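(* Let $g\in\mathrm{SL}_2(\mathbb{C})$ and $\mathbf a\in\mathbf A$, let $\breve{\mathcal O}\subseteq\mathfrak h$ be an adjoint orbit and let $\widehat{\mathcal I}_{\breve{\mathcal O},\hbar}\subseteq\widehat U(\mathfrak h^* )$ be a two-sided ideal deforming $\mathcal I_{\breve{\mathcal O}}$. The morphism $\widehat\varphi^*_{g,\hbar}(\mathbf a)\colon(\widehat A,\ast_{\mathbf a.g})\to(\widehat A,\ast_{\mathbf a})$ naturally induces a reduced morphism of algebras $$R\widehat\varphi^*_{g,\hbar}(\mathbf a)\colon R_\hbar(\widehat A,\ast_{\mathbf a.g})\longrightarrow R_\hbar(\widehat A,\ast_{\mathbf a}),$$ i.e. there is a unique algebra morphism whose composition with the canonical projection $\widehat A^{\mathfrak h}\to R_\hbar(\widehat A,\ast_{\mathbf a.g})$ equals $\widehat\varphi^*_{g,\hbar}(\mathbf a)$ (restricted to invariants) followed by the canonical projection onto $R_\hbar(\widehat A,\ast_{\mathbf a})$. Moreover, if $g'\in\mathrm{SL}_2(\mathbb{C})$ is another element then $R\widehat\varphi^*_{gg',\hbar}(\mathbf a)=R\widehat\varphi^*_{g,\hbar}(\mathbf a)\circ R\widehat\varphi^*_{g',\hbar}(\mathbf a.g)$.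
   Context: All vector spaces and algebras are over $\mathbb{C}$. Let $I=\coprod_{j\in J}I^j$ be a finite partitioned set, $V=\bigoplus_{i\in I}V_i$ a finite-dimensional $I$-graded space, $W^j=\bigoplus_{i\in I^j}V_i$. Let $\mathcal G$ be the complete multipartite quiver on nodes $I$: exactly one arrow from $i$ to $i'$ for each ordered pair of nodes lying in different parts; $\mathcal G_1$ is its set of arrows, $s,t$ are source and target, $\alpha^*$ is the arrow opposite to $\alpha$. Let $\mathbb{M}=\bigoplus_{\alpha\in\mathcal G_1}\mathrm{Hom}(V_{s(\alpha)},V_{t(\alpha)})=\bigoplus_{j\neq j'}\mathrm{Hom}(W^{j'},W^{j})$, with elements $(B_\alpha)$; fix bases of the $V_i$ and let $B_\alpha^{kl}\in\mathbb{M}^*$ be the matrix entries. Let $\mathbf A$ be the set of injective maps $\mathbf a\colon J\to\mathbb{C}\cup\{\infty\}$, $a_j:=\mathbf a(j)$. Right action of $g=\begin{pmatrix}a&b\\c&d\end{pmatrix}\in\mathrm{SL}_2(\mathbb{C})$ on $\mathbf A$: $(\mathbf a.g)(j)=-\frac{b-da_j}{a-ca_j}$ if $a_j\ne\infty$, $a\neq ca_j$; $\infty$ if $a_j\neq\infty$, $a=ca_j$; $-d/c$ if $a_j=\infty$, $c\ne0$; $\infty$ if $a_j=\infty$, $c=0$. Define $\eta_j(g,\mathbf a)$ by: $(a-ca_j)^{-1}$ if $a_j\neq\infty$, $a\ne ca_j$; $(b-da_j)^{-1}$ if $a_j\neq\infty$, $a=ca_j$; $c^{-1}$ if $a_j=\infty$,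 $c\neq0$; $a$ if $a_j=\infty$, $c=0$. For a node $i\in I^j$ put $\eta_i:=\eta_j$. For $j\neq j'\in J$ define $\varepsilon_{jj'}(\mathbf a)$ by $\varepsilon_{jj'}+\varepsilon_{j'j}=0$, $\varepsilon_{jj'}(\mathbf a)=\frac{1}{a_j-a_{j'}}$ if both are finite, $\varepsilon_{jj'}(\mathbf a)=1$ if $a_{j'}=\infty$; for an arrow $\alpha$ with $t(\alpha)\in I^j$, $s(\alpha)\in I^{j'}$ put $\varepsilon_\alpha(\mathbf a):=\varepsilon_{jj'}(\mathbf a)$. The Poisson bracket $\{\cdot,\cdot\}_{\mathbf a}$ on $A_0=\mathrm{Sym}(\mathbb{M}^* )$ is the inverse of $\omega_{\mathbf a}=\sum_\alpha\frac{\varepsilon_\alpha(\mathbf a)}2\mathrm{Tr}(dB_\alpha\wedge dB_{\alpha^*})$: $\{B_\alpha^{kl},B_\beta^{k'l'}\}_{\mathbf a}=\varepsilon_\alpha(\mathbf a)^{-1}\delta_{\alpha^*\beta}\delta_{kl'}\delta_{k'l}$. The Weyl algebra $(A,\ast_{\mathbf a})$ is $\mathrm{Tens}(\mathbb{M}^* )$ modulo the relations $f\otimes h-h\otimes f=\{f,h\}_{\mathbf a}$ ($f,h\in\mathbb{M}^*$); $\widehat f$ is the image of $f\in\mathbb{M}^*$; $\mathcal{B}_{\le k}$ is the image of $\bigoplus_{m\le k}(\mathbb{M}^* )^{\otimes m}$; $|x|=\min\{k:x\in\mathcal{B}_{\le k}\}$. Set $\widehat A=\{\sum_{k\ge0}f_k\hbar^k: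 f_k\in\mathcal{B}_{\le k},\ k-|f_k|\to+\infty\}\subseteq A[[\hbar]]$ with product induced by $\ast_{\mathbf a}$. The morphism $\widehat\varphi^*_{g,\hbar}(\mathbf a)\colon(\widehat A,\ast_{\mathbf a.g})\to(\widehat A,\ast_{\mathbf a})$ is the $\mathbb{C}[[\hbar]]$-algebra isomorphism acting on coefficients by the algebra morphism $\widehat B_\alpha^{kl}\mapsto\eta_{t(\alpha)}(g,\mathbf a)\widehat B_\alpha^{kl}$. Let $\mathfrak h=\bigoplus_{i\in I}\mathfrak{gl}(V_i)$, and give $\mathfrak h^*$ the Lie bracket transported from $\mathfrak h$ by the trace duality $X\mapsto\mathrm{Tr}(X\,\cdot)$. Let $\Lambda^i_{kl}\in\mathfrak{gl}(V_i)^*$ be the matrix entries. The quantum comoment map $\widehat\mu^*_{\mathbf a}\colon U(\mathfrak h^* )\to(A,\ast_{\mathbf a})$ is the algebra morphism with $$\widehat\mu^*_{\mathbf a}(\Lambda^i_{kl})=\tfrac12\sum_{\alpha\in t^{-1}(i)}\varepsilon_\alpha(\mathbf a)\sum_m\big(\widehat B_\alpha^{km}\ast_{\mathbf a}\widehat B_{\alpha^*}^{ml}+\widehat B_{\alpha^*}^{ml}\ast_{\mathbf a}\widehat B_\alpha^{km}\big).$$ Let $\widehat U(\mathfrak h^* )=\{\sum_kf_k\hbar^k: f_k\in U(\mathfrak h^* )_{\le k},\ k-|f_k|\to+\infty\}$ be the completed Rees algebra of $U(\mathfrak h^* )$ for its standard filtration, with semiclassical limit $\sigma_{\mathfrak h}\colon\widehat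 U(\mathfrak h^* )\to\mathrm{Sym}(\mathfrak h^* )$, sending $\sum_k f_k\hbar^k$ to the sum of the degree-$k$ symbols of $f_k$. The $\hbar$-deformed quantum comoment is the ring morphism $\widehat\mu^*_{\mathbf a,\hbar}\colon\widehat U(\mathfrak h^* )\to(\widehat A,\ast_{\mathbf a})$, $\sum_kf_k\hbar^k\mapsto\sum_k\widehat\mu^*_{\mathbf a}(f_k)\hbar^{2k}$ (so $\Lambda\hbar\mapsto\widehat\mu^*_{\mathbf a}(\Lambda)\hbar^2$ for $\Lambda\in\mathfrak h^*$). $\mathcal I_{\breve{\mathcal O}}\subseteq\mathrm{Sym}(\mathfrak h^* )=\mathbb{C}[\mathfrak h]$ is the ideal of functions vanishing on $\breve{\mathcal O}$. A two-sided ideal $\widehat{\mathcal I}\subseteq\widehat U(\mathfrak h^* )$ deforms it if $\sigma_{\mathfrak h}(\widehat{\mathcal I})=\mathcal I_{\breve{\mathcal O}}$ and $\widehat U(\mathfrak h^* )/\widehat{\mathcal I}$ is a topologically free $\mathbb{C}[[\hbar]]$-module. The invariants are $\widehat A^{\mathfrak h}=\{x\in\widehat A: [\widehat\mu^*_{\mathbf a}(\Lambda),x]=0\ \forall\Lambda\in\mathfrak h^*\}$, with commutator taken coefficientwise in $(A,\ast_{\mathbf a})$. With $\widehat{\mathcal J}_{\mathbf a}$ the two-sided ideal of $(\widehat A,\ast_{\mathbf a})$ generated by $\widehat\mu^*_{\mathbf a,\hbar}(\widehat{\mathcal I}_{\breve{\mathcal O},\hbar})$, the quantum Hamiltonian reduction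 is $R_\hbar(\widehat A,\ast_{\mathbf a})=\widehat A^{\mathfrak h}/(\widehat{\mathcal J}_{\mathbf a}\cap\widehat A^{\mathfrak h})$. *)

theory Defs
  imports
    "HOL-Library.Poly_Mapping"
    "HOL-Library.Multiset"
    "HOL-Computational_Algebra.Formal_Power_Series"
    "HOL-Algebra.QuotRing"
    "HOL-Algebra.Module"
    "Jordan_Normal_Form.Determinant"
    "Jordan_Normal_Form.VS_Connect"
begin

section \<open>Algebras over a commutative ring of scalars\<close>

text \<open>
  An algebra is a record of type \<open>('k, 'a) module\<close> (a ring with scalar multiplication), where
  the type \<open>'k\<close> of scalars is \<open>complex\<close> or \<open>complex fps\<close>. (The library locale \<open>algebra\<close>
  is not used, as it requires commutativity.)
\<close>

definition alg_hom :: "('k, 'a) module \<Rightarrow> ('k, 'b) module \<Rightarrow> ('a \<Rightarrow> 'b) set" where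
  "alg_hom A B =
     {f \<in> Ring.ring_hom A B. \<forall>c. \<forall>x\<in>carrier A. f (c \<odot>\<^bsub>A\<^esub> x) = c \<odot>\<^bsub>B\<^esub> f x}"

definition alg_quot :: "('k, 'a) module \<Rightarrow> 'a set \<Rightarrow> ('k, 'a set) module" where
  "alg_quot A J =
     \<lparr>carrier = carrier (A Quot J), mult = mult (A Quot J), one = one (A Quot J),
      zero = zero (A Quot J), add = add (A Quot J),
      smult = (\<lambda>c X. \<Union>x\<in>X. J +>\<^bsub>A\<^esub> (c \<odot>\<^bsub>A\<^esub> x))\<rparr>"

text \<open>\<open>A[[\<hbar>]]\<close>; the series \<open>\<Sum>k. f\<^sub>k \<hbar>\<^sup>k\<close> is the sequence of its coefficients. For a bare vector
  space \<open>A\<close> only the \<open>\<complex>[[\<hbar>]]\<close>-module part is meaningful.\<close>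
definition power_series :: "(complex, 'a) module \<Rightarrow> (complex fps, nat \<Rightarrow> 'a) module" where
  "power_series A =
     \<lparr>carrier = {f. \<forall>k. f k \<in> carrier A},
      mult = (\<lambda>f h n. \<Oplus>\<^bsub>A\<^esub>i\<in>{..n}. f i \<otimes>\<^bsub>A\<^esub> h (n - i)),
      one = (\<lambda>n. if n = 0 then \<one>\<^bsub>A\<^esub> else \<zero>\<^bsub>A\<^esub>),
      zero = (\<lambda>n. \<zero>\<^bsub>A\<^esub>),
      add = (\<lambda>f h n. f n \<oplus>\<^bsub>A\<^esub> h n),
      smult = (\<lambda>c f n. \<Oplus>\<^bsub>A\<^esub>i\<in>{..n}. fps_nth c i \<odot>\<^bsub>A\<^esub> f (n - i))\<rparr>"

text \<open>A \<open>\<complex>[[\<hbar>]]\<close>-module \<open>M\<close> is topologically free if it is isomorphic to \<open>V[[\<hbar>]]\<close> for a complex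
  vector space \<open>V\<close>. Such a \<open>V\<close> embeds in \<open>M\<close> as the constant series, so there is no loss in
  letting its elements have the same type as those of \<open>M\<close>.\<close>
definition topologically_free :: "(complex fps, 'm) module \<Rightarrow> bool" where
  "topologically_free M \<longleftrightarrow>
     (\<exists>(V :: (complex, 'm) module) \<Phi>.
        module (class_ring :: complex ring) V \<and>
        bij_betw \<Phi> (carrier (power_series V)) (carrier M) \<and>
        (\<forall>u\<in>carrier (power_series V). \<forall>v\<in>carrier (power_series V).
           \<Phi> (u \<oplus>\<^bsub>power_series V\<^esub> v) = \<Phi> u \<oplus>\<^bsub>M\<^esub> \<Phi> v) \<and>
        (\<forall>c. \<forall>v\<in>carrier (power_series V). \<Phi> (c \<odot>\<^bsub>power_series V\<^esub> v) = c \<odot>\<^bsub>M\<^esub> \<Phi> v))"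

section \<open>Tensor algebras and their filtered quotients\<close>

text \<open>Words form a monoid under concatenation, so that \<open>'x list \<Rightarrow>\<^sub>0 complex\<close> is the ring of
  noncommutative polynomials.\<close>
instantiation list :: (type) monoid_add
begin
definition zero_list :: "'a list" where "zero_list = []"
definition plus_list :: "'a list \<Rightarrow> 'a list \<Rightarrow> 'a list" where "plus_list = (@)"
instance by standard (simp_all add: zero_list_def plus_list_def)
end

text \<open>The tensor algebra of the vector space with basis \<open>X\<close>.\<close>
definition tensor_alg :: "'x set \<Rightarrow> (complex, 'x list \<Rightarrow>\<^sub>0 complex) module" where
  "tensor_alg X =
     \<lparr>carrier = {p. \<forall>w\<in>Poly_Mapping.keys p. set w \<subseteq> X}, mult = (*), one = 1, zero = 0, add = (+),
      smult = (\<lambda>c. Poly_Mapping.map ((*) c))\<rparr>"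

definition gen :: "'x \<Rightarrow> 'x list \<Rightarrow>\<^sub>0 complex" where
  "gen x = Poly_Mapping.single [x] 1"

text \<open>The vector space with basis \<open>X\<close>, as the degree-one part of its tensor algebra.\<close>
definition lin_part :: "'x set \<Rightarrow> ('x list \<Rightarrow>\<^sub>0 complex) set" where
  "lin_part X = {p. Poly_Mapping.keys p \<subseteq> (\<lambda>x. [x]) ` X}"

definition tensor_le :: "'x set \<Rightarrow> nat \<Rightarrow> ('x list \<Rightarrow>\<^sub>0 complex) set" where
  "tensor_le X k = {p \<in> carrier (tensor_alg X). \<forall>w\<in>Poly_Mapping.keys p. length w \<le> k}"

type_synonym 'x pres_elt = "('x list \<Rightarrow>\<^sub>0 complex) set"

definition pres_alg :: "'x set \<Rightarrow> ('x list \<Rightarrow>\<^sub>0 complex) set \<Rightarrow> (complex, 'x pres_elt) module" where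
  "pres_alg X S = alg_quot (tensor_alg X) (Idl\<^bsub>tensor_alg X\<^esub> S)"

definition pres_class ::
    "'x set \<Rightarrow> ('x list \<Rightarrow>\<^sub>0 complex) set \<Rightarrow> ('x list \<Rightarrow>\<^sub>0 complex) \<Rightarrow> 'x pres_elt" where
  "pres_class X S p = (Idl\<^bsub>tensor_alg X\<^esub> S) +>\<^bsub>tensor_alg X\<^esub> p"

definition pres_le :: "'x set \<Rightarrow> ('x list \<Rightarrow>\<^sub>0 complex) set \<Rightarrow> nat \<Rightarrow> 'x pres_elt set" where
  "pres_le X S k = pres_class X S ` tensor_le X k"

definition pres_deg :: "'x set \<Rightarrow> ('x list \<Rightarrow>\<^sub>0 complex) set \<Rightarrow> 'x pres_elt \<Rightarrow> nat" where
  "pres_deg X S f = (LEAST k. f \<in> pres_le X S k)"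

text \<open>There is at most one such morphism, and there is one exactly when the values \<open>v\<close> satisfy the
  relations \<open>S\<close>; it is only used in that case.\<close>
definition pres_hom ::
    "'x set \<Rightarrow> ('x list \<Rightarrow>\<^sub>0 complex) set \<Rightarrow> (complex, 'b) module \<Rightarrow> ('x \<Rightarrow> 'b) \<Rightarrow> 'x pres_elt \<Rightarrow> 'b"
  where
  "pres_hom X S B v =
     (THE f. f \<in> alg_hom (pres_alg X S) B \<and> f \<in> extensional (carrier (pres_alg X S)) \<and>
             (\<forall>x\<in>X. f (pres_class X S (gen x)) = v x))"

definition rees ::
    "'x set \<Rightarrow> ('x list \<Rightarrow>\<^sub>0 complex) set \<Rightarrow> (complex fps, nat \<Rightarrow> 'x pres_elt) module" where
  "rees X S =
     (power_series (pres_alg X S))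
       \<lparr>carrier := {f. (\<forall>k. f k \<in> pres_le X S k) \<and>
                      filterlim (\<lambda>k. int k - int (pres_deg X S (f k))) at_top sequentially}\<rparr>"

section \<open>The parameters and the action of the special linear group\<close>

datatype cp1 = Fin complex | Infty

definition SL2 :: "complex mat set" where
  "SL2 = {g \<in> carrier_mat 2 2. det g = 1}"

fun act_pt :: "complex mat \<Rightarrow> cp1 \<Rightarrow> cp1" where
  "act_pt g (Fin x) =
     (if g $$ (0,0) \<noteq> g $$ (1,0) * x
      then Fin (- ((g $$ (0,1) - g $$ (1,1) * x) / (g $$ (0,0) - g $$ (1,0) * x)))
      else Infty)"
| "act_pt g Infty =
     (if g $$ (1,0) \<noteq> 0 then Fin (- (g $$ (1,1) / g $$ (1,0))) else Infty)"

definition act :: "('j \<Rightarrow> cp1) \<Rightarrow> complex mat \<Rightarrow> 'j \<Rightarrow> cp1" where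
  "act a g = (\<lambda>j. act_pt g (a j))"

fun eta_pt :: "complex mat \<Rightarrow> cp1 \<Rightarrow> complex" where
  "eta_pt g (Fin x) =
     (if g $$ (0,0) \<noteq> g $$ (1,0) * x
      then inverse (g $$ (0,0) - g $$ (1,0) * x)
      else inverse (g $$ (0,1) - g $$ (1,1) * x))"
| "eta_pt g Infty = (if g $$ (1,0) \<noteq> 0 then inverse (g $$ (1,0)) else g $$ (0,0))"

definition eta :: "complex mat \<Rightarrow> ('j \<Rightarrow> cp1) \<Rightarrow> 'j \<Rightarrow> complex" where
  "eta g a j = eta_pt g (a j)"

text \<open>The last equation is never used for distinct indices, since the maps \<open>a\<close> are injective.\<close>
fun eps_pt :: "cp1 \<Rightarrow> cp1 \<Rightarrow> complex" where
  "eps_pt (Fin x) (Fin y) = 1 / (x - y)"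
| "eps_pt (Fin x) Infty = 1"
| "eps_pt Infty (Fin y) = - 1"
| "eps_pt Infty Infty = 0"

definition eps :: "('j \<Rightarrow> cp1) \<Rightarrow> 'j \<Rightarrow> 'j \<Rightarrow> complex" where
  "eps a j j' = eps_pt (a j) (a j')"

section \<open>The quiver and the Weyl algebra\<close>

text \<open>
  The nodes are the elements of a finite type \<open>'i\<close>; the map \<open>part\<close> sends a node to the index
  of its part, and \<open>V\<^sub>i\<close> is \<open>\<complex>\<close> to the power \<open>d i\<close> with its standard basis.
  An arrow is the pair of its source and its target.
\<close>

type_synonym 'i arrow = "'i \<times> 'i"

definition arrows :: "('i \<Rightarrow> 'j) \<Rightarrow> 'i arrow set" where
  "arrows part = {\<alpha>. part (fst \<alpha>) \<noteq> part (snd \<alpha>)}"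

definition opp :: "'i arrow \<Rightarrow> 'i arrow" where
  "opp \<alpha> = (snd \<alpha>, fst \<alpha>)"

definition eps_arrow :: "('i \<Rightarrow> 'j) \<Rightarrow> ('j \<Rightarrow> cp1) \<Rightarrow> 'i arrow \<Rightarrow> complex" where
  "eps_arrow part a \<alpha> = eps a (part (snd \<alpha>)) (part (fst \<alpha>))"

text \<open>\<open>(\<alpha>, k, l)\<close> stands for the matrix entry \<open>B\<^sub>\<alpha>\<^sup>k\<^sup>l\<close>, and \<open>(i, k, l)\<close> for \<open>\<Lambda>\<^sup>i\<^sub>k\<^sub>l\<close>; they form
  bases of the duals of \<open>\<M>\<close> and \<open>\<hh>\<close> respectively.\<close>

type_synonym 'i bvar = "'i arrow \<times> nat \<times> nat"
type_synonym 'i hvar = "'i \<times> nat \<times> nat"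

definition bvars :: "('i \<Rightarrow> 'j) \<Rightarrow> ('i \<Rightarrow> nat) \<Rightarrow> 'i bvar set" where
  "bvars part d = {(\<alpha>, k, l). \<alpha> \<in> arrows part \<and> k < d (snd \<alpha>) \<and> l < d (fst \<alpha>)}"

definition hvars :: "('i \<Rightarrow> nat) \<Rightarrow> 'i hvar set" where
  "hvars d = {(i, k, l). k < d i \<and> l < d i}"

fun bracket_var :: "('i \<Rightarrow> 'j) \<Rightarrow> ('j \<Rightarrow> cp1) \<Rightarrow> 'i bvar \<Rightarrow> 'i bvar \<Rightarrow> complex" where
  "bracket_var part a (\<alpha>, k, l) (\<beta>, k', l') =
     (if opp \<alpha> = \<beta> \<and> k = l' \<and> k' = l then inverse (eps_arrow part a \<alpha>) else 0)"

definition bracket ::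
    "('i \<Rightarrow> 'j) \<Rightarrow> ('i \<Rightarrow> nat) \<Rightarrow> ('j \<Rightarrow> cp1) \<Rightarrow>
     ('i bvar list \<Rightarrow>\<^sub>0 complex) \<Rightarrow> ('i bvar list \<Rightarrow>\<^sub>0 complex) \<Rightarrow> complex" where
  "bracket part d a f h =
     (\<Sum>x\<in>bvars part d. \<Sum>y\<in>bvars part d.
        Poly_Mapping.lookup f [x] * Poly_Mapping.lookup h [y] * bracket_var part a x y)"

definition weyl_rels ::
    "('i \<Rightarrow> 'j) \<Rightarrow> ('i \<Rightarrow> nat) \<Rightarrow> ('j \<Rightarrow> cp1) \<Rightarrow> ('i bvar list \<Rightarrow>\<^sub>0 complex) set" where
  "weyl_rels part d a =
     {f * h - h * f - Poly_Mapping.single [] (bracket part d a f h) | f h.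
        f \<in> lin_part (bvars part d) \<and> h \<in> lin_part (bvars part d)}"

definition weyl ::
    "('i \<Rightarrow> 'j) \<Rightarrow> ('i \<Rightarrow> nat) \<Rightarrow> ('j \<Rightarrow> cp1) \<Rightarrow> (complex, 'i bvar pres_elt) module" where
  "weyl part d a = pres_alg (bvars part d) (weyl_rels part d a)"

definition Bhat ::
    "('i \<Rightarrow> 'j) \<Rightarrow> ('i \<Rightarrow> nat) \<Rightarrow> ('j \<Rightarrow> cp1) \<Rightarrow> 'i arrow \<Rightarrow> nat \<Rightarrow> nat \<Rightarrow> 'i bvar pres_elt" where
  "Bhat part d a \<alpha> k l = pres_class (bvars part d) (weyl_rels part d a) (gen (\<alpha>, k, l))"

definition Ahat ::
    "('i \<Rightarrow> 'j) \<Rightarrow> ('i \<Rightarrow> nat) \<Rightarrow> ('j \<Rightarrow> cp1) \<Rightarrow> (complex fps, nat \<Rightarrow> 'i bvar pres_elt) module" where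
  "Ahat part d a = rees (bvars part d) (weyl_rels part d a)"

text \<open>The morphism from the Weyl algebra at \<open>a.g\<close> to the Weyl algebra at \<open>a\<close>, and its
  coefficientwise extension.\<close>

definition phi ::
    "('i \<Rightarrow> 'j) \<Rightarrow> ('i \<Rightarrow> nat) \<Rightarrow> complex mat \<Rightarrow> ('j \<Rightarrow> cp1) \<Rightarrow> 'i bvar pres_elt \<Rightarrow> 'i bvar pres_elt"
  where
  "phi part d g a =
     pres_hom (bvars part d) (weyl_rels part d (act a g)) (weyl part d a)
       (\<lambda>(\<alpha>, k, l). eta g a (part (snd \<alpha>)) \<odot>\<^bsub>weyl part d a\<^esub> Bhat part d a \<alpha> k l)"

definition phi_hbar ::
    "('i \<Rightarrow> 'j) \<Rightarrow> ('i \<Rightarrow> nat) \<Rightarrow> complex mat \<Rightarrow> ('j \<Rightarrow> cp1) \<Rightarrow>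
     (nat \<Rightarrow> 'i bvar pres_elt) \<Rightarrow> nat \<Rightarrow> 'i bvar pres_elt" where
  "phi_hbar part d g a f = (\<lambda>k. phi part d g a (f k))"

section \<open>The Lie algebra and its enveloping algebra\<close>

definition lie_h :: "('i \<Rightarrow> nat) \<Rightarrow> ('i \<Rightarrow> complex mat) set" where
  "lie_h d = {X. \<forall>i. X i \<in> carrier_mat (d i) (d i)}"

definition commutator :: "('i \<Rightarrow> complex mat) \<Rightarrow> ('i \<Rightarrow> complex mat) \<Rightarrow> 'i \<Rightarrow> complex mat" where
  "commutator X Y = (\<lambda>i. X i * Y i - Y i * X i)"

text \<open>The linear form \<open>Y \<mapsto> Tr (X Y) = \<Sum>i k l. (X\<^sub>i)\<^sub>l\<^sub>k (Y\<^sub>i)\<^sub>k\<^sub>l\<close>, expanded in the matrix entries.\<close>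
definition trace_form :: "('i \<Rightarrow> nat) \<Rightarrow> ('i \<Rightarrow> complex mat) \<Rightarrow> 'i hvar list \<Rightarrow>\<^sub>0 complex" where
  "trace_form d X = (\<Sum>(i, k, l)\<in>hvars d. Poly_Mapping.single [(i, k, l)] (X i $$ (l, k)))"

definition env_rels :: "('i \<Rightarrow> nat) \<Rightarrow> ('i hvar list \<Rightarrow>\<^sub>0 complex) set" where
  "env_rels d =
     {trace_form d X * trace_form d Y - trace_form d Y * trace_form d X
        - trace_form d (commutator X Y) | X Y. X \<in> lie_h d \<and> Y \<in> lie_h d}"

definition env :: "('i \<Rightarrow> nat) \<Rightarrow> (complex, 'i hvar pres_elt) module" where
  "env d = pres_alg (hvars d) (env_rels d)"

definition Uhat :: "('i \<Rightarrow> nat) \<Rightarrow> (complex fps, nat \<Rightarrow> 'i hvar pres_elt) module" where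
  "Uhat d = rees (hvars d) (env_rels d)"

text \<open>The symmetric algebra of the dual of \<open>\<hh>\<close> consists of the commutative polynomials in the matrix
  entries; a monomial is the multiset of its factors.\<close>

type_synonym 'i sym_elt = "'i hvar multiset \<Rightarrow>\<^sub>0 complex"

definition sym_carrier :: "('i \<Rightarrow> nat) \<Rightarrow> 'i sym_elt set" where
  "sym_carrier d = {p. \<forall>m\<in>Poly_Mapping.keys p. set_mset m \<subseteq> hvars d}"

definition sym_eval :: "'i sym_elt \<Rightarrow> ('i \<Rightarrow> complex mat) \<Rightarrow> complex" where
  "sym_eval p X =
     (\<Sum>m\<in>Poly_Mapping.keys p.
        Poly_Mapping.lookup p m * (\<Prod>(i, k, l)\<in>#m. X i $$ (k, l)))"

definition vanishing_ideal :: "('i \<Rightarrow> nat) \<Rightarrow> ('i \<Rightarrow> complex mat) set \<Rightarrow> 'i sym_elt set" where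
  "vanishing_ideal d Orb = {p \<in> sym_carrier d. \<forall>X\<in>Orb. sym_eval p X = 0}"

definition abelianise_top :: "nat \<Rightarrow> ('i hvar list \<Rightarrow>\<^sub>0 complex) \<Rightarrow> 'i sym_elt" where
  "abelianise_top k p =
     (\<Sum>w\<in>{w \<in> Poly_Mapping.keys p. length w = k}.
        Poly_Mapping.single (mset w) (Poly_Mapping.lookup p w))"

text \<open>The degree-\<open>k\<close> symbol of an element of filtration degree at most \<open>k\<close>; it does not depend on
  the representing tensor by the Poincare-Birkhoff-Witt theorem.\<close>
definition symbol :: "('i \<Rightarrow> nat) \<Rightarrow> nat \<Rightarrow> 'i hvar pres_elt \<Rightarrow> 'i sym_elt" where
  "symbol d k f =
     (THE s. \<exists>p\<in>tensor_le (hvars d) k.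
        pres_class (hvars d) (env_rels d) p = f \<and> s = abelianise_top k p)"

text \<open>Only finitely many symbols are nonzero, since \<open>k - |f\<^sub>k|\<close> tends to infinity.\<close>
definition sigma :: "('i \<Rightarrow> nat) \<Rightarrow> (nat \<Rightarrow> 'i hvar pres_elt) \<Rightarrow> 'i sym_elt" where
  "sigma d f = (\<Sum>k\<in>{k. symbol d k (f k) \<noteq> 0}. symbol d k (f k))"

definition adjoint_orbit :: "('i \<Rightarrow> nat) \<Rightarrow> ('i \<Rightarrow> complex mat) \<Rightarrow> ('i \<Rightarrow> complex mat) set" where
  "adjoint_orbit d X =
     {\<lambda>i. P i * X i * Q i | P Q.
        P \<in> lie_h d \<and> Q \<in> lie_h d \<and> (\<forall>i. P i * Q i = 1\<^sub>m (d i) \<and> Q i * P i = 1\<^sub>m (d i))}"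

definition deforms ::
    "('i \<Rightarrow> nat) \<Rightarrow> (nat \<Rightarrow> 'i hvar pres_elt) set \<Rightarrow> ('i \<Rightarrow> complex mat) set \<Rightarrow> bool" where
  "deforms d I Orb \<longleftrightarrow>
     ideal I (Uhat d) \<and> sigma d ` I = vanishing_ideal d Orb \<and>
     topologically_free (alg_quot (Uhat d) I)"

section \<open>Comoment maps and quantum Hamiltonian reduction\<close>

definition comoment ::
    "('i \<Rightarrow> 'j) \<Rightarrow> ('i \<Rightarrow> nat) \<Rightarrow> ('j \<Rightarrow> cp1) \<Rightarrow> 'i hvar pres_elt \<Rightarrow> 'i bvar pres_elt" where
  "comoment part d a =
     pres_hom (hvars d) (env_rels d) (weyl part d a)
       (\<lambda>(i, k, l). (1/2) \<odot>\<^bsub>weyl part d a\<^esub>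
          (\<Oplus>\<^bsub>weyl part d a\<^esub>\<alpha>\<in>{\<alpha> \<in> arrows part. snd \<alpha> = i}.
             eps_arrow part a \<alpha> \<odot>\<^bsub>weyl part d a\<^esub>
               (\<Oplus>\<^bsub>weyl part d a\<^esub>m\<in>{..<d (fst \<alpha>)}.
                  Bhat part d a \<alpha> k m \<otimes>\<^bsub>weyl part d a\<^esub> Bhat part d a (opp \<alpha>) m l
                  \<oplus>\<^bsub>weyl part d a\<^esub>
                  Bhat part d a (opp \<alpha>) m l \<otimes>\<^bsub>weyl part d a\<^esub> Bhat part d a \<alpha> k m)))"

definition comoment_hbar ::
    "('i \<Rightarrow> 'j) \<Rightarrow> ('i \<Rightarrow> nat) \<Rightarrow> ('j \<Rightarrow> cp1) \<Rightarrow>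
     (nat \<Rightarrow> 'i hvar pres_elt) \<Rightarrow> nat \<Rightarrow> 'i bvar pres_elt" where
  "comoment_hbar part d a f =
     (\<lambda>n. if even n then comoment part d a (f (n div 2)) else \<zero>\<^bsub>weyl part d a\<^esub>)"

definition invariants ::
    "('i \<Rightarrow> 'j) \<Rightarrow> ('i \<Rightarrow> nat) \<Rightarrow> ('j \<Rightarrow> cp1) \<Rightarrow> (nat \<Rightarrow> 'i bvar pres_elt) set" where
  "invariants part d a =
     {x \<in> carrier (Ahat part d a).
        \<forall>\<Lambda>\<in>pres_class (hvars d) (env_rels d) ` lin_part (hvars d). \<forall>k.
          comoment part d a \<Lambda> \<otimes>\<^bsub>weyl part d a\<^esub> x k
          \<ominus>\<^bsub>weyl part d a\<^esub> x k \<otimes>\<^bsub>weyl part d a\<^esub> comoment part d a \<Lambda> = \<zero>\<^bsub>weyl part d a\<^esub>}"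

definition inv_alg ::
    "('i \<Rightarrow> 'j) \<Rightarrow> ('i \<Rightarrow> nat) \<Rightarrow> ('j \<Rightarrow> cp1) \<Rightarrow> (complex fps, nat \<Rightarrow> 'i bvar pres_elt) module" where
  "inv_alg part d a = (Ahat part d a)\<lparr>carrier := invariants part d a\<rparr>"

definition red_ideal ::
    "('i \<Rightarrow> 'j) \<Rightarrow> ('i \<Rightarrow> nat) \<Rightarrow> (nat \<Rightarrow> 'i hvar pres_elt) set \<Rightarrow> ('j \<Rightarrow> cp1) \<Rightarrow>
     (nat \<Rightarrow> 'i bvar pres_elt) set" where
  "red_ideal part d I a =
     (Idl\<^bsub>Ahat part d a\<^esub> (comoment_hbar part d a ` I)) \<inter> invariants part d a"

definition reduction ::
    "('i \<Rightarrow> 'j) \<Rightarrow> ('i \<Rightarrow> nat) \<Rightarrow> (nat \<Rightarrow> 'i hvar pres_elt) set \<Rightarrow> ('j \<Rightarrow> cp1) \<Rightarrow>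
     (complex fps, (nat \<Rightarrow> 'i bvar pres_elt) set) module" where
  "reduction part d I a = alg_quot (inv_alg part d a) (red_ideal part d I a)"

definition red_proj ::
    "('i \<Rightarrow> 'j) \<Rightarrow> ('i \<Rightarrow> nat) \<Rightarrow> (nat \<Rightarrow> 'i hvar pres_elt) set \<Rightarrow> ('j \<Rightarrow> cp1) \<Rightarrow>
     (nat \<Rightarrow> 'i bvar pres_elt) \<Rightarrow> (nat \<Rightarrow> 'i bvar pres_elt) set" where
  "red_proj part d I a x = red_ideal part d I a +>\<^bsub>inv_alg part d a\<^esub> x"

definition is_reduced_morphism ::
    "('i \<Rightarrow> 'j) \<Rightarrow> ('i \<Rightarrow> nat) \<Rightarrow> (nat \<Rightarrow> 'i hvar pres_elt) set \<Rightarrow> complex mat \<Rightarrow> ('j \<Rightarrow> cp1) \<Rightarrow>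
     ((nat \<Rightarrow> 'i bvar pres_elt) set \<Rightarrow> (nat \<Rightarrow> 'i bvar pres_elt) set) \<Rightarrow> bool" where
  "is_reduced_morphism part d I g a F \<longleftrightarrow>
     F \<in> alg_hom (reduction part d I (act a g)) (reduction part d I a) \<and>
     F \<in> extensional (carrier (reduction part d I (act a g))) \<and>
     (\<forall>x\<in>invariants part d (act a g).
        F (red_proj part d I (act a g) x) = red_proj part d I a (phi_hbar part d g a x))"

definition reduced_morphism ::
    "('i \<Rightarrow> 'j) \<Rightarrow> ('i \<Rightarrow> nat) \<Rightarrow> (nat \<Rightarrow> 'i hvar pres_elt) set \<Rightarrow> complex mat \<Rightarrow> ('j \<Rightarrow> cp1) \<Rightarrow>
     (nat \<Rightarrow> 'i bvar pres_elt) set \<Rightarrow> (nat \<Rightarrow> 'i bvar pres_elt) set" where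
  "reduced_morphism part d I g a = (THE F. is_reduced_morphism part d I g a F)"

end

theory Submission
  imports Defs "HOL-Algebra.Subrings"
begin

text \<open>
  The morphism at \<open>g\<close> multiplies the generators of an arrow \<open>\<alpha>\<close> by \<open>\<eta>\<close> at the target of \<open>\<alpha>\<close>. Two identities
  for Moebius transformations carry the proof:

  \<^item> covariance, \<open>\<epsilon>\<^sub>j\<^sub>k(a.g) \<eta>\<^sub>j(g, a) \<eta>\<^sub>k(g, a) = \<epsilon>\<^sub>j\<^sub>k(a)\<close> (lemma \<open>eps_covariant\<close>);
  \<^item> the cocycle property, \<open>\<eta>\<^sub>j(g g', a) = \<eta>\<^sub>j(g, a) \<eta>\<^sub>j(g', a.g)\<close> (lemma \<open>eta_mult\<close>).

  Every structure involved couples an arrow only with its opposite, so that rescaling contributes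
  the product of the two factors at its ends. By covariance this product is compensated by the
  change of \<open>\<epsilon>\<close>. Hence the Weyl relations at \<open>a.g\<close> go to those at \<open>a\<close> (\<open>rescale_weyl_rels\<close>), and the comoment
  map at \<open>a.g\<close> followed by the morphism is the comoment map at \<open>a\<close> (\<open>phi_comoment\<close>). The morphism
  therefore maps invariants to invariants and the ideal generated by the image of the comoment
  map to the corresponding ideal, and descends uniquely to the reductions
  (\<open>reduced_morphism_unique\<close>). The cocycle property makes the morphisms compose before reduction
  (\<open>phi_hbar_mult\<close>), and by uniqueness they compose after it.

  The algebras are quotients of tensor algebras, and morphisms out of them are computed by substitution
  in tensors (\<open>pres_hom_substitution\<close>). With this description the two compatibilities above are
  equalities of free tensors. Computations modulo the Weyl relations
  occur only in the existence of the comoment map, that is, in the proof that it respects the Lie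
  bracket (\<open>ad_rel_moment\<close>). Commutators
  with the quadratic element attached to \<open>X\<close> act on the generators \<open>B\<^sub>\<alpha>\<close> by \<open>B\<^sub>\<alpha> X - X B\<^sub>\<alpha>\<close>, which is where
  \<open>\<epsilon>\<^sub>\<alpha> \<noteq> 0\<close>, and thus the injectivity of \<open>a\<close>, is used. Symmetrisation of the quadratic elements excludes central
  corrections.

  Completed Rees algebras are handled as subrings of formal power series; the ring axioms
  come from lifting coefficients to the tensor algebra, and the growth condition is
  rephrased by the filtration (\<open>rees_carrier_iff\<close>).
\<close>

section \<open>Rings with scalars and their quotients\<close>

text \<open>Scalars need only act additively and commute with right multiplication. Then scaling by \<open>c\<close> is
  left multiplication by the element \<open>c \<odot> \<one>\<close>, so that every ideal is stable under scalars. The same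
  axioms serve for complex algebras and for algebras over formal power series.\<close>
locale scaled_ring = ring A for A :: "('k, 'a) module" (structure) +
  assumes smult_closed: "x \<in> carrier A \<Longrightarrow> c \<odot> x \<in> carrier A"
    and smult_add: "\<lbrakk>x \<in> carrier A; y \<in> carrier A\<rbrakk> \<Longrightarrow> c \<odot> (x \<oplus> y) = c \<odot> x \<oplus> c \<odot> y"
    and smult_mult: "\<lbrakk>x \<in> carrier A; y \<in> carrier A\<rbrakk> \<Longrightarrow> (c \<odot> x) \<otimes> y = c \<odot> (x \<otimes> y)"

text \<open>The ring axioms see only the five ring fields of a record, so they pass from the quotient ring
  of the library to the same quotient with a scalar multiplication added.\<close>
lemma ring_cong:
  fixes R :: "('a, 'm) ring_scheme" and S :: "('a, 'n) ring_scheme"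
  assumes "ring R" "carrier S = carrier R" "mult S = mult R" "one S = one R"
    "zero S = zero R" "add S = add R"
  shows "ring S"
proof -
  interpret ring R by fact
  show ?thesis
    by (rule ringI, rule abelian_groupI, unfold assms(2-))
      (auto simp: a_ac l_distr r_distr m_assoc intro: monoidI dest: a_inv_closed
        intro!: bexI[of _ "\<ominus>\<^bsub>R\<^esub> _"] l_neg monoid.intro[of S, unfolded assms(2-)])
qed

context scaled_ring
begin

lemma ideal_smult_closed:
  assumes "ideal J A" "x \<in> J"
  shows "c \<odot> x \<in> J"
proof -
  interpret J: ideal J A by fact
  have "c \<odot> x = (c \<odot> \<one>) \<otimes> x"
    using assms(2) by (simp add: smult_mult)
  then show ?thesis
    using J.I_l_closed[OF assms(2)] smult_closed by simp
qed

lemma alg_quot_carrier: "carrier (alg_quot A J) = (\<lambda>x. J +> x) ` carrier A"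
  unfolding alg_quot_def FactRing_def A_RCOSETS_def RCOSETS_def a_r_coset_def by auto

lemma alg_quot_coset_eq_iff:
  assumes "ideal J A" "x \<in> carrier A" "y \<in> carrier A"
  shows "J +> x = J +> y \<longleftrightarrow> x \<ominus> y \<in> J"
  by (metis assms quotient_eq_iff_same_a_r_cos)

lemma alg_quot_add:
  assumes "ideal J A" "x \<in> carrier A" "y \<in> carrier A"
  shows "(J +> x) \<oplus>\<^bsub>alg_quot A J\<^esub> (J +> y) = J +> (x \<oplus> y)"
proof -
  interpret J: ideal J A by fact
  show ?thesis using assms(2,3) by (simp add: alg_quot_def FactRing_def J.a_rcos_sum)
qed

lemma alg_quot_mult:
  assumes "ideal J A" "x \<in> carrier A" "y \<in> carrier A"
  shows "(J +> x) \<otimes>\<^bsub>alg_quot A J\<^esub> (J +> y) = J +> (x \<otimes> y)"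
proof -
  interpret J: ideal J A by fact
  show ?thesis using assms(2,3) by (simp add: alg_quot_def FactRing_def J.rcoset_mult_add)
qed

lemma alg_quot_one: "\<one>\<^bsub>alg_quot A J\<^esub> = J +> \<one>"
  by (simp add: alg_quot_def FactRing_def)

lemma alg_quot_zero:
  assumes "ideal J A"
  shows "\<zero>\<^bsub>alg_quot A J\<^esub> = J +> \<zero>"
proof -
  interpret J: ideal J A by fact
  show ?thesis by (simp add: alg_quot_def FactRing_def J.a_subset)
qed

text \<open>The union that defines the scalar multiplication collapses to one coset, because all
  representatives of a coset differ by elements of the ideal, which is stable under scalars.\<close>
lemma alg_quot_smult:
  assumes "ideal J A" "x \<in> carrier A"
  shows "c \<odot>\<^bsub>alg_quot A J\<^esub> (J +> x) = J +> (c \<odot> x)"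
proof -
  interpret J: ideal J A by fact
  have "J +> (c \<odot> y) = J +> (c \<odot> x)" if y: "y \<in> J +> x" for y
  proof -
    obtain z where z: "z \<in> J" "y = z \<oplus> x"
      using y unfolding a_r_coset_def r_coset_def by auto
    have "c \<odot> y = c \<odot> z \<oplus> c \<odot> x"
      using z assms(2) by (simp add: smult_add)
    then have "c \<odot> y \<in> J +> (c \<odot> x)"
      using ideal_smult_closed[OF assms(1) z(1)] unfolding a_r_coset_def r_coset_def by auto
    then show ?thesis
      using J.a_repr_independence'[OF _ smult_closed[OF assms(2)]] by simp
  qed
  then have "(\<Union>y\<in>J +> x. J +> (c \<odot> y)) = (\<Union>y\<in>J +> x. J +> (c \<odot> x))"
    by (rule SUP_cong[OF refl])
  moreover have "J +> x \<noteq> {}"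
    using J.a_rcos_self[OF assms(2)] by blast
  ultimately show ?thesis
    by (simp add: alg_quot_def)
qed

lemma alg_quot_scaled_ring:
  assumes "ideal J A"
  shows "scaled_ring (alg_quot A J)"
proof -
  interpret J: ideal J A by fact
  have "ring (alg_quot A J)"
    by (rule ring_cong[OF J.quotient_is_ring]) (simp_all add: alg_quot_def)
  then show ?thesis
    by (intro scaled_ring.intro scaled_ring_axioms.intro)
      (auto simp: alg_quot_carrier alg_quot_add[OF assms] alg_quot_mult[OF assms]
        alg_quot_smult[OF assms] smult_closed smult_add smult_mult)
qed

end

lemma alg_hom_ring_hom_ring:
  assumes "ring A" "ring B" "h \<in> alg_hom A B"
  shows "ring_hom_ring A B h"
  using assms by (auto simp: alg_hom_def intro: ring_hom_ringI2)

lemma alg_homI: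
  assumes "\<And>x. x \<in> carrier A \<Longrightarrow> h x \<in> carrier B"
    and "\<And>x y. x \<in> carrier A \<Longrightarrow> y \<in> carrier A \<Longrightarrow> h (x \<otimes>\<^bsub>A\<^esub> y) = h x \<otimes>\<^bsub>B\<^esub> h y"
    and "\<And>x y. x \<in> carrier A \<Longrightarrow> y \<in> carrier A \<Longrightarrow> h (x \<oplus>\<^bsub>A\<^esub> y) = h x \<oplus>\<^bsub>B\<^esub> h y"
    and "h \<one>\<^bsub>A\<^esub> = \<one>\<^bsub>B\<^esub>"
    and "\<And>c x. x \<in> carrier A \<Longrightarrow> h (c \<odot>\<^bsub>A\<^esub> x) = c \<odot>\<^bsub>B\<^esub> h x"
  shows "h \<in> alg_hom A B"
  using assms by (auto simp: alg_hom_def intro: ring_hom_memI)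

lemma alg_homD:
  assumes "h \<in> alg_hom A B"
  shows "\<And>x. x \<in> carrier A \<Longrightarrow> h x \<in> carrier B"
    and "\<And>x y. x \<in> carrier A \<Longrightarrow> y \<in> carrier A \<Longrightarrow> h (x \<otimes>\<^bsub>A\<^esub> y) = h x \<otimes>\<^bsub>B\<^esub> h y"
    and "\<And>x y. x \<in> carrier A \<Longrightarrow> y \<in> carrier A \<Longrightarrow> h (x \<oplus>\<^bsub>A\<^esub> y) = h x \<oplus>\<^bsub>B\<^esub> h y"
    and "h \<one>\<^bsub>A\<^esub> = \<one>\<^bsub>B\<^esub>"
    and "\<And>c x. x \<in> carrier A \<Longrightarrow> h (c \<odot>\<^bsub>A\<^esub> x) = c \<odot>\<^bsub>B\<^esub> h x"
  using assms by (auto simp: alg_hom_def Ring.ring_hom_def)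

text \<open>This factorisation is used at two levels: to construct morphisms between algebras given by
  generators and relations from morphisms of tensor algebras, and to descend the deformed
  morphism to the quantum Hamiltonian reductions.\<close>
lemma induced_alg_hom_unique:
  assumes "scaled_ring A" "scaled_ring B" "ideal J A" "ideal K B"
    and h: "h \<in> alg_hom A B" and hJ: "h ` J \<subseteq> K"
  shows "\<exists>!F. F \<in> alg_hom (alg_quot A J) (alg_quot B K) \<and>
    F \<in> extensional (carrier (alg_quot A J)) \<and>
    (\<forall>x\<in>carrier A. F (J +>\<^bsub>A\<^esub> x) = K +>\<^bsub>B\<^esub> h x)"
proof -
  interpret A: scaled_ring A by fact
  interpret B: scaled_ring B by fact
  interpret h: ring_hom_ring A B h
    by (rule alg_hom_ring_hom_ring[OF A.ring_axioms B.ring_axioms h])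
  note hD = alg_homD[OF h]
  have wd: "K +>\<^bsub>B\<^esub> h x = K +>\<^bsub>B\<^esub> h y"
    if "x \<in> carrier A" "y \<in> carrier A" "J +>\<^bsub>A\<^esub> x = J +>\<^bsub>A\<^esub> y" for x y
  proof -
    have "h (x \<ominus>\<^bsub>A\<^esub> y) \<in> K"
      using that hJ A.alg_quot_coset_eq_iff[OF assms(3)] by blast
    then have "h x \<ominus>\<^bsub>B\<^esub> h y \<in> K"
      using that by (simp add: a_minus_def)
    then show ?thesis
      using that hD(1) B.alg_quot_coset_eq_iff[OF assms(4)] by blast
  qed
  define F where "F = restrict (\<lambda>X. K +>\<^bsub>B\<^esub> h (SOME x. x \<in> carrier A \<and> J +>\<^bsub>A\<^esub> x = X))
    (carrier (alg_quot A J))"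
  have F: "F (J +>\<^bsub>A\<^esub> x) = K +>\<^bsub>B\<^esub> h x" if "x \<in> carrier A" for x
  proof -
    let ?y = "SOME y. y \<in> carrier A \<and> J +>\<^bsub>A\<^esub> y = J +>\<^bsub>A\<^esub> x"
    have "?y \<in> carrier A \<and> J +>\<^bsub>A\<^esub> ?y = J +>\<^bsub>A\<^esub> x"
      by (rule someI[of _ x]) (use that in simp)
    then have "K +>\<^bsub>B\<^esub> h ?y = K +>\<^bsub>B\<^esub> h x"
      using wd that by blast
    then show ?thesis
      using that by (simp add: F_def A.alg_quot_carrier)
  qed
  have "F \<in> alg_hom (alg_quot A J) (alg_quot B K)"
    by (rule alg_homI)
      (auto simp: A.alg_quot_carrier B.alg_quot_carrier F hD A.smult_closed
        A.alg_quot_mult[OF assms(3)] B.alg_quot_mult[OF assms(4)]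
        A.alg_quot_add[OF assms(3)] B.alg_quot_add[OF assms(4)]
        A.alg_quot_smult[OF assms(3)] B.alg_quot_smult[OF assms(4)]
        A.alg_quot_one B.alg_quot_one)
  moreover have "F \<in> extensional (carrier (alg_quot A J))"
    by (simp add: F_def)
  ultimately show ?thesis
    by (intro ex1I[of _ F]) (auto simp: F A.alg_quot_carrier intro!: extensionalityI)
qed

section \<open>Substitution in tensor algebras\<close>

abbreviation tensors :: "'x set \<Rightarrow> ('x list \<Rightarrow>\<^sub>0 complex) set" where
  "tensors X \<equiv> carrier (tensor_alg X)"

abbreviation sc :: "complex \<Rightarrow> 'x list \<Rightarrow>\<^sub>0 complex" where
  "sc \<equiv> Poly_Mapping.single []"

text \<open>The morphism of tensor algebras with prescribed values on the generators.\<close>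
definition subst :: "('x \<Rightarrow> 'y list \<Rightarrow>\<^sub>0 complex) \<Rightarrow> ('x list \<Rightarrow>\<^sub>0 complex) \<Rightarrow> 'y list \<Rightarrow>\<^sub>0 complex" where
  "subst v p = (\<Sum>w\<in>Poly_Mapping.keys p. sc (Poly_Mapping.lookup p w) * prod_list (map v w))"

lemma single_mult_single:
  "Poly_Mapping.single u b * Poly_Mapping.single w c = Poly_Mapping.single (u @ w) (b * c)"
  for b c :: complex
  by (simp add: mult_single plus_list_def)

lemma sc_one: "sc 1 = 1"
  using single_one[where ?'a = "'a list"] by (simp add: zero_list_def)

lemma sc_mult: "sc (b * c) = sc b * sc c"
  by (simp add: single_mult_single)

lemma tensor_alg_simps:
  "\<And>p q. p \<otimes>\<^bsub>tensor_alg X\<^esub> q = p * q" "\<And>p q. p \<oplus>\<^bsub>tensor_alg X\<^esub> q = p + q"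
  "\<one>\<^bsub>tensor_alg X\<^esub> = 1" "\<zero>\<^bsub>tensor_alg X\<^esub> = 0"
  "\<And>c p. c \<odot>\<^bsub>tensor_alg X\<^esub> p = sc c * p"
  by (simp_all add: tensor_alg_def mult_map_scale_conv_mult zero_list_def)

lemma tensors_eq: "tensors X = {p. \<forall>w\<in>Poly_Mapping.keys p. set w \<subseteq> X}"
  by (simp add: tensor_alg_def)

lemma tensor_le_eq:
  "tensor_le X k = {p. \<forall>w\<in>Poly_Mapping.keys p. set w \<subseteq> X \<and> length w \<le> k}"
  by (auto simp: tensor_le_def tensors_eq)

lemma tensor_le_add: "p \<in> tensor_le X k \<Longrightarrow> q \<in> tensor_le X k \<Longrightarrow> p + q \<in> tensor_le X k"
  using keys_add[of p q] unfolding tensor_le_eq by blast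

lemma tensor_le_uminus: "p \<in> tensor_le X k \<Longrightarrow> - p \<in> tensor_le X k"
  by (auto simp: tensor_le_eq in_keys_iff)

lemma tensor_le_mult:
  assumes "p \<in> tensor_le X k" "q \<in> tensor_le X l"
  shows "p * q \<in> tensor_le X (k + l)"
  using assms keys_mult[of p q] unfolding tensor_le_eq plus_list_def
  by (fastforce simp: set_append)

lemma tensor_le_mono: "k \<le> l \<Longrightarrow> tensor_le X k \<subseteq> tensor_le X l"
  by (force simp: tensor_le_eq)

lemma single_in_tensor_le:
  "set w \<subseteq> X \<Longrightarrow> length w \<le> k \<Longrightarrow> Poly_Mapping.single w c \<in> tensor_le X k"
  by (auto simp: tensor_le_eq split: if_splits)

lemma zero_in_tensor_le: "0 \<in> tensor_le X k"
  by (simp add: tensor_le_eq)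

lemma one_in_tensor_le: "1 \<in> tensor_le X k"
  using single_in_tensor_le[of "[]" X k 1] by (simp add: sc_one)

lemma tensor_le_sc_mult:
  assumes "p \<in> tensor_le X k"
  shows "sc c * p \<in> tensor_le X k"
  using tensor_le_mult[OF single_in_tensor_le[of "[]" X 0 c] assms] by simp

lemma tensor_le_sum: "(\<And>i. i \<in> B \<Longrightarrow> f i \<in> tensor_le X k) \<Longrightarrow> sum f B \<in> tensor_le X k"
  by (induction B rule: infinite_finite_induct) (auto simp: zero_in_tensor_le tensor_le_add)

lemma tensors_Union: "tensors X = (\<Union>k. tensor_le X k)"
proof
  show "tensors X \<subseteq> (\<Union>k. tensor_le X k)"
  proof
    fix p assume p: "p \<in> tensors X"
    have "length w \<le> Max (length ` Poly_Mapping.keys p)" if "w \<in> Poly_Mapping.keys p" for w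
      using that by simp
    then show "p \<in> (\<Union>k. tensor_le X k)"
      using p unfolding tensor_le_def by blast
  qed
qed (auto simp: tensor_le_def)

lemma tensor_le_subset: "tensor_le X k \<subseteq> tensors X"
  by (auto simp: tensors_Union)

lemma tensors_two:
  assumes "p \<in> tensors X" "q \<in> tensors X"
  obtains k where "p \<in> tensor_le X k" "q \<in> tensor_le X k"
proof -
  obtain k l where "p \<in> tensor_le X k" "q \<in> tensor_le X l"
    using assms by (auto simp: tensors_Union)
  then show thesis
    using that[of "max k l"] tensor_le_mono[of k "max k l" X] tensor_le_mono[of l "max k l" X]
    by auto
qed

lemma tensors_add: "p \<in> tensors X \<Longrightarrow> q \<in> tensors X \<Longrightarrow> p + q \<in> tensors X"
  by (meson tensors_two tensor_le_add subsetD tensor_le_subset)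

lemma tensors_mult: "p \<in> tensors X \<Longrightarrow> q \<in> tensors X \<Longrightarrow> p * q \<in> tensors X"
  by (meson tensors_two tensor_le_mult subsetD tensor_le_subset)

lemma tensors_uminus: "p \<in> tensors X \<Longrightarrow> - p \<in> tensors X"
  by (meson tensors_two tensor_le_uminus subsetD tensor_le_subset)

lemma tensors_diff: "p \<in> tensors X \<Longrightarrow> q \<in> tensors X \<Longrightarrow> p - q \<in> tensors X"
  using tensors_add[of p X "- q"] tensors_uminus[of q X] by simp

lemma single_in_tensors: "set w \<subseteq> X \<Longrightarrow> Poly_Mapping.single w c \<in> tensors X"
  by (auto simp: tensors_eq split: if_splits)

lemma gen_in_tensors: "x \<in> X \<Longrightarrow> gen x \<in> tensors X"
  by (simp add: gen_def single_in_tensors)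

lemma zero_in_tensors: "0 \<in> tensors X"
  by (simp add: tensors_eq)

lemma one_in_tensors: "1 \<in> tensors X"
  using single_in_tensors[of "[]" X 1] by (simp add: sc_one)

lemma tensors_sum: "(\<And>i. i \<in> B \<Longrightarrow> f i \<in> tensors X) \<Longrightarrow> sum f B \<in> tensors X"
  by (induction B rule: infinite_finite_induct) (auto simp: zero_in_tensors tensors_add)

lemmas tensors_closed = tensors_add tensors_mult tensors_uminus tensors_diff gen_in_tensors
  single_in_tensors zero_in_tensors one_in_tensors tensors_sum

lemma poly_mapping_sum_single:
  "p = (\<Sum>w\<in>Poly_Mapping.keys p. Poly_Mapping.single w (Poly_Mapping.lookup p w))"
  for p :: "'a \<Rightarrow>\<^sub>0 complex"
proof (rule poly_mapping_eqI)
  fix u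
  have "Poly_Mapping.lookup p u = (\<Sum>w\<in>Poly_Mapping.keys p.
      if w = u then Poly_Mapping.lookup p w else 0)"
    by (simp add: in_keys_iff)
  then show "Poly_Mapping.lookup p u = Poly_Mapping.lookup
      (\<Sum>w\<in>Poly_Mapping.keys p. Poly_Mapping.single w (Poly_Mapping.lookup p w)) u"
    by (simp add: lookup_sum lookup_single when_def)
qed

lemma tensor_induct [consumes 1, case_names zero single add]:
  assumes "p \<in> tensors X"
    and "P 0"
    and "\<And>w c. set w \<subseteq> X \<Longrightarrow> P (Poly_Mapping.single w c)"
    and "\<And>p q. p \<in> tensors X \<Longrightarrow> q \<in> tensors X \<Longrightarrow> P p \<Longrightarrow> P q \<Longrightarrow> P (p + q)"
  shows "P p"
proof -
  define f where "f w = Poly_Mapping.single w (Poly_Mapping.lookup p w)" for w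
  have sum: "sum f B \<in> tensors X \<and> P (sum f B)" if "finite B" "B \<subseteq> Poly_Mapping.keys p" for B
    using that
  proof (induction B rule: finite_induct)
    case (insert w B)
    have "set w \<subseteq> X"
      using insert.prems assms(1) by (auto simp: tensors_eq)
    then show ?case
      using insert assms(3,4) by (auto simp: f_def tensors_closed)
  qed (simp add: assms(2) zero_in_tensors)
  have "p = sum f (Poly_Mapping.keys p)"
    unfolding f_def by (rule poly_mapping_sum_single)
  then show ?thesis
    using sum[of "Poly_Mapping.keys p"] by (metis finite_keys order_refl)
qed

text \<open>Constant tensors are central, although the tensor algebra is not commutative.\<close>
lemma sc_commute: "sc c * p = p * sc c"
proof -
  have "p \<in> tensors UNIV" by (simp add: tensors_eq)
  then show ?thesis
    by (induction p rule: tensor_induct)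
      (simp_all add: distrib_left distrib_right single_mult_single mult.commute)
qed

lemma subst_superset:
  assumes "finite B" "Poly_Mapping.keys p \<subseteq> B"
  shows "subst v p = (\<Sum>w\<in>B. sc (Poly_Mapping.lookup p w) * prod_list (map v w))"
  unfolding subst_def
  by (rule sum.mono_neutral_left[OF assms]) (simp add: in_keys_iff)

lemma subst_zero [simp]: "subst v 0 = 0"
  by (simp add: subst_def)

lemma subst_add: "subst v (p + q) = subst v p + subst v q"
proof -
  let ?B = "Poly_Mapping.keys p \<union> Poly_Mapping.keys q"
  show ?thesis
    by (subst (1 2 3) subst_superset[of ?B])
      (use keys_add[of p q] in \<open>auto simp: lookup_add single_add distrib_right sum.distrib\<close>)
qed

lemma subst_single: "subst v (Poly_Mapping.single w c) = sc c * prod_list (map v w)"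
  by (subst subst_superset[of "{w}"]) auto

lemma subst_sc [simp]: "subst v (sc c) = sc c"
  by (simp add: subst_single)

lemma subst_one [simp]: "subst v 1 = 1"
  using subst_sc[of v 1] by (simp add: sc_one)

lemma subst_gen [simp]: "subst v (gen x) = v x"
  by (simp add: gen_def subst_single sc_one)

lemma subst_uminus: "subst v (- p) = - subst v p"
  using subst_add[of v p "- p"] by (simp add: eq_neg_iff_add_eq_0 add.commute)

lemma subst_diff: "subst v (p - q) = subst v p - subst v q"
  using subst_add[of v p "- q"] by (simp add: subst_uminus)

lemma subst_sum: "subst v (sum f B) = (\<Sum>i\<in>B. subst v (f i))"
  by (induction B rule: infinite_finite_induct) (simp_all add: subst_add)

lemma subst_mult: "subst v (p * q) = subst v p * subst v q"
proof -
  have p: "p \<in> tensors UNIV" and q: "q \<in> tensors UNIV"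
    by (simp_all add: tensors_eq)
  from p show ?thesis
  proof (induction p rule: tensor_induct)
    case (single w c)
    from q show ?case
    proof (induction q rule: tensor_induct)
      case (single u b)
      let ?w = "prod_list (map v w)" and ?u = "prod_list (map v u)"
      have "subst v (Poly_Mapping.single w c * Poly_Mapping.single u b) = sc (c * b) * (?w * ?u)"
        by (simp add: single_mult_single subst_single)
      also have "\<dots> = sc c * (sc b * ?w) * ?u"
        by (simp only: sc_mult mult.assoc)
      also have "sc b * ?w = ?w * sc b"
        by (rule sc_commute)
      finally show ?case
        by (simp only: subst_single mult.assoc)
    qed (simp_all add: distrib_left subst_add)
  qed (simp_all add: distrib_right subst_add)
qed

lemmas subst_simps = subst_add subst_diff subst_uminus subst_mult subst_sum

lemma subst_prod_list: "subst v (prod_list ps) = prod_list (map (subst v) ps)"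
  by (induction ps) (simp_all add: subst_mult)

text \<open>Morphisms of tensor algebras compose by substituting generators. All compatibilities between
  the rescaling and comoment maps are obtained from this lemma, as equalities of free tensors that
  hold before any relation is imposed.\<close>
lemma subst_subst: "subst v (subst u p) = subst (\<lambda>x. subst v (u x)) p"
  unfolding subst_def[of _ p] by (simp add: subst_simps subst_prod_list comp_def)

text \<open>If all generators are replaced by tensors of degree at most \<open>r\<close>, degrees are multiplied by at
  most \<open>r\<close>. The rescaling has \<open>r = 1\<close> and the comoment map, which is quadratic, has \<open>r = 2\<close>.\<close>
lemma subst_tensor_le:
  assumes "\<And>x. x \<in> X \<Longrightarrow> v x \<in> tensor_le Y r" "p \<in> tensor_le X k"
  shows "subst v p \<in> tensor_le Y (r * k)"
  unfolding subst_def
proof (rule tensor_le_sum)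
  fix w assume "w \<in> Poly_Mapping.keys p"
  then have w: "set w \<subseteq> X" "length w \<le> k"
    using assms(2) by (auto simp: tensor_le_eq)
  have "prod_list (map v w) \<in> tensor_le Y (r * length w)"
    using w(1)
  proof (induction w)
    case (Cons x w)
    then show ?case
      using tensor_le_mult[OF assms(1)[of x], of "prod_list (map v w)"] by simp
  qed (simp add: one_in_tensor_le)
  then show "sc (Poly_Mapping.lookup p w) * prod_list (map v w) \<in> tensor_le Y (r * k)"
    using tensor_le_mono[of "r * length w" "r * k" Y] w(2) tensor_le_sc_mult by fastforce
qed

lemma subst_in_tensors:
  assumes "\<And>x. x \<in> X \<Longrightarrow> v x \<in> tensors Y" "p \<in> tensors X"
  shows "subst v p \<in> tensors Y"
  unfolding subst_def
proof (intro tensors_sum tensors_mult single_in_tensors)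
  fix w assume "w \<in> Poly_Mapping.keys p"
  then have "set w \<subseteq> X" using assms(2) by (auto simp: tensors_eq)
  then show "prod_list (map v w) \<in> tensors Y"
    by (induction w) (auto simp: assms(1) tensors_closed)
qed simp

section \<open>Tensor algebras as rings\<close>

text \<open>The image of a ring under a map that respects the operations is a ring. The source is a type
  class ring, in which the axioms, in particular associativity of the Cauchy product of series
  with noncommuting coefficients, are already known.\<close>
lemma ring_imageI:
  fixes R :: "('a, 'm) ring_scheme" and \<pi> :: "'t::ring_1 \<Rightarrow> 'a"
  assumes "carrier R = \<pi> ` U" and "0 \<in> U" "1 \<in> U"
    and "\<And>x y. x \<in> U \<Longrightarrow> y \<in> U \<Longrightarrow> x + y \<in> U"
    and "\<And>x y. x \<in> U \<Longrightarrow> y \<in> U \<Longrightarrow> x * y \<in> U"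
    and "\<And>x. x \<in> U \<Longrightarrow> - x \<in> U"
    and "\<And>x y. x \<in> U \<Longrightarrow> y \<in> U \<Longrightarrow> \<pi> x \<oplus>\<^bsub>R\<^esub> \<pi> y = \<pi> (x + y)"
    and "\<And>x y. x \<in> U \<Longrightarrow> y \<in> U \<Longrightarrow> \<pi> x \<otimes>\<^bsub>R\<^esub> \<pi> y = \<pi> (x * y)"
    and "\<zero>\<^bsub>R\<^esub> = \<pi> 0" "\<one>\<^bsub>R\<^esub> = \<pi> 1"
  shows "ring R"
proof (rule ringI)
  show "abelian_group R"
  proof (rule abelian_groupI)
    fix x assume "x \<in> carrier R"
    then obtain u where "u \<in> U" "x = \<pi> u" using assms(1) by auto
    then show "\<exists>y\<in>carrier R. y \<oplus>\<^bsub>R\<^esub> x = \<zero>\<^bsub>R\<^esub>"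
      by (intro bexI[of _ "\<pi> (- u)"]) (simp_all add: assms)
  qed (auto simp: assms algebra_simps)
  show "Group.monoid R"
    by (rule monoidI) (auto simp: assms algebra_simps)
qed (auto simp: assms algebra_simps)

lemma tensor_alg_scaled_ring: "scaled_ring (tensor_alg X)"
proof -
  have "ring (tensor_alg X)"
    by (rule ring_imageI[of _ "\<lambda>p. p" "tensors X"]) (auto simp: tensors_closed tensor_alg_simps)
  then show ?thesis
    by (intro scaled_ring.intro scaled_ring_axioms.intro)
      (auto simp: tensors_closed tensor_alg_simps distrib_left mult.assoc)
qed

interpretation tensor_alg: scaled_ring "tensor_alg X"
  by (rule tensor_alg_scaled_ring)

lemma tensor_alg_uminus: "p \<in> tensors X \<Longrightarrow> \<ominus>\<^bsub>tensor_alg X\<^esub> p = - p"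
  by (rule tensor_alg.minus_equality) (auto simp: tensor_alg_simps tensors_closed)

section \<open>Algebras given by generators and relations\<close>

abbreviation relation_ideal ::
    "'x set \<Rightarrow> ('x list \<Rightarrow>\<^sub>0 complex) set \<Rightarrow> ('x list \<Rightarrow>\<^sub>0 complex) set" where
  "relation_ideal X S \<equiv> Idl\<^bsub>tensor_alg X\<^esub> S"

text \<open>The algebra \<open>pres_alg X S\<close>. The relations have to be tensors in the given generators, since the
  ideal generated by a set that is not contained in the carrier is not an ideal.\<close>
locale presentation =
  fixes X :: "'x set" and S :: "('x list \<Rightarrow>\<^sub>0 complex) set"
  assumes relations: "S \<subseteq> tensors X"
begin

abbreviation "P \<equiv> pres_alg X S"
abbreviation "cl \<equiv> pres_class X S"

lemma ideal: "ideal (relation_ideal X S) (tensor_alg X)"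
  by (rule tensor_alg.genideal_ideal[OF relations])

lemma relation_mem: "s \<in> S \<Longrightarrow> s \<in> relation_ideal X S"
  using tensor_alg.genideal_self[OF relations] by auto

lemma ideal_closed:
  assumes "p \<in> relation_ideal X S"
  shows "\<And>q. q \<in> relation_ideal X S \<Longrightarrow> p + q \<in> relation_ideal X S"
    and "- p \<in> relation_ideal X S"
    and "\<And>q. q \<in> tensors X \<Longrightarrow> q * p \<in> relation_ideal X S"
    and "\<And>q. q \<in> tensors X \<Longrightarrow> p * q \<in> relation_ideal X S"
proof -
  interpret J: ideal "relation_ideal X S" "tensor_alg X" by (rule ideal)
  have uminus: "- q \<in> relation_ideal X S" if "q \<in> relation_ideal X S" for q
    using J.a_inv_closed[OF that] J.a_Hcarr[OF that] by (simp add: tensor_alg_uminus)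
  have add: "p + q \<in> relation_ideal X S" if "q \<in> relation_ideal X S" for q
    using J.a_closed[OF assms that] by (simp add: tensor_alg_simps)
  show "- p \<in> relation_ideal X S" using uminus assms by simp
  show "p + q \<in> relation_ideal X S" if "q \<in> relation_ideal X S" for q
    using add that .
  show "q * p \<in> relation_ideal X S" if "q \<in> tensors X" for q
    using J.I_l_closed[OF assms that] by (simp add: tensor_alg_simps)
  show "p * q \<in> relation_ideal X S" if "q \<in> tensors X" for q
    using J.I_r_closed[OF assms that] by (simp add: tensor_alg_simps)
qed

lemma zero_mem_ideal: "0 \<in> relation_ideal X S"
proof -
  interpret J: ideal "relation_ideal X S" "tensor_alg X" by (rule ideal)
  show ?thesis using J.zero_closed by (simp add: tensor_alg_simps)
qed

sublocale P: scaled_ring P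
  unfolding pres_alg_def by (rule tensor_alg.alg_quot_scaled_ring[OF ideal])

lemma carrier_P: "carrier P = cl ` tensors X"
  unfolding pres_alg_def pres_class_def by (rule tensor_alg.alg_quot_carrier)

lemma cl_in_carrier: "p \<in> tensors X \<Longrightarrow> cl p \<in> carrier P"
  by (simp add: carrier_P)

lemma P_ops:
  shows "\<And>p q. p \<in> tensors X \<Longrightarrow> q \<in> tensors X \<Longrightarrow> cl p \<oplus>\<^bsub>P\<^esub> cl q = cl (p + q)"
    and "\<And>p q. p \<in> tensors X \<Longrightarrow> q \<in> tensors X \<Longrightarrow> cl p \<otimes>\<^bsub>P\<^esub> cl q = cl (p * q)"
    and "\<And>p c. p \<in> tensors X \<Longrightarrow> c \<odot>\<^bsub>P\<^esub> cl p = cl (sc c * p)"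
    and "\<one>\<^bsub>P\<^esub> = cl 1" and "\<zero>\<^bsub>P\<^esub> = cl 0"
  unfolding pres_alg_def pres_class_def
  using tensor_alg.alg_quot_add[OF ideal] tensor_alg.alg_quot_mult[OF ideal]
    tensor_alg.alg_quot_smult[OF ideal] tensor_alg.alg_quot_one[of X "relation_ideal X S"]
    tensor_alg.alg_quot_zero[OF ideal]
  by (simp_all add: tensor_alg_simps)

lemma P_uminus: "p \<in> tensors X \<Longrightarrow> \<ominus>\<^bsub>P\<^esub> cl p = cl (- p)"
  by (rule P.minus_equality) (auto simp: P_ops tensors_closed cl_in_carrier)

lemma P_finsum:
  assumes "finite B" "\<And>i. i \<in> B \<Longrightarrow> f i \<in> tensors X"
  shows "(\<Oplus>\<^bsub>P\<^esub>i\<in>B. cl (f i)) = cl (sum f B)"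
  using assms by (induction B rule: finite_induct)
    (auto simp: P_ops P.finsum_insert Pi_def cl_in_carrier tensors_closed)

text \<open>Every class is a linear combination of products of generators, and this determines a morphism by
  its values on generators. It is the uniqueness that the description in \<open>pres_hom\<close> calls for.\<close>
lemma alg_hom_eqI:
  assumes "f \<in> alg_hom P B" "h \<in> alg_hom P B"
    and "\<And>x. x \<in> X \<Longrightarrow> f (cl (gen x)) = h (cl (gen x))"
    and "u \<in> carrier P"
  shows "f u = h u"
proof -
  note fD = alg_homD[OF assms(1)] and hD = alg_homD[OF assms(2)]
  have single: "f (cl (Poly_Mapping.single w 1)) = h (cl (Poly_Mapping.single w 1))"
    if "set w \<subseteq> X" for w
    using that
  proof (induction w)
    case Nil
    then show ?case using fD(4) hD(4) by (simp add: P_ops sc_one)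
  next
    case (Cons x w)
    then have "cl (Poly_Mapping.single (x # w) 1) = cl (gen x) \<otimes>\<^bsub>P\<^esub> cl (Poly_Mapping.single w 1)"
      by (simp add: P_ops tensors_closed) (simp add: gen_def single_mult_single)
    then show ?case
      using Cons assms(3) fD(2) hD(2) by (simp add: cl_in_carrier tensors_closed)
  qed
  obtain p where p: "p \<in> tensors X" "u = cl p"
    using assms(4) carrier_P by auto
  from p(1) have "f (cl p) = h (cl p)"
  proof (induction p rule: tensor_induct)
    case zero
    have "cl 0 = 0 \<odot>\<^bsub>P\<^esub> cl 1"
      by (simp add: P_ops tensors_closed)
    then show ?case
      using single[of "[]"] fD(5) hD(5) by (simp add: sc_one cl_in_carrier tensors_closed)
  next
    case (single w c)
    have "cl (Poly_Mapping.single w c) = c \<odot>\<^bsub>P\<^esub> cl (Poly_Mapping.single w 1)"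
      using single by (simp add: P_ops tensors_closed single_mult_single)
    then show ?case
      using \<open>set w \<subseteq> X\<close> \<open>set w \<subseteq> X \<Longrightarrow> _\<close> fD(5) hD(5)
      by (simp add: cl_in_carrier tensors_closed)
  next
    case (add p q)
    then show ?case
      using fD(3)[of "cl p" "cl q"] hD(3)[of "cl p" "cl q"] by (simp add: P_ops cl_in_carrier)
  qed
  then show ?thesis using p(2) by simp
qed

end

text \<open>A morphism given by its values on generators is computed on representatives by substitution,
  provided that the substituted relations lie in the ideal of relations of the target. This
  replaces the definite descriptions of the rescaling and comoment maps by explicit formulas.\<close>
lemma pres_hom_substitution:
  assumes "presentation X S" "presentation Y S'"
    and v: "\<And>x. x \<in> X \<Longrightarrow> v x \<in> tensors Y"
    and S: "\<And>s. s \<in> S \<Longrightarrow> subst v s \<in> relation_ideal Y S'"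
    and u: "\<And>x. x \<in> X \<Longrightarrow> u x = pres_class Y S' (v x)"
  shows "pres_hom X S (pres_alg Y S') u \<in> alg_hom (pres_alg X S) (pres_alg Y S')"
    and "\<And>p. p \<in> tensors X \<Longrightarrow>
      pres_hom X S (pres_alg Y S') u (pres_class X S p) = pres_class Y S' (subst v p)"
proof -
  interpret X: presentation X S by fact
  interpret Y: presentation Y S' by fact
  have hom: "subst v \<in> alg_hom (tensor_alg X) (tensor_alg Y)"
    by (rule alg_homI)
      (auto simp: tensor_alg_simps subst_simps intro!: subst_in_tensors v)
  interpret h: ring_hom_ring "tensor_alg X" "tensor_alg Y" "subst v"
    by (rule alg_hom_ring_hom_ring[OF _ _ hom])
      (rule tensor_alg.ring_axioms)+
  have "relation_ideal X S \<subseteq> {p \<in> tensors X. subst v p \<in> relation_ideal Y S'}"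
    by (rule tensor_alg.genideal_minimal[OF h.ideal_vimage[OF Y.ideal]])
      (use X.relations S in auto)
  then have J: "subst v ` relation_ideal X S \<subseteq> relation_ideal Y S'"
    by auto
  obtain F where F: "F \<in> alg_hom (pres_alg X S) (pres_alg Y S')"
    "F \<in> extensional (carrier (pres_alg X S))"
    "\<And>p. p \<in> tensors X \<Longrightarrow> F (pres_class X S p) = pres_class Y S' (subst v p)"
    using induced_alg_hom_unique[OF tensor_alg_scaled_ring tensor_alg_scaled_ring
        X.ideal Y.ideal hom J]
    unfolding pres_alg_def pres_class_def by auto
  have "pres_hom X S (pres_alg Y S') u = F"
    unfolding pres_hom_def
  proof (rule the_equality)
    show "F \<in> alg_hom (pres_alg X S) (pres_alg Y S') \<and> F \<in> extensional (carrier (pres_alg X S)) \<and>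
        (\<forall>x\<in>X. F (pres_class X S (gen x)) = u x)"
      using F by (simp add: gen_in_tensors u)
  next
    fix f
    assume f: "f \<in> alg_hom (pres_alg X S) (pres_alg Y S') \<and>
      f \<in> extensional (carrier (pres_alg X S)) \<and> (\<forall>x\<in>X. f (pres_class X S (gen x)) = u x)"
    show "f = F"
      by (rule extensionalityI[of _ "carrier (pres_alg X S)"], use f F(2) in simp_all)
        (rule X.alg_hom_eqI[of _ "pres_alg Y S'"], use f F in \<open>auto simp: gen_in_tensors u\<close>)
  qed
  with F show "pres_hom X S (pres_alg Y S') u \<in> alg_hom (pres_alg X S) (pres_alg Y S')"
    and "\<And>p. p \<in> tensors X \<Longrightarrow>
      pres_hom X S (pres_alg Y S') u (pres_class X S p) = pres_class Y S' (subst v p)"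
    by auto
qed

section \<open>Rees algebras\<close>

lemma (in scaled_ring) scaled_subring:
  assumes "subring H A" "\<And>c x. x \<in> H \<Longrightarrow> c \<odot> x \<in> H"
  shows "scaled_ring (A\<lparr>carrier := H\<rparr>)"
proof -
  have "H \<subseteq> carrier A" by (rule subringE(1)[OF assms(1)])
  then show ?thesis
    by (intro scaled_ring.intro scaled_ring_axioms.intro subring_is_ring[OF assms(1)])
      (auto simp: assms(2) intro: smult_add smult_mult)
qed

lemma power_series_simps:
  "carrier (power_series A) = {f. \<forall>k. f k \<in> carrier A}"
  "mult (power_series A) = (\<lambda>f h n. \<Oplus>\<^bsub>A\<^esub>i\<in>{..n}. f i \<otimes>\<^bsub>A\<^esub> h (n - i))"
  "one (power_series A) = (\<lambda>n. if n = 0 then \<one>\<^bsub>A\<^esub> else \<zero>\<^bsub>A\<^esub>)"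
  "zero (power_series A) = (\<lambda>n. \<zero>\<^bsub>A\<^esub>)"
  "add (power_series A) = (\<lambda>f h n. f n \<oplus>\<^bsub>A\<^esub> h n)"
  "smult (power_series A) = (\<lambda>c f n. \<Oplus>\<^bsub>A\<^esub>i\<in>{..n}. fps_nth c i \<odot>\<^bsub>A\<^esub> f (n - i))"
  by (simp_all add: power_series_def)

lemma power_series_map_alg_hom:
  assumes "scaled_ring A" "scaled_ring B" "h \<in> alg_hom A B"
  shows "(\<lambda>f k. h (f k)) \<in> alg_hom (power_series A) (power_series B)"
proof -
  interpret A: scaled_ring A by fact
  interpret B: scaled_ring B by fact
  interpret h: ring_hom_ring A B h
    by (rule alg_hom_ring_hom_ring[OF A.ring_axioms B.ring_axioms assms(3)])
  note hD = alg_homD[OF assms(3)]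
  show ?thesis
    by (rule alg_homI)
      (auto simp: power_series_simps hD Pi_def comp_def A.smult_closed fun_eq_iff)
qed

context presentation
begin

abbreviation "filt \<equiv> pres_le X S"

lemma filt_in_carrier: "x \<in> filt k \<Longrightarrow> x \<in> carrier P"
  using tensor_le_subset by (auto simp: pres_le_def carrier_P)

lemma filt_mono: "k \<le> l \<Longrightarrow> filt k \<subseteq> filt l"
  unfolding pres_le_def by (intro image_mono tensor_le_mono)

lemma filt_zero: "\<zero>\<^bsub>P\<^esub> \<in> filt k"
  unfolding pres_le_def P_ops by (intro imageI zero_in_tensor_le)

lemma filt_one: "\<one>\<^bsub>P\<^esub> \<in> filt k"
  unfolding pres_le_def P_ops by (intro imageI one_in_tensor_le)

lemma filtE:
  assumes "x \<in> filt k"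
  obtains p where "p \<in> tensor_le X k" "p \<in> tensors X" "x = cl p"
  using assms tensor_le_subset unfolding pres_le_def by blast

lemma filtI: "p \<in> tensor_le X k \<Longrightarrow> cl p \<in> filt k"
  by (simp add: pres_le_def)

lemma filt_add: "x \<in> filt k \<Longrightarrow> y \<in> filt k \<Longrightarrow> x \<oplus>\<^bsub>P\<^esub> y \<in> filt k"
  by (elim filtE) (simp add: P_ops filtI tensor_le_add)

lemma filt_uminus: "x \<in> filt k \<Longrightarrow> \<ominus>\<^bsub>P\<^esub> x \<in> filt k"
  by (elim filtE) (simp add: P_uminus filtI tensor_le_uminus)

lemma filt_mult: "x \<in> filt k \<Longrightarrow> y \<in> filt l \<Longrightarrow> x \<otimes>\<^bsub>P\<^esub> y \<in> filt (k + l)"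
  by (elim filtE) (simp add: P_ops filtI tensor_le_mult)

lemma filt_finsum:
  assumes "finite E" "\<And>i. i \<in> E \<Longrightarrow> f i \<in> filt k"
  shows "(\<Oplus>\<^bsub>P\<^esub>i\<in>E. f i) \<in> filt k"
  using assms
proof (induction E rule: finite_induct)
  case (insert j E)
  then have "f j \<in> carrier P" "f \<in> E \<rightarrow> carrier P"
    using filt_in_carrier by blast+
  with insert show ?case
    by (simp add: P.finsum_insert filt_add)
qed (simp add: filt_zero)

lemma pres_deg_le_iff:
  assumes "x \<in> filt l"
  shows "pres_deg X S x \<le> k \<longleftrightarrow> x \<in> filt k"
proof
  have "x \<in> filt (pres_deg X S x)"
    unfolding pres_deg_def by (rule LeastI[of _ l]) (rule assms)
  then show "x \<in> filt k" if "pres_deg X S x \<le> k"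
    using filt_mono[OF that] by auto
next
  show "pres_deg X S x \<le> k" if "x \<in> filt k"
    unfolding pres_deg_def by (rule Least_le) (rule that)
qed

text \<open>The growth condition \<open>k - |f\<^sub>k| \<rightarrow> \<infinity>\<close> in terms of the filtration alone: eventually the \<open>k\<close>-th coefficient
  lies \<open>N\<close> steps below the bound \<open>k\<close>, for every \<open>N\<close>. In this form it is preserved by all operations that
  respect the filtration, without computing exact degrees.\<close>
lemma rees_carrier_iff:
  "f \<in> carrier (rees X S) \<longleftrightarrow>
    (\<forall>k. f k \<in> filt k) \<and> (\<forall>N. \<exists>K. \<forall>k\<ge>K. N \<le> k \<and> f k \<in> filt (k - N))"
proof -
  have "(\<forall>Z. \<forall>\<^sub>F k in sequentially. Z \<le> int k - int (pres_deg X S (f k))) \<longleftrightarrow>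
      (\<forall>N. \<exists>K. \<forall>k\<ge>K. N \<le> k \<and> f k \<in> filt (k - N))" (is "?l = ?r")
    if f: "\<And>k. f k \<in> filt k"
  proof
    assume l: ?l
    show ?r
    proof
      fix N
      obtain K where K: "\<And>k. k \<ge> K \<Longrightarrow> int N \<le> int k - int (pres_deg X S (f k))"
        using l unfolding eventually_sequentially by blast
      have "N \<le> k \<and> f k \<in> filt (k - N)" if "k \<ge> K" for k
        using K[OF that] by (auto simp flip: pres_deg_le_iff[OF f])
      then show "\<exists>K. \<forall>k\<ge>K. N \<le> k \<and> f k \<in> filt (k - N)" by blast
    qed
  next
    assume r: ?r
    show ?l
    proof
      fix Z
      obtain K where K: "\<And>k. k \<ge> K \<Longrightarrow> nat Z \<le> k \<and> f k \<in> filt (k - nat Z)"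
        using r by blast
      have "Z \<le> int k - int (pres_deg X S (f k))" if "k \<ge> K" for k
        using K[OF that] unfolding pres_deg_le_iff[OF f, symmetric] by linarith
      then show "\<forall>\<^sub>F k in sequentially. Z \<le> int k - int (pres_deg X S (f k))"
        unfolding eventually_sequentially by blast
    qed
  qed
  then show ?thesis
    by (auto simp: rees_def filterlim_at_top)
qed

lemma reesD:
  assumes "f \<in> carrier (rees X S)"
  shows "f k \<in> filt k"
    and "\<exists>K. \<forall>k\<ge>K. N \<le> k \<and> f k \<in> filt (k - N)"
  using assms unfolding rees_carrier_iff by blast+

lemma reesD2:
  assumes "f \<in> carrier (rees X S)" "h \<in> carrier (rees X S)"
  shows "\<exists>K. \<forall>k\<ge>K. N \<le> k \<and> f k \<in> filt (k - N) \<and> h k \<in> filt (k - N)"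
proof -
  obtain K L where "\<And>k. k \<ge> K \<Longrightarrow> N \<le> k \<and> f k \<in> filt (k - N)"
    "\<And>k. k \<ge> L \<Longrightarrow> N \<le> k \<and> h k \<in> filt (k - N)"
    using reesD(2)[OF assms(1)] reesD(2)[OF assms(2)] by metis
  then show ?thesis by (intro exI[of _ "max K L"]) simp
qed

text \<open>Series with coefficients in the quotient algebra are lifted to formal power series over the
  tensor algebra, where products are those of the library; \<open>coeff_classes\<close> is the projection.\<close>
definition coeff_classes :: "('x list \<Rightarrow>\<^sub>0 complex) fps \<Rightarrow> nat \<Rightarrow> 'x pres_elt" where
  "coeff_classes F = (\<lambda>n. cl (fps_nth F n))"

definition tensor_series :: "('x list \<Rightarrow>\<^sub>0 complex) fps set" where
  "tensor_series = {F. \<forall>n. fps_nth F n \<in> tensors X}"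

definition sc_series :: "complex fps \<Rightarrow> ('x list \<Rightarrow>\<^sub>0 complex) fps" where
  "sc_series c = Abs_fps (\<lambda>n. sc (fps_nth c n))"

lemma tensor_series_closed:
  "0 \<in> tensor_series" "1 \<in> tensor_series" "sc_series c \<in> tensor_series"
  "F \<in> tensor_series \<Longrightarrow> - F \<in> tensor_series"
  "F \<in> tensor_series \<Longrightarrow> G \<in> tensor_series \<Longrightarrow> F + G \<in> tensor_series"
  "F \<in> tensor_series \<Longrightarrow> G \<in> tensor_series \<Longrightarrow> F * G \<in> tensor_series"
  by (auto simp: tensor_series_def sc_series_def fps_mult_nth tensors_closed)

lemma power_series_carrier: "carrier (power_series P) = coeff_classes ` tensor_series"
proof
  show "carrier (power_series P) \<subseteq> coeff_classes ` tensor_series"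
  proof
    fix f assume "f \<in> carrier (power_series P)"
    then have "\<forall>k. \<exists>p. p \<in> tensors X \<and> f k = cl p"
      by (auto simp: power_series_simps carrier_P)
    then obtain p where "\<And>k. p k \<in> tensors X" "\<And>k. f k = cl (p k)"
      by metis
    then show "f \<in> coeff_classes ` tensor_series"
      by (intro image_eqI[of _ _ "Abs_fps p"]) (auto simp: tensor_series_def coeff_classes_def)
  qed
qed (auto simp: power_series_simps tensor_series_def coeff_classes_def cl_in_carrier)

lemma power_series_ops:
  assumes "F \<in> tensor_series"
  shows "\<And>G. G \<in> tensor_series \<Longrightarrow>
      coeff_classes F \<oplus>\<^bsub>power_series P\<^esub> coeff_classes G = coeff_classes (F + G)"
    and "\<And>G. G \<in> tensor_series \<Longrightarrow>
      coeff_classes F \<otimes>\<^bsub>power_series P\<^esub> coeff_classes G = coeff_classes (F * G)"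
    and "c \<odot>\<^bsub>power_series P\<^esub> coeff_classes F = coeff_classes (sc_series c * F)"
  using assms
  by (auto simp: power_series_simps coeff_classes_def tensor_series_def fun_eq_iff P_ops
      fps_mult_nth sc_series_def atLeast0AtMost P_finsum tensors_closed)

lemma power_series_scaled_ring: "scaled_ring (power_series P)"
proof -
  have "ring (power_series P)"
    by (rule ring_imageI[OF power_series_carrier tensor_series_closed(1,2,5,6,4) power_series_ops(1,2)])
      (auto simp: power_series_simps coeff_classes_def P_ops fun_eq_iff)
  then show ?thesis
    by (intro scaled_ring.intro scaled_ring_axioms.intro)
      (auto simp: power_series_carrier power_series_ops tensor_series_closed distrib_left mult.assoc)
qed

sublocale series: scaled_ring "power_series P"
  by (rule power_series_scaled_ring)

lemma power_series_uminus:
  assumes "f \<in> carrier (power_series P)"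
  shows "\<ominus>\<^bsub>power_series P\<^esub> f = (\<lambda>k. \<ominus>\<^bsub>P\<^esub> f k)"
  by (rule series.minus_equality) (use assms in \<open>auto simp: power_series_simps P.l_neg\<close>)

lemma rees_eq: "rees X S = (power_series P)\<lparr>carrier := carrier (rees X S)\<rparr>"
  by (simp add: rees_def)

lemma rees_subset: "carrier (rees X S) \<subseteq> carrier (power_series P)"
  by (auto simp: power_series_simps dest: reesD(1) intro: filt_in_carrier)

text \<open>In each summand \<open>f\<^sub>i h\<^bsub>n - i\<^esub>\<close> one of the two indices is at least \<open>n / 2\<close>. That factor alone lies far
  below its bound, and the other one stays within its own bound.\<close>
lemma rees_mult_closed:
  assumes f: "f \<in> carrier (rees X S)" and h: "h \<in> carrier (rees X S)"
  shows "f \<otimes>\<^bsub>power_series P\<^esub> h \<in> carrier (rees X S)"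
  unfolding rees_carrier_iff
proof (intro conjI allI)
  fix n
  show "(f \<otimes>\<^bsub>power_series P\<^esub> h) n \<in> filt n"
    unfolding power_series_simps
  proof (rule filt_finsum)
    fix i assume "i \<in> {..n}"
    then show "f i \<otimes>\<^bsub>P\<^esub> h (n - i) \<in> filt n"
      using filt_mult[OF reesD(1)[OF f] reesD(1)[OF h], of i "n - i"] by simp
  qed simp
next
  fix N
  obtain K where K: "\<And>k. k \<ge> K \<Longrightarrow> N \<le> k \<and> f k \<in> filt (k - N) \<and> h k \<in> filt (k - N)"
    using reesD2[OF f h] by blast
  have "(f \<otimes>\<^bsub>power_series P\<^esub> h) n \<in> filt (n - N)" if n: "n \<ge> 2 * K" for n
    unfolding power_series_simps
  proof (rule filt_finsum)
    fix i assume i: "i \<in> {..n}"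
    show "f i \<otimes>\<^bsub>P\<^esub> h (n - i) \<in> filt (n - N)"
    proof (cases "i \<ge> K")
      case True
      then have "i - N + (n - i) = n - N" using K[of i] i by auto
      then show ?thesis
        using filt_mult[of "f i" "i - N" "h (n - i)" "n - i"] K[OF True] reesD(1)[OF h, of "n - i"]
        by simp
    next
      case False
      then have ni: "n - i \<ge> K" using n by linarith
      then have "i + (n - i - N) = n - N" using K[OF ni] i by auto
      then show ?thesis
        using filt_mult[of "f i" i "h (n - i)" "n - i - N"] K[OF ni] reesD(1)[OF f, of i]
        by simp
    qed
  qed simp
  moreover have "N \<le> n" if "n \<ge> 2 * K" for n
    using K[of n] that by simp
  ultimately show "\<exists>K. \<forall>k\<ge>K. N \<le> k \<and> (f \<otimes>\<^bsub>power_series P\<^esub> h) k \<in> filt (k - N)"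
    by blast
qed

lemma coeffs_of_degree_zero_in_rees:
  assumes "\<And>n. f n \<in> filt 0"
  shows "f \<in> carrier (rees X S)"
proof -
  have "f n \<in> filt k" for n k
    using assms filt_mono[of 0 k] by blast
  then show ?thesis
    unfolding rees_carrier_iff by auto
qed

lemma rees_subring: "subring (carrier (rees X S)) (power_series P)"
proof (rule series.subringI)
  show "\<one>\<^bsub>power_series P\<^esub> \<in> carrier (rees X S)"
    by (rule coeffs_of_degree_zero_in_rees) (simp_all add: power_series_simps filt_zero filt_one)
  show "\<ominus>\<^bsub>power_series P\<^esub> f \<in> carrier (rees X S)" if f: "f \<in> carrier (rees X S)" for f
  proof -
    have "(\<lambda>k. \<ominus>\<^bsub>P\<^esub> f k) \<in> carrier (rees X S)"
      using f unfolding rees_carrier_iff by (meson filt_uminus)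
    then show ?thesis
      using power_series_uminus f rees_subset by auto
  qed
  show "f \<oplus>\<^bsub>power_series P\<^esub> h \<in> carrier (rees X S)"
    if f: "f \<in> carrier (rees X S)" and h: "h \<in> carrier (rees X S)" for f h
    unfolding rees_carrier_iff power_series_simps
    using reesD2[OF f h] reesD(1)[OF f] reesD(1)[OF h] by (meson filt_add)
qed (auto simp: rees_subset intro: rees_mult_closed)

lemma sc_series_in_rees: "coeff_classes (sc_series c) \<in> carrier (rees X S)"
  by (rule coeffs_of_degree_zero_in_rees)
    (auto simp: coeff_classes_def sc_series_def pres_le_def intro!: imageI single_in_tensor_le)

lemma power_series_smult:
  assumes "f \<in> carrier (power_series P)"
  shows "c \<odot>\<^bsub>power_series P\<^esub> f = coeff_classes (sc_series c) \<otimes>\<^bsub>power_series P\<^esub> f"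
  using assms by (auto simp: power_series_carrier power_series_ops tensor_series_closed)

lemma rees_smult_closed:
  assumes "f \<in> carrier (rees X S)"
  shows "c \<odot>\<^bsub>power_series P\<^esub> f \<in> carrier (rees X S)"
  using rees_mult_closed[OF sc_series_in_rees assms] power_series_smult assms rees_subset by auto

sublocale rees: scaled_ring "rees X S"
  using series.scaled_subring[OF rees_subring rees_smult_closed] rees_eq by simp

lemma rees_simps:
  "mult (rees X S) = mult (power_series P)" "add (rees X S) = add (power_series P)"
  "one (rees X S) = one (power_series P)" "zero (rees X S) = zero (power_series P)"
  "smult (rees X S) = smult (power_series P)"
  by (simp_all add: rees_def)

lemma rees_uminus:
  assumes "f \<in> carrier (rees X S)"
  shows "\<ominus>\<^bsub>rees X S\<^esub> f = (\<lambda>k. \<ominus>\<^bsub>P\<^esub> f k)"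
proof -
  have "(\<lambda>k. \<ominus>\<^bsub>P\<^esub> f k) \<in> carrier (rees X S)"
    using assms unfolding rees_carrier_iff by (meson filt_uminus)
  moreover have "f k \<in> carrier P" for k
    using reesD(1)[OF assms] filt_in_carrier by blast
  ultimately show ?thesis
    by (intro rees.minus_equality) (use assms in \<open>auto simp: power_series_simps rees_simps P.l_neg\<close>)
qed

text \<open>The series all of whose coefficients commute with \<open>M\<close>. With \<open>M\<close> the image of the comoment map
  on linear forms, these are the invariants.\<close>
definition commutant :: "'x pres_elt set \<Rightarrow> (nat \<Rightarrow> 'x pres_elt) set" where
  "commutant M = {f \<in> carrier (rees X S). \<forall>m\<in>M. \<forall>k. m \<otimes>\<^bsub>P\<^esub> f k = f k \<otimes>\<^bsub>P\<^esub> m}"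

lemma commutant_scaled_ring:
  assumes M: "M \<subseteq> carrier P"
  shows "scaled_ring ((rees X S)\<lparr>carrier := commutant M\<rparr>)"
proof -
  have sub: "commutant M \<subseteq> carrier (rees X S)"
    by (auto simp: commutant_def)
  have c: "f k \<in> carrier P" if "f \<in> carrier (rees X S)" for f k
    using reesD(1)[OF that] filt_in_carrier by blast
  have comm: "m \<otimes>\<^bsub>P\<^esub> f k = f k \<otimes>\<^bsub>P\<^esub> m" if "f \<in> commutant M" "m \<in> M" for f m k
    using that by (simp add: commutant_def)
  have mult: "f \<otimes>\<^bsub>rees X S\<^esub> h \<in> commutant M"
    if f: "f \<in> commutant M" and h: "h \<in> commutant M" for f h
  proof -
    have fc: "\<And>k. f k \<in> carrier P" and hc: "\<And>k. h k \<in> carrier P"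
      using c f h sub by auto
    have "m \<otimes>\<^bsub>P\<^esub> (f \<otimes>\<^bsub>rees X S\<^esub> h) n = (f \<otimes>\<^bsub>rees X S\<^esub> h) n \<otimes>\<^bsub>P\<^esub> m" if m: "m \<in> M" for m n
    proof -
      have mc: "m \<in> carrier P" using m M by auto
      have "m \<otimes>\<^bsub>P\<^esub> (f i \<otimes>\<^bsub>P\<^esub> h j) = f i \<otimes>\<^bsub>P\<^esub> h j \<otimes>\<^bsub>P\<^esub> m" for i j
        using comm[OF f m, of i] comm[OF h m, of j] fc hc mc
        by (metis P.m_assoc)
      then show ?thesis
        using fc hc mc by (simp add: rees_simps power_series_simps P.finsum_rdistr P.finsum_ldistr Pi_def)
    qed
    moreover have "f \<otimes>\<^bsub>rees X S\<^esub> h \<in> carrier (rees X S)"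
      using f h sub by blast
    ultimately show ?thesis by (simp add: commutant_def)
  qed
  have uminus: "\<ominus>\<^bsub>rees X S\<^esub> f \<in> commutant M" if f: "f \<in> commutant M" for f
  proof -
    have fr: "f \<in> carrier (rees X S)" using f sub by auto
    have "m \<otimes>\<^bsub>P\<^esub> (\<ominus>\<^bsub>P\<^esub> f k) = (\<ominus>\<^bsub>P\<^esub> f k) \<otimes>\<^bsub>P\<^esub> m" if "m \<in> M" for m k
      using comm[OF f that] c[OF fr] that M by (auto simp: P.l_minus P.r_minus)
    moreover have "\<ominus>\<^bsub>rees X S\<^esub> f \<in> carrier (rees X S)"
      using fr by blast
    ultimately show ?thesis
      by (simp add: commutant_def rees_uminus[OF fr])
  qed
  have add: "f \<oplus>\<^bsub>rees X S\<^esub> h \<in> commutant M"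
    if f: "f \<in> commutant M" and h: "h \<in> commutant M" for f h
  proof -
    have "m \<otimes>\<^bsub>P\<^esub> (f k \<oplus>\<^bsub>P\<^esub> h k) = (f k \<oplus>\<^bsub>P\<^esub> h k) \<otimes>\<^bsub>P\<^esub> m" if m: "m \<in> M" for m k
    proof -
      have "m \<in> carrier P" "f k \<in> carrier P" "h k \<in> carrier P"
        using m M f h sub c by auto
      then show ?thesis
        using comm[OF f m] comm[OF h m] by (simp add: P.l_distr P.r_distr)
    qed
    moreover have "f \<oplus>\<^bsub>rees X S\<^esub> h \<in> carrier (rees X S)"
      using f h sub by blast
    ultimately show ?thesis
      by (auto simp: commutant_def rees_simps power_series_simps)
  qed
  have smult: "c \<odot>\<^bsub>rees X S\<^esub> f \<in> commutant M" if f: "f \<in> commutant M" for c f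
  proof -
    let ?s = "coeff_classes (sc_series c)"
    have "m \<otimes>\<^bsub>P\<^esub> ?s k = ?s k \<otimes>\<^bsub>P\<^esub> m" if "m \<in> M" for m k
      using that M by (auto simp: carrier_P coeff_classes_def sc_series_def P_ops tensors_closed
          sc_commute dest!: subsetD)
    then have "?s \<in> commutant M"
      by (simp add: commutant_def sc_series_in_rees)
    then have "?s \<otimes>\<^bsub>rees X S\<^esub> f \<in> commutant M"
      by (rule mult) (rule f)
    then show ?thesis
      using power_series_smult f sub rees_subset by (auto simp: rees_simps)
  qed
  have "\<one>\<^bsub>rees X S\<^esub> \<in> commutant M"
  proof -
    have "m \<otimes>\<^bsub>P\<^esub> \<one>\<^bsub>rees X S\<^esub> k = \<one>\<^bsub>rees X S\<^esub> k \<otimes>\<^bsub>P\<^esub> m" if "m \<in> M" for m k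
      using that M by (auto simp: rees_simps power_series_simps)
    then show ?thesis
      by (simp add: commutant_def)
  qed
  then have "subring (commutant M) (rees X S)"
    by (intro rees.subringI sub mult uminus add)
  then show ?thesis
    by (rule rees.scaled_subring) (rule smult)
qed

end

text \<open>A map that multiplies filtration degrees by at most \<open>r\<close> acts on Rees algebras when \<open>\<hbar>\<close> is sent to
  \<open>\<hbar>\<^sup>r\<close>: the defect \<open>k - |f\<^sub>k|\<close> is multiplied by at least \<open>r\<close>, and the new coefficients in degrees not
  divisible by \<open>r\<close> vanish.\<close>
lemma rees_spread_in_carrier:
  assumes "presentation X S" "presentation Y S'" and r: "r > 0"
    and h: "\<And>k x. x \<in> pres_le X S k \<Longrightarrow> h x \<in> pres_le Y S' (r * k)"
    and f: "f \<in> carrier (rees X S)"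
  shows "(\<lambda>n. if r dvd n then h (f (n div r)) else \<zero>\<^bsub>pres_alg Y S'\<^esub>) \<in> carrier (rees Y S')"
    (is "?f \<in> _")
proof -
  interpret X: presentation X S by fact
  interpret Y: presentation Y S' by fact
  show ?thesis
    unfolding Y.rees_carrier_iff
  proof (intro conjI allI)
    show "?f n \<in> pres_le Y S' n" for n
      using h[OF X.reesD(1)[OF f], of "n div r"] by (auto simp: Y.filt_zero)
    fix N
    obtain K where K: "\<And>k. k \<ge> K \<Longrightarrow> N \<le> k \<and> f k \<in> pres_le X S (k - N)"
      using X.reesD(2)[OF f] by blast
    have "N \<le> n \<and> ?f n \<in> pres_le Y S' (n - N)" if n: "n \<ge> r * K + N" for n
    proof (cases "r dvd n")
      case True
      then obtain k where k: "n = r * k" by (elim dvdE)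
      then have "k \<ge> K" using n r by (meson add_leD1 mult_le_cancel1)
      then have "h (f k) \<in> pres_le Y S' (r * (k - N))"
        using K h by blast
      moreover have "r * (k - N) \<le> n - N"
        using r by (simp add: k diff_mult_distrib2 diff_le_mono2)
      ultimately show ?thesis
        using n True k r Y.filt_mono by auto
    qed (use n in \<open>simp add: Y.filt_zero\<close>)
    then show "\<exists>K. \<forall>k\<ge>K. N \<le> k \<and> ?f k \<in> pres_le Y S' (k - N)"
      by blast
  qed
qed

lemma rees_map_alg_hom:
  assumes "presentation X S" "presentation Y S'"
    and hom: "h \<in> alg_hom (pres_alg X S) (pres_alg Y S')"
    and h: "\<And>k x. x \<in> pres_le X S k \<Longrightarrow> h x \<in> pres_le Y S' k"
  shows "(\<lambda>f k. h (f k)) \<in> alg_hom (rees X S) (rees Y S')"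
proof -
  interpret X: presentation X S by fact
  interpret Y: presentation Y S' by fact
  note D = alg_homD[OF power_series_map_alg_hom[OF X.P.scaled_ring_axioms Y.P.scaled_ring_axioms hom]]
    and [simp] = subsetD[OF X.rees_subset]
  have "(\<lambda>k. h (f k)) \<in> carrier (rees Y S')" if "f \<in> carrier (rees X S)" for f
    using rees_spread_in_carrier[OF assms(1,2), of 1 h f] h that by simp
  then show ?thesis
    by (intro alg_homI)
      (simp_all add: X.rees_simps Y.rees_simps D)
qed

section \<open>Covariance of the parameters\<close>

lemma SL2_det:
  assumes "g \<in> SL2"
  shows "g $$ (0,0) * g $$ (1,1) - g $$ (0,1) * g $$ (1,0) = 1"
proof -
  have g: "g \<in> carrier_mat 2 2" "Determinant.det g = 1"
    using assms by (auto simp: SL2_def)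
  then have "mat_delete g i 0 \<in> carrier_mat 1 1" for i
    by (intro carrier_matI) auto
  then have "Determinant.det g = g $$ (0,0) * g $$ (1,1) - g $$ (1,0) * g $$ (0,1)"
    using g(1) by (subst laplace_expansion_column[of g 2 0])
      (auto simp: cofactor_def numeral_2_eq_2 det_single, auto simp: mat_delete_def)
  then show ?thesis using g(2) by (simp add: mult.commute)
qed

lemma SL2_mult_entries:
  assumes "g \<in> SL2" "h \<in> SL2"
  shows "(g * h) $$ (0,0) = g $$ (0,0) * h $$ (0,0) + g $$ (0,1) * h $$ (1,0)"
    and "(g * h) $$ (0,1) = g $$ (0,0) * h $$ (0,1) + g $$ (0,1) * h $$ (1,1)"
    and "(g * h) $$ (1,0) = g $$ (1,0) * h $$ (0,0) + g $$ (1,1) * h $$ (1,0)"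
    and "(g * h) $$ (1,1) = g $$ (1,0) * h $$ (0,1) + g $$ (1,1) * h $$ (1,1)"
  using assms by (auto simp: SL2_def scalar_prod_def numeral_2_eq_2)

lemma SL2_mult_closed:
  assumes "g \<in> SL2" "h \<in> SL2"
  shows "g * h \<in> SL2"
  using assms by (auto simp: SL2_def det_mult[where n = 2])

lemma eta_pt_nonzero:
  assumes "g \<in> SL2"
  shows "eta_pt g x \<noteq> 0"
proof (cases x)
  case (Fin z)
  have "g $$ (0,1) \<noteq> g $$ (1,1) * z" if "g $$ (0,0) = g $$ (1,0) * z"
    using SL2_det[OF assms] that by auto
  then show ?thesis using Fin by auto
qed (use SL2_det[OF assms] in auto)

lemma eps_pt_swap: "eps_pt y x = - eps_pt x y"
  by (cases x; cases y) (auto simp: divide_simps)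

text \<open>For finite points with finite images this is the familiar formula
  \<open>g z - g w = (z - w) / ((a - c z) (a - c w))\<close> for Moebius transformations. The values of \<open>\<eta>\<close> at poles and
  at infinity are exactly those for which it survives in the limiting cases.\<close>
lemma eps_pt_covariant:
  assumes "g \<in> SL2"
  shows "eps_pt (act_pt g x) (act_pt g y) * (eta_pt g x * eta_pt g y) = eps_pt x y"
proof -
  obtain a b c d where g: "g $$ (0,0) = a" "g $$ (0,1) = b" "g $$ (1,0) = c" "g $$ (1,1) = d"
    by blast
  have det: "a * d - b * c = 1"
    using SL2_det[OF assms] g by simp
  note g = g g[unfolded One_nat_def]
  \<comment> \<open>At a pole the determinant condition reads \<open>- c (b - d z) = 1\<close>.\<close>
  have sing: "inverse (b - d * z) = - c" if "a = c * z" for z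
  proof -
    have "(b - d * z) * (- c) = 1" using det that by (simp add: algebra_simps)
    then show ?thesis by (rule inverse_unique)
  qed
  have finfin: "eps_pt (act_pt g (Fin z)) (act_pt g (Fin w)) * (eta_pt g (Fin z) * eta_pt g (Fin w))
      = eps_pt (Fin z) (Fin w)" if w: "a \<noteq> c * w" for z w
  proof (cases "a = c * z")
    case False
    define u v where "u = inverse (a - c * z)" and "v = inverse (a - c * w)"
    have u: "u * (a - c * z) = 1" "u \<noteq> 0" and v: "v * (a - c * w) = 1" "v \<noteq> 0"
      using False w by (simp_all add: u_def v_def)
    have "- ((b - d * z) * u) - - ((b - d * w) * v)
        = (b - d * w) * v * (u * (a - c * z)) - (b - d * z) * u * (v * (a - c * w))"
      using u(1) v(1) by simp
    also have "\<dots> = (a * d - b * c) * ((z - w) * (u * v))"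
      by (simp add: algebra_simps)
    finally have "- ((b - d * z) * u) - - ((b - d * w) * v) = (z - w) * (u * v)"
      using det by simp
    then have "1 / (- ((b - d * z) * u) - - ((b - d * w) * v)) * (u * v) = 1 / (z - w)"
      using u(2) v(2) by simp
    then show ?thesis
      using False w by (simp add: g u_def v_def divide_inverse)
  next
    case True
    have "c \<noteq> 0" using det True by auto
    have "a - c * w = c * (z - w)" by (simp add: True algebra_simps)
    then show ?thesis
      using True w \<open>c \<noteq> 0\<close> by (simp add: g sing[OF True] divide_inverse)
  qed
  have fininf: "eps_pt (act_pt g (Fin z)) (act_pt g Infty) * (eta_pt g (Fin z) * eta_pt g Infty) = 1" for z
  proof (cases "c = 0")
    case True
    then show ?thesis using det by (auto simp: g)
  next
    case c: False
    show ?thesis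
    proof (cases "a = c * z")
      case True
      then show ?thesis using c by (simp add: g sing[OF True])
    next
      case False
      define u v where "u = inverse (a - c * z)" and "v = inverse c"
      have u: "u * (a - c * z) = 1" "u \<noteq> 0" and v: "v * c = 1" "v \<noteq> 0"
        using False c by (simp_all add: u_def v_def)
      have "- ((b - d * z) * u) - - (d * v)
          = d * v * (u * (a - c * z)) - (b - d * z) * u * (v * c)"
        using u(1) v(1) by simp
      also have "\<dots> = (a * d - b * c) * (u * v)"
        by (simp add: algebra_simps)
      finally have "- ((b - d * z) * u) - - (d * v) = u * v"
        using det by simp
      then have "1 / (- ((b - d * z) * u) - - (d * v)) * (u * v) = 1"
        using u(2) v(2) by simp
      then show ?thesis
        using False c by (simp add: g u_def v_def divide_inverse)
    qed
  qed
  show ?thesis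
  proof (cases x; cases y)
    fix z w assume xy: "x = Fin z" "y = Fin w"
    show ?thesis
    proof (cases "a = c * w")
      case False
      then show ?thesis using finfin xy by simp
    next
      case w: True
      show ?thesis
      proof (cases "a = c * z")
        case True
        then have "z = w" using w det by auto
        then show ?thesis using True by (simp add: xy g)
      next
        case False
        then show ?thesis
          using finfin[of z w] unfolding xy
          by (metis (no_types, lifting) eps_pt_swap finfin minus_mult_left mult.commute)
      qed
    qed
  next
    fix z assume "x = Fin z" "y = Infty"
    then show ?thesis using fininf by simp
  next
    fix w assume xy: "x = Infty" "y = Fin w"
    show ?thesis
      using fininf[of w] eps_pt_swap[of "act_pt g Infty" "act_pt g (Fin w)"] unfolding xy
      by (simp add: mult.commute)
  next
    assume "x = Infty" "y = Infty"
    then show ?thesis by (cases "act_pt g Infty") simp_all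
  qed
qed

text \<open>The factor \<open>\<eta>\<close> is the inverse of the denominator \<open>a - c z\<close> of the transformation, and denominators
  form a multiplicative cocycle, as the factors by which a matrix changes a homogeneous coordinate. At a pole the numerator takes the place of the
  denominator, and the unit determinant makes the two sides agree.\<close>
lemma act_eta_pt_mult:
  assumes "g \<in> SL2" "h \<in> SL2"
  shows "act_pt (g * h) x = act_pt h (act_pt g x)"
    and "eta_pt (g * h) x = eta_pt g x * eta_pt h (act_pt g x)"
proof -
  obtain a b c d where g: "g $$ (0,0) = a" "g $$ (0,1) = b" "g $$ (1,0) = c" "g $$ (1,1) = d"
    by blast
  obtain a' b' c' d' where h: "h $$ (0,0) = a'" "h $$ (0,1) = b'" "h $$ (1,0) = c'" "h $$ (1,1) = d'"
    by blast
  obtain A B C D where gh: "(g * h) $$ (0,0) = A" "(g * h) $$ (0,1) = B"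
    "(g * h) $$ (1,0) = C" "(g * h) $$ (1,1) = D"
    by blast
  note e = SL2_mult_entries[OF assms, unfolded g h gh]
  have det: "a * d - b * c = 1" "a' * d' - b' * c' = 1" "A * D - B * C = 1"
    using SL2_det[OF assms(1)] SL2_det[OF assms(2)] SL2_det[OF SL2_mult_closed[OF assms]] g h gh
    by simp_all
  note g = g g[unfolded One_nat_def] and h = h h[unfolded One_nat_def]
    and gh = gh gh[unfolded One_nat_def]
  have "act_pt (g * h) x = act_pt h (act_pt g x) \<and>
    eta_pt (g * h) x = eta_pt g x * eta_pt h (act_pt g x)"
  proof (cases x)
    case (Fin z)
    show ?thesis
    proof (cases "a = c * z")
      case False
      define u where "u = inverse (a - c * z)"
      have u: "u * (a - c * z) = 1" "u \<noteq> 0"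
        using False by (simp_all add: u_def)
      have "(A - C * z) * u = a' * (u * (a - c * z)) + c' * ((b - d * z) * u)"
        and "(B - D * z) * u = b' * (u * (a - c * z)) + d' * ((b - d * z) * u)"
        by (simp_all add: e algebra_simps)
      then have 1: "a' - c' * (- ((b - d * z) * u)) = (A - C * z) * u"
        and 2: "b' - d' * (- ((b - d * z) * u)) = (B - D * z) * u"
        by (simp_all add: u(1))
      have x: "act_pt g x = Fin (- ((b - d * z) * u))" "eta_pt g x = u"
        using False by (simp_all add: Fin g u_def divide_inverse)
      have "a' = c' * (- ((b - d * z) * u)) \<longleftrightarrow> A = C * z"
        using 1 u(2) by (metis eq_iff_diff_eq_0 mult_eq_0_iff)
      then show ?thesis
        unfolding x unfolding Fin act_pt.simps eta_pt.simps g h gh 1 2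
        using u(2) by simp
    next
      case True
      define u where "u = b - d * z"
      have u: "u \<noteq> 0" using det True by (auto simp: u_def)
      have 1: "A - C * z = c' * u" and 2: "B - D * z = d' * u"
        by (simp_all add: e u_def True algebra_simps)
      have x: "act_pt g x = Infty" "eta_pt g x = inverse u"
        using True by (simp_all add: Fin g u_def)
      have 3: "A = C * z \<longleftrightarrow> c' = 0"
        using 1 u by (metis eq_iff_diff_eq_0 mult_eq_0_iff)
      have 4: "a' = inverse d'" if "c' = 0"
        using det that inverse_unique[of d' a'] by (simp add: mult.commute)
      show ?thesis
        unfolding x unfolding Fin act_pt.simps eta_pt.simps g h gh 1 2 3
        using u 4 by simp
    qed
  next
    case Infty
    show ?thesis
    proof (cases "c = 0")
      case False
      have 1: "a' - c' * (- (d / c)) = C / c" and 2: "b' - d' * (- (d / c)) = D / c"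
        using False by (simp_all add: e field_simps)
      have x: "act_pt g x = Fin (- (d / c))" "eta_pt g x = inverse c"
        using False by (simp_all add: Infty g)
      have 3: "a' = c' * (- (d / c)) \<longleftrightarrow> C = 0"
        using 1 False by (metis divide_eq_0_iff eq_iff_diff_eq_0)
      have 4: "A = inverse D" if "C = 0"
        using det that inverse_unique[of D A] by (simp add: mult.commute)
      show ?thesis
        unfolding x unfolding Infty act_pt.simps eta_pt.simps g h gh 1 2 3
        using False 4 by (simp add: inverse_eq_divide)
    next
      case True
      have x: "act_pt g x = Infty" "eta_pt g x = a"
        using True by (simp_all add: Infty g)
      have ad: "a * d = 1" "d \<noteq> 0" using det True by auto
      have CD: "C = d * c'" "D = d * d'" using True e by simp_all
      show ?thesis
        unfolding x unfolding Infty act_pt.simps eta_pt.simps g h gh CD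
        using ad by (auto simp: e field_simps)
    qed
  qed
  then show "act_pt (g * h) x = act_pt h (act_pt g x)"
    and "eta_pt (g * h) x = eta_pt g x * eta_pt h (act_pt g x)"
    by blast+
qed

lemma act_mult:
  assumes "g \<in> SL2" "h \<in> SL2"
  shows "act a (g * h) = act (act a g) h"
  using act_eta_pt_mult[OF assms] by (simp add: act_def)

lemma eta_mult:
  assumes "g \<in> SL2" "h \<in> SL2"
  shows "eta (g * h) a j = eta g a j * eta h (act a g) j"
  using act_eta_pt_mult[OF assms] by (simp add: act_def eta_def)

lemma eps_covariant:
  assumes "g \<in> SL2"
  shows "eps (act a g) j j' * (eta g a j * eta g a j') = eps a j j'"
  using eps_pt_covariant[OF assms] by (simp add: eps_def act_def eta_def)

lemma eps_nonzero:
  assumes "inj a" "j \<noteq> j'"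
  shows "eps a j j' \<noteq> 0"
proof -
  have "a j \<noteq> a j'" using assms by (auto dest: injD)
  then show ?thesis
    unfolding eps_def by (cases "a j"; cases "a j'") auto
qed

text \<open>Covariance detects coinciding points, because \<open>\<epsilon>\<close> is zero exactly there.\<close>
lemma act_inj:
  assumes "g \<in> SL2" "inj a"
  shows "inj (act a g)"
proof (rule injI)
  fix j j' assume "act a g j = act a g j'"
  then have "eps (act a g) j j' = 0"
    by (cases "act a g j'") (simp_all add: eps_def)
  then have "eps a j j' = 0"
    using eps_covariant[OF assms(1), of a j j'] by simp
  then show "j = j'"
    using eps_nonzero[OF assms(2)] by blast
qed

section \<open>The rescaling morphism\<close>

lemma finite_bvars: "finite (bvars part d)" for part :: "'i::finite \<Rightarrow> 'j"
proof (rule finite_subset)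
  show "bvars part d \<subseteq> UNIV \<times> (\<Union>i. {..<d i}) \<times> (\<Union>i. {..<d i})"
    by (auto simp: bvars_def)
qed auto

lemma lin_part_subset: "lin_part X \<subseteq> tensors X"
  by (auto simp: lin_part_def tensors_eq)

lemma gen_in_lin_part: "x \<in> X \<Longrightarrow> gen x \<in> lin_part X"
  by (auto simp: lin_part_def gen_def)

lemma presentation_weyl: "presentation (bvars part d) (weyl_rels part d a)"
proof
  show "weyl_rels part d a \<subseteq> tensors (bvars part d)"
    using lin_part_subset unfolding weyl_rels_def
    by (force intro!: tensors_diff tensors_mult single_in_tensors)
qed

interpretation weyl: presentation "bvars part d" "weyl_rels part d a"
  by (rule presentation_weyl)

lemma lin_part_expand:
  assumes "finite X" "f \<in> lin_part X"
  shows "f = (\<Sum>x\<in>X. sc (Poly_Mapping.lookup f [x]) * gen x)"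
proof -
  have "f = (\<Sum>w\<in>Poly_Mapping.keys f. Poly_Mapping.single w (Poly_Mapping.lookup f w))"
    by (rule poly_mapping_sum_single)
  also have "\<dots> = (\<Sum>w\<in>(\<lambda>x. [x]) ` X. Poly_Mapping.single w (Poly_Mapping.lookup f w))"
    by (rule sum.mono_neutral_left) (use assms in \<open>auto simp: lin_part_def in_keys_iff\<close>)
  also have "\<dots> = (\<Sum>x\<in>X. Poly_Mapping.single [x] (Poly_Mapping.lookup f [x]))"
    by (subst sum.reindex) (auto intro: inj_onI)
  finally show ?thesis
    by (simp add: gen_def single_mult_single)
qed

lemma subst_rescale_lin_part:
  fixes e :: "'x \<Rightarrow> complex"
  assumes "finite X" "f \<in> lin_part X"
  defines "f' \<equiv> subst (\<lambda>x. sc (e x) * gen x) f"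
  shows "f' \<in> lin_part X"
    and "\<And>x. x \<in> X \<Longrightarrow> Poly_Mapping.lookup f' [x] = e x * Poly_Mapping.lookup f [x]"
proof -
  have "f' = (\<Sum>x\<in>X. sc (Poly_Mapping.lookup f [x]) * (sc (e x) * gen x))"
    unfolding f'_def by (subst lin_part_expand[OF assms(1,2)]) (simp add: subst_sum subst_mult)
  also have "\<dots> = (\<Sum>x\<in>X. Poly_Mapping.single [x] (e x * Poly_Mapping.lookup f [x]))"
    by (simp add: gen_def single_mult_single mult.commute)
  finally have f': "f' = (\<Sum>x\<in>X. Poly_Mapping.single [x] (e x * Poly_Mapping.lookup f [x]))" .
  have "Poly_Mapping.keys f' \<subseteq> (\<Union>x\<in>X. {[x]})"
    unfolding f' using assms(1)
  proof (induction X rule: finite_induct)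
    case (insert y Y)
    let ?y = "Poly_Mapping.single [y] (e y * Poly_Mapping.lookup f [y])"
      and ?Y = "\<Sum>x\<in>Y. Poly_Mapping.single [x] (e x * Poly_Mapping.lookup f [x])"
    show ?case
      using insert keys_add[of ?y ?Y] by (auto split: if_splits)
  qed simp
  then show "f' \<in> lin_part X"
    by (auto simp: lin_part_def)
  show "Poly_Mapping.lookup f' [x] = e x * Poly_Mapping.lookup f [x]" if "x \<in> X" for x
    using that assms(1) by (simp add: f' lookup_sum lookup_single when_def)
qed

definition rescale :: "('i \<Rightarrow> 'j) \<Rightarrow> complex mat \<Rightarrow> ('j \<Rightarrow> cp1) \<Rightarrow> 'i bvar \<Rightarrow> 'i bvar list \<Rightarrow>\<^sub>0 complex" where
  "rescale part g a x = sc (eta g a (part (snd (fst x)))) * gen x"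

text \<open>The bracket pairs an arrow \<open>\<alpha>\<close> with its opposite, so the two rescaling factors belong to the two
  ends of \<open>\<alpha>\<close>, and their product is what turns \<open>\<epsilon>\<^sub>\<alpha>\<close> at \<open>a.g\<close> into \<open>\<epsilon>\<^sub>\<alpha>\<close> at \<open>a\<close>.\<close>
lemma bracket_var_covariant:
  assumes "g \<in> SL2"
  shows "eta g a (part (snd (fst x))) * eta g a (part (snd (fst y))) * bracket_var part a x y
    = bracket_var part (act a g) x y"
proof -
  obtain \<alpha> k l \<beta> k' l' where xy: "x = (\<alpha>, k, l)" "y = (\<beta>, k', l')"
    by (cases x; cases y)
  have "eta g a j \<noteq> 0" for j
    by (simp add: eta_def eta_pt_nonzero[OF assms])
  moreover have "eps_arrow part a \<alpha> = eps_arrow part (act a g) \<alpha> *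
      (eta g a (part (snd \<alpha>)) * eta g a (part (fst \<alpha>)))"
    unfolding eps_arrow_def by (rule eps_covariant[OF assms, symmetric])
  ultimately show ?thesis
    by (auto simp: xy opp_def field_simps)
qed

text \<open>The rescaling maps linear forms to linear forms and preserves their bracket, so each defining
  relation goes to a defining relation, not merely into the ideal.\<close>
lemma rescale_weyl_rels:
  fixes part :: "'i::finite \<Rightarrow> 'j"
  assumes "g \<in> SL2" "s \<in> weyl_rels part d (act a g)"
  shows "subst (rescale part g a) s \<in> weyl_rels part d a"
proof -
  let ?X = "bvars part d" and ?e = "\<lambda>x. eta g a (part (snd (fst x)))"
  obtain f h where fh: "f \<in> lin_part ?X" "h \<in> lin_part ?X"
    and s: "s = f * h - h * f - sc (bracket part d (act a g) f h)"
    using assms(2) by (auto simp: weyl_rels_def)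
  have re: "rescale part g a = (\<lambda>x. sc (?e x) * gen x)"
    by (simp add: rescale_def fun_eq_iff)
  let ?f = "subst (rescale part g a) f" and ?h = "subst (rescale part g a) h"
  note f = subst_rescale_lin_part[OF finite_bvars fh(1), where e = ?e, folded re]
    and h = subst_rescale_lin_part[OF finite_bvars fh(2), where e = ?e, folded re]
  have "bracket part d a ?f ?h = bracket part d (act a g) f h"
    unfolding bracket_def
    by (intro sum.cong refl) (simp add: f(2) h(2) mult_ac flip: bracket_var_covariant[OF assms(1)])
  then have "subst (rescale part g a) s = ?f * ?h - ?h * ?f - sc (bracket part d a ?f ?h)"
    by (simp add: s subst_simps)
  then show ?thesis
    using f(1) h(1) unfolding weyl_rels_def by blast
qed

lemma rescale_in_tensor_le: "x \<in> X \<Longrightarrow> rescale part g a x \<in> tensor_le X 1"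
  unfolding rescale_def gen_def by (intro tensor_le_sc_mult single_in_tensor_le) auto

lemma rescale_in_tensors: "x \<in> X \<Longrightarrow> rescale part g a x \<in> tensors X"
  by (simp add: rescale_def tensors_closed)

lemma rescale_mult:
  assumes "g \<in> SL2" "h \<in> SL2"
  shows "subst (rescale part g a) (rescale part h (act a g) x) = rescale part (g * h) a x"
  by (simp add: rescale_def subst_mult eta_mult[OF assms] sc_mult mult.commute[of "eta g a _"]
      mult.assoc)

lemma phi_eq:
  fixes part :: "'i::finite \<Rightarrow> 'j"
  assumes "g \<in> SL2"
  shows "phi part d g a \<in> alg_hom (weyl part d (act a g)) (weyl part d a)"
    and "\<And>p. p \<in> tensors (bvars part d) \<Longrightarrow>
      phi part d g a (pres_class (bvars part d) (weyl_rels part d (act a g)) p)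
      = pres_class (bvars part d) (weyl_rels part d a) (subst (rescale part g a) p)"
proof -
  let ?X = "bvars part d"
  have s: "subst (rescale part g a) s \<in> relation_ideal ?X (weyl_rels part d a)"
    if "s \<in> weyl_rels part d (act a g)" for s
    using rescale_weyl_rels[OF assms that] by (rule weyl.relation_mem)
  have u: "(\<lambda>(\<alpha>, k, l). eta g a (part (snd \<alpha>)) \<odot>\<^bsub>weyl part d a\<^esub> Bhat part d a \<alpha> k l) x
      = pres_class ?X (weyl_rels part d a) (rescale part g a x)" if "x \<in> ?X" for x
    using that by (cases x) (simp add: weyl_def Bhat_def rescale_def weyl.P_ops gen_in_tensors)
  note * = pres_hom_substitution[OF presentation_weyl presentation_weyl rescale_in_tensors s u]
  show "phi part d g a \<in> alg_hom (weyl part d (act a g)) (weyl part d a)"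
    using *(1) by (simp add: phi_def weyl_def)
  show "phi part d g a (pres_class ?X (weyl_rels part d (act a g)) p)
      = pres_class ?X (weyl_rels part d a) (subst (rescale part g a) p)" if "p \<in> tensors ?X" for p
    using *(2)[OF _ _ _ that] by (simp add: phi_def weyl_def)
qed

lemma phi_filtered:
  fixes part :: "'i::finite \<Rightarrow> 'j"
  assumes "g \<in> SL2" "x \<in> pres_le (bvars part d) (weyl_rels part d (act a g)) k"
  shows "phi part d g a x \<in> pres_le (bvars part d) (weyl_rels part d a) k"
proof -
  obtain p where p: "p \<in> tensor_le (bvars part d) k" "p \<in> tensors (bvars part d)"
    "x = pres_class (bvars part d) (weyl_rels part d (act a g)) p"
    using assms(2) by (rule weyl.filtE)
  have "subst (rescale part g a) p \<in> tensor_le (bvars part d) (1 * k)"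
    by (rule subst_tensor_le[OF rescale_in_tensor_le p(1)])
  then show ?thesis
    unfolding p(3) phi_eq(2)[OF assms(1) p(2)] by (simp add: weyl.filtI)
qed

lemma phi_mult:
  fixes part :: "'i::finite \<Rightarrow> 'j"
  assumes "g \<in> SL2" "h \<in> SL2" "x \<in> carrier (weyl part d (act a (g * h)))"
  shows "phi part d (g * h) a x = phi part d g a (phi part d h (act a g) x)"
proof -
  let ?X = "bvars part d"
  obtain p where p: "p \<in> tensors ?X" "x = pres_class ?X (weyl_rels part d (act a (g * h))) p"
    using assms(3) by (auto simp: weyl_def weyl.carrier_P)
  have "subst (rescale part h (act a g)) p \<in> tensors ?X"
    by (rule subst_in_tensors[OF rescale_in_tensors p(1)])
  note q = phi_eq(2)[OF assms(1) this]
  have "phi part d (g * h) a x = pres_class ?X (weyl_rels part d a) (subst (rescale part (g * h) a) p)"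
    unfolding p(2) by (rule phi_eq(2)[OF SL2_mult_closed[OF assms(1,2)] p(1)])
  also have "subst (rescale part (g * h) a) p
      = subst (rescale part g a) (subst (rescale part h (act a g)) p)"
    by (simp only: subst_subst rescale_mult[OF assms(1,2)])
  also have "pres_class ?X (weyl_rels part d a) \<dots> = phi part d g a (phi part d h (act a g) x)"
    unfolding p(2) act_mult[OF assms(1,2)] phi_eq(2)[OF assms(2) p(1)] q ..
  finally show ?thesis .
qed

lemma phi_hbar_alg_hom:
  fixes part :: "'i::finite \<Rightarrow> 'j"
  assumes "g \<in> SL2"
  shows "phi_hbar part d g a \<in> alg_hom (Ahat part d (act a g)) (Ahat part d a)"
  using rees_map_alg_hom[OF presentation_weyl presentation_weyl
      phi_eq(1)[OF assms, unfolded weyl_def] phi_filtered[OF assms]]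
  by (simp add: phi_hbar_def[abs_def] Ahat_def)

section \<open>Inner derivations modulo relations\<close>

text \<open>The tensor \<open>p'\<close> represents the commutator of \<open>q\<close> with \<open>p\<close> in the quotient. It is kept as a relation,
  so that a convenient representative can be chosen at each step; the next lemmas say that the
  commutator with \<open>q\<close> is a derivation.\<close>
definition (in presentation) ad_rel ::
    "('x list \<Rightarrow>\<^sub>0 complex) \<Rightarrow> ('x list \<Rightarrow>\<^sub>0 complex) \<Rightarrow> ('x list \<Rightarrow>\<^sub>0 complex) \<Rightarrow> bool" where
  "ad_rel q p p' \<longleftrightarrow> p \<in> tensors X \<and> p' \<in> tensors X \<and> q * p - p * q - p' \<in> relation_ideal X S"

context presentation
begin

lemma ad_rel_mult:
  assumes "ad_rel q p p'" "ad_rel q r r'"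
  shows "ad_rel q (p * r) (p' * r + p * r')"
proof -
  have "q * (p * r) - p * r * q - (p' * r + p * r')
      = (q * p - p * q - p') * r + p * (q * r - r * q - r')"
    by (simp add: algebra_simps)
  then show ?thesis
    using assms by (simp add: ad_rel_def tensors_closed ideal_closed)
qed

lemma ad_rel_add:
  assumes "ad_rel q p p'" "ad_rel q r r'"
  shows "ad_rel q (p + r) (p' + r')"
proof -
  have "q * (p + r) - (p + r) * q - (p' + r') = (q * p - p * q - p') + (q * r - r * q - r')"
    by (simp add: algebra_simps)
  also have "\<dots> \<in> relation_ideal X S"
    using assms by (intro ideal_closed(1)) (simp_all add: ad_rel_def)
  finally show ?thesis
    using assms by (simp only: ad_rel_def tensors_add)
qed

lemma ad_rel_sc:
  assumes "ad_rel q p p'"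
  shows "ad_rel q (sc c * p) (sc c * p')"
proof -
  have "q * (sc c * p) = sc c * (q * p)"
    by (metis mult.assoc sc_commute)
  then have "q * (sc c * p) - sc c * p * q - sc c * p' = sc c * (q * p - p * q - p')"
    by (simp add: algebra_simps)
  then show ?thesis
    using assms by (simp add: ad_rel_def tensors_closed ideal_closed)
qed

lemma ad_rel_sum:
  assumes "\<And>i. i \<in> E \<Longrightarrow> ad_rel q (f i) (f' i)"
  shows "ad_rel q (sum f E) (sum f' E)"
  using assms
proof (induction E rule: infinite_finite_induct)
  case (insert i E)
  then show ?case by (simp add: ad_rel_add)
qed (simp_all add: ad_rel_def zero_in_tensors zero_mem_ideal)

lemma ad_rel_swap:
  assumes "ad_rel q p p'" "q \<in> tensors X"
  shows "ad_rel p q (- p')"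
proof -
  have "p * q - q * p - (- p') = - (q * p - p * q - p')"
    by simp
  then show ?thesis
    using assms ideal_closed(2) unfolding ad_rel_def by (metis tensors_uminus)
qed

end

section \<open>Symmetrised products\<close>

text \<open>Twice the symmetrised product. Derivations act on it without producing any ordering
  corrections, and for this reason the comoment map of symmetrised quadratic elements has no
  central anomaly.\<close>
definition symm :: "('x list \<Rightarrow>\<^sub>0 complex) \<Rightarrow> ('x list \<Rightarrow>\<^sub>0 complex) \<Rightarrow> 'x list \<Rightarrow>\<^sub>0 complex" where
  "symm p q = p * q + q * p"

lemma symm_diff: "symm (p - p') q = symm p q - symm p' q" "symm q (p - p') = symm q p - symm q p'"
  by (simp_all add: symm_def algebra_simps)

lemma symm_sc: "symm (sc c * p) q = sc c * symm p q" "symm q (sc c * p) = sc c * symm q p"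
proof -
  have "q * (sc c * p) = sc c * (q * p)"
    by (metis mult.assoc sc_commute)
  then show "symm (sc c * p) q = sc c * symm p q" "symm q (sc c * p) = sc c * symm q p"
    by (simp_all add: symm_def algebra_simps)
qed

lemma symm_sum: "symm (sum f E) q = (\<Sum>i\<in>E. symm (f i) q)" "symm q (sum f E) = (\<Sum>i\<in>E. symm q (f i))"
  by (simp_all add: symm_def sum_distrib_left sum_distrib_right sum.distrib)

lemma subst_symm: "subst v (symm p q) = symm (subst v p) (subst v q)"
  by (simp add: symm_def subst_simps)

lemma (in presentation) ad_rel_symm:
  assumes "ad_rel q p p'" "ad_rel q r r'"
  shows "ad_rel q (symm p r) (symm p' r + symm p r')"
  using ad_rel_add[OF ad_rel_mult[OF assms] ad_rel_mult[OF assms(2,1)]]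
  by (simp add: symm_def add_ac)

text \<open>Read as matrix identities, with \<open>B\<close> and \<open>C\<close> of sizes \<open>n\<close> by \<open>e\<close> and \<open>e\<close> by \<open>n\<close>: if a derivation sends
  \<open>B\<close> to \<open>B x' - x B\<close> and \<open>C\<close> to \<open>C x - x' C\<close>, then it sends \<open>Tr (y B C)\<close> to \<open>Tr ((x y - y x) B C)\<close>. The
  contributions of \<open>x'\<close> cancel, and cyclicity of the trace does the rest. The products
  of the entries of \<open>B\<close> and \<open>C\<close> are symmetrised, since these entries do not commute.\<close>
lemma symm_trace_invariance:
  fixes B C :: "nat \<Rightarrow> nat \<Rightarrow> 'x list \<Rightarrow>\<^sub>0 complex" and x y x' :: "nat \<Rightarrow> nat \<Rightarrow> complex"
  assumes DB: "\<And>k m. DB k m = (\<Sum>r<e. sc (x' r m) * B k r) - (\<Sum>r<n. sc (x k r) * B r m)"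
    and DC: "\<And>m l. DC m l = (\<Sum>r<n. sc (x r l) * C m r) - (\<Sum>r<e. sc (x' m r) * C r l)"
  shows "(\<Sum>k<n. \<Sum>l<n. sc (y l k) * (\<Sum>m<e. symm (DB k m) (C m l) + symm (B k m) (DC m l)))
    = (\<Sum>k<n. \<Sum>l<n. sc ((\<Sum>r<n. x l r * y r k) - (\<Sum>r<n. y l r * x r k)) *
        (\<Sum>m<e. symm (B k m) (C m l)))"
proof -
  define t where "t k l = (\<Sum>m<e. symm (B k m) (C m l))" for k l
  have inner: "(\<Sum>m<e. symm (DB k m) (C m l) + symm (B k m) (DC m l))
      = (\<Sum>r<n. sc (x r l) * t k r) - (\<Sum>r<n. sc (x k r) * t r l)" for k l
  proof -
    have "(\<Sum>m<e. \<Sum>r<e. sc (x' r m) * symm (B k r) (C m l))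
        = (\<Sum>m<e. \<Sum>r<e. sc (x' m r) * symm (B k m) (C r l))"
      by (rule sum.swap)
    moreover have "(\<Sum>m<e. \<Sum>r<n. sc (x k r) * symm (B r m) (C m l)) = (\<Sum>r<n. sc (x k r) * t r l)"
      unfolding t_def sum_distrib_left by (rule sum.swap)
    moreover have "(\<Sum>m<e. \<Sum>r<n. sc (x r l) * symm (B k m) (C m r)) = (\<Sum>r<n. sc (x r l) * t k r)"
      unfolding t_def sum_distrib_left by (rule sum.swap)
    ultimately show ?thesis
      unfolding DB DC
      by (simp add: symm_diff symm_sum symm_sc sum.distrib sum_subtractf)
  qed
  have 1: "(\<Sum>k<n. \<Sum>l<n. \<Sum>r<n. sc (y l k) * (sc (x r l) * t k r))
      = (\<Sum>k<n. \<Sum>l<n. \<Sum>r<n. sc (x l r * y r k) * t k l)"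
  proof (rule sum.cong[OF refl])
    fix k
    have "(\<Sum>l<n. \<Sum>r<n. sc (y l k) * (sc (x r l) * t k r))
        = (\<Sum>r<n. \<Sum>l<n. sc (y l k) * (sc (x r l) * t k r))"
      by (rule sum.swap)
    then show "(\<Sum>l<n. \<Sum>r<n. sc (y l k) * (sc (x r l) * t k r))
        = (\<Sum>l<n. \<Sum>r<n. sc (x l r * y r k) * t k l)"
      by (simp add: single_mult_single mult.commute flip: mult.assoc)
  qed
  have "(\<Sum>k<n. \<Sum>l<n. \<Sum>r<n. sc (y l k) * (sc (x k r) * t r l))
      = (\<Sum>k<n. \<Sum>r<n. \<Sum>l<n. sc (y l k) * (sc (x k r) * t r l))"
    by (rule sum.cong[OF refl], rule sum.swap)
  also have "\<dots> = (\<Sum>r<n. \<Sum>k<n. \<Sum>l<n. sc (y l k) * (sc (x k r) * t r l))"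
    by (rule sum.swap)
  also have "\<dots> = (\<Sum>r<n. \<Sum>l<n. \<Sum>k<n. sc (y l k) * (sc (x k r) * t r l))"
    by (rule sum.cong[OF refl], rule sum.swap)
  also have "\<dots> = (\<Sum>k<n. \<Sum>l<n. \<Sum>r<n. sc (y l r * x r k) * t k l)"
    by (simp add: single_mult_single flip: mult.assoc)
  finally have 2: "(\<Sum>k<n. \<Sum>l<n. \<Sum>r<n. sc (y l k) * (sc (x k r) * t r l))
      = (\<Sum>k<n. \<Sum>l<n. \<Sum>r<n. sc (y l r * x r k) * t k l)" .
  have sc_sum: "sc (sum f E) = (\<Sum>i\<in>E. sc (f i))" for f :: "nat \<Rightarrow> complex" and E
    by (induction E rule: infinite_finite_induct) (simp_all add: single_add)
  show ?thesis
    unfolding inner t_def[symmetric]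
    using 1 2
    by (simp add: right_diff_distrib left_diff_distrib sum_distrib_left sum_distrib_right
        sum_subtractf single_diff sc_sum)
qed

section \<open>The quantum comoment map\<close>

definition comoment_gen ::
    "('i \<Rightarrow> 'j) \<Rightarrow> ('i \<Rightarrow> nat) \<Rightarrow> ('j \<Rightarrow> cp1) \<Rightarrow> 'i hvar \<Rightarrow> 'i bvar list \<Rightarrow>\<^sub>0 complex" where
  "comoment_gen part d a = (\<lambda>(i, k, l). sc (1/2) *
     (\<Sum>\<alpha>\<in>{\<alpha> \<in> arrows part. snd \<alpha> = i}. sc (eps_arrow part a \<alpha>) *
       (\<Sum>m<d (fst \<alpha>). symm (gen (\<alpha>, k, m)) (gen (opp \<alpha>, m, l)))))"

text \<open>The quadratic tensor that represents the image of \<open>Tr (X \<cdot>)\<close> under the comoment map, with the sum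
  arranged by arrows rather than by nodes.\<close>
definition moment ::
    "('i \<Rightarrow> 'j) \<Rightarrow> ('i \<Rightarrow> nat) \<Rightarrow> ('j \<Rightarrow> cp1) \<Rightarrow> ('i \<Rightarrow> complex mat) \<Rightarrow> 'i bvar list \<Rightarrow>\<^sub>0 complex" where
  "moment part d a X = sc (1/2) * (\<Sum>\<alpha>\<in>arrows part. sc (eps_arrow part a \<alpha>) *
     (\<Sum>k<d (snd \<alpha>). \<Sum>l<d (snd \<alpha>). sc (X (snd \<alpha>) $$ (l, k)) *
       (\<Sum>m<d (fst \<alpha>). symm (gen (\<alpha>, k, m)) (gen (opp \<alpha>, m, l)))))"

text \<open>The entry \<open>(p, q)\<close> of \<open>B\<^sub>\<beta> X - X B\<^sub>\<beta>\<close>: the infinitesimal action of the change of bases on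
  representations of the quiver.\<close>
definition moment_action ::
    "('i \<Rightarrow> nat) \<Rightarrow> ('i \<Rightarrow> complex mat) \<Rightarrow> 'i bvar \<Rightarrow> 'i bvar list \<Rightarrow>\<^sub>0 complex" where
  "moment_action d X = (\<lambda>(\<beta>, p, q).
     (\<Sum>r<d (fst \<beta>). sc (X (fst \<beta>) $$ (r, q)) * gen (\<beta>, p, r))
     - (\<Sum>r<d (snd \<beta>). sc (X (snd \<beta>) $$ (p, r)) * gen (\<beta>, r, q)))"

lemma hvars_Sigma: "hvars d = (SIGMA i:UNIV. {..<d i} \<times> {..<d i})"
  by (auto simp: hvars_def)

lemma trace_form_eq: "trace_form d X = (\<Sum>(i, k, l)\<in>hvars d. sc (X i $$ (l, k)) * gen (i, k, l))"
  unfolding trace_form_def by (rule sum.cong) (auto simp: gen_def single_mult_single)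

lemma trace_form_in_tensors: "trace_form d X \<in> tensors (hvars d)"
  unfolding trace_form_eq by (intro tensors_sum) (auto intro!: tensors_closed)

lemma presentation_env: "presentation (hvars d) (env_rels d)"
proof
  show "env_rels d \<subseteq> tensors (hvars d)"
    unfolding env_rels_def
    by (force intro!: tensors_diff tensors_mult trace_form_in_tensors)
qed

interpretation env: presentation "hvars d" "env_rels d"
  by (rule presentation_env)

lemma subst_trace_form:
  fixes part :: "'i::finite \<Rightarrow> 'j"
  shows "subst (comoment_gen part d a) (trace_form d X) = moment part d a X"
proof -
  define t where "t \<alpha> k l = (\<Sum>m<d (fst \<alpha>). symm (gen (\<alpha>, k, m)) (gen (opp \<alpha>, m, l)))"
    for \<alpha> :: "'i arrow" and k l
  have "subst (comoment_gen part d a) (trace_form d X)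
      = (\<Sum>(i, k, l)\<in>hvars d. sc (X i $$ (l, k)) * comoment_gen part d a (i, k, l))"
    unfolding trace_form_eq subst_sum by (rule sum.cong) (auto simp: subst_mult)
  also have "\<dots> = (\<Sum>i\<in>UNIV. \<Sum>k<d i. \<Sum>l<d i. sc (X i $$ (l, k)) * comoment_gen part d a (i, k, l))"
    unfolding hvars_Sigma
    by (subst sum.Sigma[symmetric]) (simp_all add: sum.cartesian_product)
  also have "\<dots> = (\<Sum>i\<in>UNIV. \<Sum>k<d i. \<Sum>l<d i. \<Sum>\<alpha>\<in>{\<alpha> \<in> arrows part. snd \<alpha> = i}.
      sc (1/2) * (sc (eps_arrow part a \<alpha>) * (sc (X (snd \<alpha>) $$ (l, k)) * t \<alpha> k l)))"
  proof (intro sum.cong refl)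
    fix i k l
    have "sc c * (sc (1/2) * (sc e * u)) = sc (1/2) * (sc e * (sc c * u))"
      for c e and u :: "'i bvar list \<Rightarrow>\<^sub>0 complex"
      by (simp add: single_mult_single mult_ac flip: mult.assoc)
    then show "sc (X i $$ (l, k)) * comoment_gen part d a (i, k, l)
      = (\<Sum>\<alpha>\<in>{\<alpha> \<in> arrows part. snd \<alpha> = i}.
          sc (1/2) * (sc (eps_arrow part a \<alpha>) * (sc (X (snd \<alpha>) $$ (l, k)) * t \<alpha> k l)))"
      by (simp add: comoment_gen_def t_def[symmetric] sum_distrib_left)
  qed
  also have "\<dots> = (\<Sum>i\<in>UNIV. \<Sum>\<alpha>\<in>{\<alpha> \<in> arrows part. snd \<alpha> = i}. \<Sum>k<d (snd \<alpha>). \<Sum>l<d (snd \<alpha>).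
      sc (1/2) * (sc (eps_arrow part a \<alpha>) * (sc (X (snd \<alpha>) $$ (l, k)) * t \<alpha> k l)))"
  proof (rule sum.cong[OF refl])
    fix i
    let ?f = "\<lambda>\<alpha> k l. sc (1/2) * (sc (eps_arrow part a \<alpha>) * (sc (X (snd \<alpha>) $$ (l, k)) * t \<alpha> k l))"
    let ?A = "{\<alpha> \<in> arrows part. snd \<alpha> = i}"
    have "(\<Sum>k<d i. \<Sum>l<d i. \<Sum>\<alpha>\<in>?A. ?f \<alpha> k l) = (\<Sum>k<d i. \<Sum>\<alpha>\<in>?A. \<Sum>l<d i. ?f \<alpha> k l)"
      by (rule sum.cong[OF refl], rule sum.swap)
    also have "\<dots> = (\<Sum>\<alpha>\<in>?A. \<Sum>k<d i. \<Sum>l<d i. ?f \<alpha> k l)"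
      by (rule sum.swap)
    also have "\<dots> = (\<Sum>\<alpha>\<in>?A. \<Sum>k<d (snd \<alpha>). \<Sum>l<d (snd \<alpha>). ?f \<alpha> k l)"
      by (rule sum.cong) auto
    finally show "(\<Sum>k<d i. \<Sum>l<d i. \<Sum>\<alpha>\<in>?A. ?f \<alpha> k l)
      = (\<Sum>\<alpha>\<in>?A. \<Sum>k<d (snd \<alpha>). \<Sum>l<d (snd \<alpha>). ?f \<alpha> k l)" .
  qed
  also have "\<dots> = (\<Sum>\<alpha>\<in>arrows part. \<Sum>k<d (snd \<alpha>). \<Sum>l<d (snd \<alpha>).
      sc (1/2) * (sc (eps_arrow part a \<alpha>) * (sc (X (snd \<alpha>) $$ (l, k)) * t \<alpha> k l)))"
    by (rule sum.group) auto
  finally show ?thesis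
    by (simp add: moment_def t_def[symmetric] sum_distrib_left)
qed

lemma opp_opp [simp]: "opp (opp \<alpha>) = \<alpha>"
  and fst_opp [simp]: "fst (opp \<alpha>) = snd \<alpha>"
  and snd_opp [simp]: "snd (opp \<alpha>) = fst \<alpha>"
  by (simp_all add: opp_def)

lemma opp_in_arrows [simp]: "opp \<alpha> \<in> arrows part \<longleftrightarrow> \<alpha> \<in> arrows part"
  by (auto simp: arrows_def opp_def)

lemma eps_arrow_opp: "eps_arrow part a (opp \<alpha>) = - eps_arrow part a \<alpha>"
  unfolding eps_arrow_def eps_def by (simp add: eps_pt_swap[of "a (part (fst \<alpha>))"])

lemma gens_in_tensors:
  assumes "\<alpha> \<in> arrows part" "k < d (snd \<alpha>)" "l < d (fst \<alpha>)"
  shows "gen (\<alpha>, k, l) \<in> tensors (bvars part d)" "gen (opp \<alpha>, l, k) \<in> tensors (bvars part d)"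
  using assms by (auto simp: bvars_def intro!: gen_in_tensors)

lemma comoment_gen_in_tensor_le:
  assumes "x \<in> hvars d"
  shows "comoment_gen part d a x \<in> tensor_le (bvars part d) 2"
proof -
  obtain i k l where x: "x = (i, k, l)" "k < d i" "l < d i"
    using assms by (auto simp: hvars_def)
  have "gen u * gen v \<in> tensor_le Y 2" if "u \<in> Y" "v \<in> Y" for u v :: "'a bvar" and Y
    using that unfolding gen_def single_mult_single by (intro single_in_tensor_le) auto
  then show ?thesis
    unfolding x(1) comoment_gen_def symm_def prod.case
    using x(2,3)
    by (intro tensor_le_sc_mult tensor_le_sum tensor_le_add) (auto simp: bvars_def)
qed

lemma bracket_gen:
  fixes part :: "'i::finite \<Rightarrow> 'j"
  assumes "x \<in> bvars part d" "y \<in> bvars part d"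
  shows "bracket part d a (gen x) (gen y) = bracket_var part a x y"
proof -
  have "bracket part d a (gen x) (gen y) = (\<Sum>u\<in>bvars part d. \<Sum>v\<in>bvars part d.
      if x = u then (if y = v then bracket_var part a u v else 0) else 0)"
    unfolding bracket_def gen_def by (intro sum.cong refl) (simp add: lookup_single when_def)
  also have "\<dots> = (\<Sum>u\<in>bvars part d. if x = u then bracket_var part a u y else 0)"
    using assms(2) finite_bvars[of part d] by (intro sum.cong refl) simp
  finally show ?thesis
    using assms(1) finite_bvars[of part d] by simp
qed

lemma ad_rel_gen:
  fixes part :: "'i::finite \<Rightarrow> 'j"
  assumes "x \<in> bvars part d" "y \<in> bvars part d"
  shows "presentation.ad_rel (bvars part d) (weyl_rels part d a)
    (gen x) (gen y) (sc (bracket_var part a x y))"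
proof -
  have "gen x * gen y - gen y * gen x - sc (bracket_var part a x y) \<in> weyl_rels part d a"
    unfolding weyl_rels_def bracket_gen[OF assms, symmetric]
    using gen_in_lin_part[OF assms(1)] gen_in_lin_part[OF assms(2)] by blast
  then show ?thesis
    using assms by (simp add: weyl.ad_rel_def weyl.relation_mem gen_in_tensors single_in_tensors)
qed

text \<open>This collapses the sums over arrows and indices in which the bracket is a Kronecker symbol.\<close>
lemma sum_single:
  assumes "finite E" "i \<in> E" "\<And>j. j \<in> E \<Longrightarrow> j \<noteq> i \<Longrightarrow> f j = 0"
  shows "sum f E = f i"
  using assms by (simp add: sum.remove)

text \<open>A variable \<open>z\<close> of the arrow \<open>\<beta>\<close> has nonzero brackets only with variables of the opposite arrow.
  These occur in the moment in the summands for \<open>\<beta>\<close> and for its opposite, once for each end of \<open>\<beta>\<close>; there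
  the coefficient \<open>\<epsilon>\<close> cancels against the inverse \<open>\<epsilon>\<close> of the bracket.\<close>
lemma ad_rel_moment_gen:
  fixes part :: "'i::finite \<Rightarrow> 'j"
  assumes "inj a" "z \<in> bvars part d"
  shows "presentation.ad_rel (bvars part d) (weyl_rels part d a)
    (moment part d a X) (gen z) (moment_action d X z)"
proof -
  obtain \<beta> p q where z: "z = (\<beta>, p, q)" "\<beta> \<in> arrows part" "p < d (snd \<beta>)" "q < d (fst \<beta>)"
    using assms(2) by (auto simp: bvars_def)
  let ?b = "bracket_var part a z"
  \<comment> \<open>The two terms of the derivation on a product \<open>B\<^sub>\<alpha> B\<^bsub>\<alpha>*\<^esub>\<close>: \<open>F\<close> collects the brackets with the
    first factor and \<open>G\<close> those with the second. The commutator is first taken in the order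
    \<open>[z, moment]\<close>, where it is a derivation in the moment, and swapped afterwards.\<close>
  define F where "F \<alpha> = (\<Sum>k<d (snd \<alpha>). \<Sum>l<d (snd \<alpha>). sc (X (snd \<alpha>) $$ (l, k)) *
       (\<Sum>m<d (fst \<alpha>). sc (?b (\<alpha>, k, m)) * gen (opp \<alpha>, m, l)))" for \<alpha>
  define G where "G \<alpha> = (\<Sum>k<d (snd \<alpha>). \<Sum>l<d (snd \<alpha>). sc (X (snd \<alpha>) $$ (l, k)) *
       (\<Sum>m<d (fst \<alpha>). sc (?b (opp \<alpha>, m, l)) * gen (\<alpha>, k, m)))" for \<alpha>
  define E where "E = sc (1/2) * (\<Sum>\<alpha>\<in>arrows part. sc (eps_arrow part a \<alpha>) *
     (\<Sum>k<d (snd \<alpha>). \<Sum>l<d (snd \<alpha>). sc (X (snd \<alpha>) $$ (l, k)) *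
       (\<Sum>m<d (fst \<alpha>). symm (sc (?b (\<alpha>, k, m))) (gen (opp \<alpha>, m, l))
         + symm (gen (\<alpha>, k, m)) (sc (?b (opp \<alpha>, m, l))))))"
  have "presentation.ad_rel (bvars part d) (weyl_rels part d a) (gen z) (moment part d a X) E"
    unfolding moment_def E_def
    by (intro weyl.ad_rel_sc weyl.ad_rel_sum weyl.ad_rel_symm ad_rel_gen assms(2))
      (auto simp: bvars_def)
  then have E: "presentation.ad_rel (bvars part d) (weyl_rels part d a) (moment part d a X) (gen z) (- E)"
    by (rule weyl.ad_rel_swap) (rule gen_in_tensors[OF assms(2)])
  have symm: "symm (sc b) u = sc 2 * (sc b * u)" "symm u (sc b) = sc 2 * (sc b * u)"
    for b and u :: "'i bvar list \<Rightarrow>\<^sub>0 complex"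
  proof -
    have "sc b * u + sc b * u = sc (2 * b) * u"
      by (simp only: mult_2 single_add distrib_right)
    then show "symm (sc b) u = sc 2 * (sc b * u)" "symm u (sc b) = sc 2 * (sc b * u)"
      by (simp_all add: symm_def sc_commute[of b u, symmetric] single_mult_single flip: mult.assoc)
  qed
  have "E = (\<Sum>\<alpha>\<in>arrows part. sc (eps_arrow part a \<alpha>) * (F \<alpha> + G \<alpha>))"
  proof -
    have half: "sc (1/2) * (sc e * (sc 2 * u)) = sc e * u" for e and u :: "'i bvar list \<Rightarrow>\<^sub>0 complex"
      by (simp add: single_mult_single flip: mult.assoc)
    have two: "sc x * (sc 2 * u) = sc 2 * (sc x * u)" for x and u :: "'i bvar list \<Rightarrow>\<^sub>0 complex"
      by (simp add: single_mult_single mult.commute flip: mult.assoc)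
    have "(\<Sum>k<d (snd \<alpha>). \<Sum>l<d (snd \<alpha>). sc (X (snd \<alpha>) $$ (l, k)) *
       (\<Sum>m<d (fst \<alpha>). symm (sc (?b (\<alpha>, k, m))) (gen (opp \<alpha>, m, l))
         + symm (gen (\<alpha>, k, m)) (sc (?b (opp \<alpha>, m, l))))) = sc 2 * (F \<alpha> + G \<alpha>)" for \<alpha>
      unfolding F_def G_def symm
      by (simp add: two sum.distrib distrib_left flip: sum_distrib_left)
    then show ?thesis
      unfolding E_def by (simp add: half sum_distrib_left)
  qed
  then have E': "E = (\<Sum>\<alpha>\<in>arrows part. sc (eps_arrow part a \<alpha>) * F \<alpha>)
      + (\<Sum>\<alpha>\<in>arrows part. sc (eps_arrow part a \<alpha>) * G \<alpha>)"
    by (simp add: distrib_left sum.distrib)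
  have eps: "eps_arrow part a \<beta> \<noteq> 0"
    using z(2) eps_nonzero[OF assms(1)] by (simp add: eps_arrow_def arrows_def)
  have "F \<alpha> = 0" if "\<alpha> \<noteq> opp \<beta>" for \<alpha>
    using that by (auto simp: F_def z(1))
  then have "(\<Sum>\<alpha>\<in>arrows part. sc (eps_arrow part a \<alpha>) * F \<alpha>)
      = sc (eps_arrow part a (opp \<beta>)) * F (opp \<beta>)"
    by (intro sum_single) (simp_all add: z(2))
  moreover have "F (opp \<beta>) = (\<Sum>l<d (fst \<beta>). sc (X (fst \<beta>) $$ (l, q)) *
      (sc (inverse (eps_arrow part a \<beta>)) * gen (\<beta>, p, l)))"
  proof -
    have outer: "F (opp \<beta>) = (\<Sum>l<d (fst \<beta>). sc (X (fst \<beta>) $$ (l, q)) *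
       (\<Sum>m<d (snd \<beta>). sc (?b (opp \<beta>, q, m)) * gen (\<beta>, m, l)))"
      unfolding F_def opp_opp fst_opp snd_opp
      by (rule sum_single) (use z(4) in \<open>auto simp: z(1)\<close>)
    have inner: "(\<Sum>m<d (snd \<beta>). sc (?b (opp \<beta>, q, m)) * gen (\<beta>, m, l))
        = sc (?b (opp \<beta>, q, p)) * gen (\<beta>, p, l)" for l
      by (rule sum_single) (use z(3) in \<open>auto simp: z(1)\<close>)
    show ?thesis unfolding outer inner by (simp add: z(1))
  qed
  ultimately have F: "(\<Sum>\<alpha>\<in>arrows part. sc (eps_arrow part a \<alpha>) * F \<alpha>)
      = - (\<Sum>l<d (fst \<beta>). sc (X (fst \<beta>) $$ (l, q)) * gen (\<beta>, p, l))"
    using eps by (simp add: eps_arrow_opp sum_distrib_left single_mult_single single_uminus sum_negf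
        mult.commute[of _ "inverse _"] flip: mult.assoc)
  have "G \<alpha> = 0" if "\<alpha> \<noteq> \<beta>" for \<alpha>
  proof -
    have "opp \<beta> \<noteq> opp \<alpha>" using that by (metis opp_opp)
    then show ?thesis by (auto simp: G_def z(1))
  qed
  then have "(\<Sum>\<alpha>\<in>arrows part. sc (eps_arrow part a \<alpha>) * G \<alpha>) = sc (eps_arrow part a \<beta>) * G \<beta>"
    by (intro sum_single) (simp_all add: z(2))
  moreover have "G \<beta> = (\<Sum>k<d (snd \<beta>). sc (X (snd \<beta>) $$ (p, k)) *
      (sc (inverse (eps_arrow part a \<beta>)) * gen (\<beta>, k, q)))"
    unfolding G_def
  proof (rule sum.cong[OF refl])
    fix k
    have "(\<Sum>l<d (snd \<beta>). sc (X (snd \<beta>) $$ (l, k)) *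
       (\<Sum>m<d (fst \<beta>). sc (?b (opp \<beta>, m, l)) * gen (\<beta>, k, m)))
       = sc (X (snd \<beta>) $$ (p, k)) * (\<Sum>m<d (fst \<beta>). sc (?b (opp \<beta>, m, p)) * gen (\<beta>, k, m))"
      by (rule sum_single) (use z(3) in \<open>auto simp: z(1)\<close>)
    also have "(\<Sum>m<d (fst \<beta>). sc (?b (opp \<beta>, m, p)) * gen (\<beta>, k, m))
       = sc (?b (opp \<beta>, q, p)) * gen (\<beta>, k, q)"
      by (rule sum_single) (use z(4) in \<open>auto simp: z(1)\<close>)
    finally show "(\<Sum>l<d (snd \<beta>). sc (X (snd \<beta>) $$ (l, k)) *
       (\<Sum>m<d (fst \<beta>). sc (?b (opp \<beta>, m, l)) * gen (\<beta>, k, m)))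
       = sc (X (snd \<beta>) $$ (p, k)) * (sc (inverse (eps_arrow part a \<beta>)) * gen (\<beta>, k, q))"
      by (simp add: z(1))
  qed
  ultimately have G: "(\<Sum>\<alpha>\<in>arrows part. sc (eps_arrow part a \<alpha>) * G \<alpha>)
      = (\<Sum>k<d (snd \<beta>). sc (X (snd \<beta>) $$ (p, k)) * gen (\<beta>, k, q))"
    using eps by (simp add: sum_distrib_left single_mult_single
        mult.commute[of _ "inverse _"] flip: mult.assoc)
  have "- E = moment_action d X z"
    unfolding E' F G by (simp add: moment_action_def z(1))
  then show ?thesis using E by simp
qed

lemma commutator_index:
  assumes "X \<in> lie_h d" "Y \<in> lie_h d" "k < d i" "l < d i"
  shows "commutator X Y i $$ (l, k)
    = (\<Sum>r<d i. X i $$ (l, r) * Y i $$ (r, k)) - (\<Sum>r<d i. Y i $$ (l, r) * X i $$ (r, k))"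
proof -
  have "X i \<in> carrier_mat (d i) (d i)" "Y i \<in> carrier_mat (d i) (d i)"
    using assms by (auto simp: lie_h_def)
  then show ?thesis
    using assms(3,4) by (simp add: commutator_def scalar_prod_def lessThan_atLeast0)
qed

text \<open>The comoment map respects the Lie bracket: the derivation given by \<open>X\<close> acts on the generators in
  the moment of \<open>Y\<close> by the infinitesimal change of bases, under which the trace form of \<open>Y\<close> turns
  into that of \<open>[X, Y]\<close>.\<close>
lemma ad_rel_moment:
  fixes part :: "'i::finite \<Rightarrow> 'j"
  assumes "inj a" "X \<in> lie_h d" "Y \<in> lie_h d"
  shows "presentation.ad_rel (bvars part d) (weyl_rels part d a)
    (moment part d a X) (moment part d a Y) (moment part d a (commutator X Y))"
proof -
  let ?D = "moment_action d X"
  define E where "E = sc (1/2) * (\<Sum>\<alpha>\<in>arrows part. sc (eps_arrow part a \<alpha>) *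
     (\<Sum>k<d (snd \<alpha>). \<Sum>l<d (snd \<alpha>). sc (Y (snd \<alpha>) $$ (l, k)) *
       (\<Sum>m<d (fst \<alpha>). symm (?D (\<alpha>, k, m)) (gen (opp \<alpha>, m, l))
         + symm (gen (\<alpha>, k, m)) (?D (opp \<alpha>, m, l)))))"
  have "presentation.ad_rel (bvars part d) (weyl_rels part d a)
      (moment part d a X) (moment part d a Y) E"
    unfolding moment_def[of part d a Y] E_def
    by (intro weyl.ad_rel_sc weyl.ad_rel_sum weyl.ad_rel_symm ad_rel_moment_gen assms(1))
      (auto simp: bvars_def)
  moreover have "E = moment part d a (commutator X Y)"
  proof -
    have "(\<Sum>k<d (snd \<alpha>). \<Sum>l<d (snd \<alpha>). sc (Y (snd \<alpha>) $$ (l, k)) *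
       (\<Sum>m<d (fst \<alpha>). symm (?D (\<alpha>, k, m)) (gen (opp \<alpha>, m, l))
         + symm (gen (\<alpha>, k, m)) (?D (opp \<alpha>, m, l))))
      = (\<Sum>k<d (snd \<alpha>). \<Sum>l<d (snd \<alpha>). sc (commutator X Y (snd \<alpha>) $$ (l, k)) *
       (\<Sum>m<d (fst \<alpha>). symm (gen (\<alpha>, k, m)) (gen (opp \<alpha>, m, l))))" for \<alpha>
    proof -
      have "(\<Sum>k<d (snd \<alpha>). \<Sum>l<d (snd \<alpha>). sc (Y (snd \<alpha>) $$ (l, k)) *
         (\<Sum>m<d (fst \<alpha>). symm (?D (\<alpha>, k, m)) (gen (opp \<alpha>, m, l))
           + symm (gen (\<alpha>, k, m)) (?D (opp \<alpha>, m, l))))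
        = (\<Sum>k<d (snd \<alpha>). \<Sum>l<d (snd \<alpha>).
         sc ((\<Sum>r<d (snd \<alpha>). X (snd \<alpha>) $$ (l, r) * Y (snd \<alpha>) $$ (r, k))
           - (\<Sum>r<d (snd \<alpha>). Y (snd \<alpha>) $$ (l, r) * X (snd \<alpha>) $$ (r, k))) *
         (\<Sum>m<d (fst \<alpha>). symm (gen (\<alpha>, k, m)) (gen (opp \<alpha>, m, l))))"
        by (rule symm_trace_invariance[where x' = "\<lambda>r m. X (fst \<alpha>) $$ (r, m)"])
          (simp_all add: moment_action_def)
      also have "\<dots> = (\<Sum>k<d (snd \<alpha>). \<Sum>l<d (snd \<alpha>). sc (commutator X Y (snd \<alpha>) $$ (l, k)) *
         (\<Sum>m<d (fst \<alpha>). symm (gen (\<alpha>, k, m)) (gen (opp \<alpha>, m, l))))"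
        by (intro sum.cong refl) (simp add: commutator_index[OF assms(2,3)])
      finally show ?thesis .
    qed
    then show ?thesis by (simp add: E_def moment_def)
  qed
  ultimately show ?thesis by simp
qed

lemma comoment_gen_env_rels:
  fixes part :: "'i::finite \<Rightarrow> 'j"
  assumes "inj a" "s \<in> env_rels d"
  shows "subst (comoment_gen part d a) s \<in> relation_ideal (bvars part d) (weyl_rels part d a)"
proof -
  obtain X Y where XY: "X \<in> lie_h d" "Y \<in> lie_h d"
    "s = trace_form d X * trace_form d Y - trace_form d Y * trace_form d X
        - trace_form d (commutator X Y)"
    using assms(2) by (auto simp: env_rels_def)
  then show ?thesis
    using ad_rel_moment[OF assms(1) XY(1,2), of part]
    by (simp add: weyl.ad_rel_def subst_simps subst_trace_form)
qed

text \<open>Each summand is quadratic in an arrow and its opposite, with coefficient \<open>\<epsilon>\<^sub>\<alpha>\<close>. The two rescaling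
  factors are absorbed by this coefficient, and the comoment tensors at \<open>a.g\<close> and at \<open>a\<close> correspond
  exactly.\<close>
lemma rescale_comoment_gen:
  assumes "g \<in> SL2"
  shows "subst (rescale part g a) (comoment_gen part d (act a g) x) = comoment_gen part d a x"
proof -
  obtain i k l where x: "x = (i, k, l)" by (cases x)
  have "sc (eps_arrow part (act a g) \<alpha>) * symm (rescale part g a (\<alpha>, k, m)) (rescale part g a (opp \<alpha>, m, l))
      = sc (eps_arrow part a \<alpha>) * symm (gen (\<alpha>, k, m)) (gen (opp \<alpha>, m, l))" for \<alpha> m
  proof -
    have "eps_arrow part (act a g) \<alpha> * (eta g a (part (fst \<alpha>)) * eta g a (part (snd \<alpha>)))
        = eps_arrow part a \<alpha>"
      unfolding eps_arrow_def mult.commute[of "eta g a (part (fst \<alpha>))"]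
      by (rule eps_covariant[OF assms])
    then show ?thesis
      by (simp add: rescale_def symm_sc single_mult_single mult.assoc flip: mult.assoc[of "sc _"])
  qed
  then show ?thesis
    by (simp add: x comoment_gen_def subst_simps subst_symm sum_distrib_left)
qed

lemma comoment_eq:
  fixes part :: "'i::finite \<Rightarrow> 'j"
  assumes "inj a"
  shows "comoment part d a \<in> alg_hom (env d) (weyl part d a)"
    and "\<And>p. p \<in> tensors (hvars d) \<Longrightarrow>
      comoment part d a (pres_class (hvars d) (env_rels d) p)
      = pres_class (bvars part d) (weyl_rels part d a) (subst (comoment_gen part d a) p)"
proof -
  let ?cl = "pres_class (bvars part d) (weyl_rels part d a)"
  have v: "comoment_gen part d a x \<in> tensors (bvars part d)" if "x \<in> hvars d" for x
    using comoment_gen_in_tensor_le[OF that] tensor_le_subset by blast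
  let ?u = "\<lambda>(i, k, l). (1/2) \<odot>\<^bsub>weyl part d a\<^esub>
          (\<Oplus>\<^bsub>weyl part d a\<^esub>\<alpha>\<in>{\<alpha> \<in> arrows part. snd \<alpha> = i}.
             eps_arrow part a \<alpha> \<odot>\<^bsub>weyl part d a\<^esub>
               (\<Oplus>\<^bsub>weyl part d a\<^esub>m\<in>{..<d (fst \<alpha>)}.
                  Bhat part d a \<alpha> k m \<otimes>\<^bsub>weyl part d a\<^esub> Bhat part d a (opp \<alpha>) m l
                  \<oplus>\<^bsub>weyl part d a\<^esub>
                  Bhat part d a (opp \<alpha>) m l \<otimes>\<^bsub>weyl part d a\<^esub> Bhat part d a \<alpha> k m))"
  have u: "?u x = ?cl (comoment_gen part d a x)" if hv: "x \<in> hvars d" for x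
  proof -
    obtain i k l where x: "x = (i, k, l)" "k < d i" "l < d i"
      using hv by (auto simp: hvars_def)
    let ?P = "pres_alg (bvars part d) (weyl_rels part d a)"
    have t: "gen (\<alpha>, k, m) \<in> tensors (bvars part d)" "gen (opp \<alpha>, m, l) \<in> tensors (bvars part d)"
      if "\<alpha> \<in> {\<alpha> \<in> arrows part. snd \<alpha> = i}" "m \<in> {..<d (fst \<alpha>)}" for \<alpha> m
      using that x(2,3) gens_in_tensors[of \<alpha> part k d m] gens_in_tensors[of \<alpha> part l d m] by auto
    have s: "symm (gen (\<alpha>, k, m)) (gen (opp \<alpha>, m, l)) \<in> tensors (bvars part d)"
      if "\<alpha> \<in> {\<alpha> \<in> arrows part. snd \<alpha> = i}" "m \<in> {..<d (fst \<alpha>)}" for \<alpha> m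
      using t[OF that] by (simp add: symm_def tensors_closed)
    have 1: "(\<Oplus>\<^bsub>?P\<^esub>m\<in>{..<d (fst \<alpha>)}.
          ?cl (gen (\<alpha>, k, m)) \<otimes>\<^bsub>?P\<^esub> ?cl (gen (opp \<alpha>, m, l)) \<oplus>\<^bsub>?P\<^esub>
          ?cl (gen (opp \<alpha>, m, l)) \<otimes>\<^bsub>?P\<^esub> ?cl (gen (\<alpha>, k, m)))
        = ?cl (\<Sum>m<d (fst \<alpha>). symm (gen (\<alpha>, k, m)) (gen (opp \<alpha>, m, l)))"
      if a: "\<alpha> \<in> {\<alpha> \<in> arrows part. snd \<alpha> = i}" for \<alpha>
    proof -
      have "(\<Oplus>\<^bsub>?P\<^esub>m\<in>{..<d (fst \<alpha>)}.
          ?cl (gen (\<alpha>, k, m)) \<otimes>\<^bsub>?P\<^esub> ?cl (gen (opp \<alpha>, m, l)) \<oplus>\<^bsub>?P\<^esub>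
          ?cl (gen (opp \<alpha>, m, l)) \<otimes>\<^bsub>?P\<^esub> ?cl (gen (\<alpha>, k, m)))
        = (\<Oplus>\<^bsub>?P\<^esub>m\<in>{..<d (fst \<alpha>)}. ?cl (symm (gen (\<alpha>, k, m)) (gen (opp \<alpha>, m, l))))"
        by (rule weyl.P.finsum_cong')
          (auto simp: weyl.P_ops t[OF a] s[OF a] symm_def tensors_closed weyl.cl_in_carrier)
      also have "\<dots> = ?cl (\<Sum>m<d (fst \<alpha>). symm (gen (\<alpha>, k, m)) (gen (opp \<alpha>, m, l)))"
        by (rule weyl.P_finsum) (use s[OF a] in auto)
      finally show ?thesis .
    qed
    have 2: "(\<Sum>m<d (fst \<alpha>). symm (gen (\<alpha>, k, m)) (gen (opp \<alpha>, m, l))) \<in> tensors (bvars part d)"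
      if "\<alpha> \<in> {\<alpha> \<in> arrows part. snd \<alpha> = i}" for \<alpha>
      by (rule tensors_sum) (rule s[OF that])
    have "(\<Oplus>\<^bsub>?P\<^esub>\<alpha>\<in>{\<alpha> \<in> arrows part. snd \<alpha> = i}. eps_arrow part a \<alpha> \<odot>\<^bsub>?P\<^esub>
        (\<Oplus>\<^bsub>?P\<^esub>m\<in>{..<d (fst \<alpha>)}.
          ?cl (gen (\<alpha>, k, m)) \<otimes>\<^bsub>?P\<^esub> ?cl (gen (opp \<alpha>, m, l)) \<oplus>\<^bsub>?P\<^esub>
          ?cl (gen (opp \<alpha>, m, l)) \<otimes>\<^bsub>?P\<^esub> ?cl (gen (\<alpha>, k, m))))
      = (\<Oplus>\<^bsub>?P\<^esub>\<alpha>\<in>{\<alpha> \<in> arrows part. snd \<alpha> = i}. ?cl (sc (eps_arrow part a \<alpha>) *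
          (\<Sum>m<d (fst \<alpha>). symm (gen (\<alpha>, k, m)) (gen (opp \<alpha>, m, l)))))"
      by (rule weyl.P.finsum_cong')
        (auto simp: 1 2 weyl.P_ops tensors_closed weyl.cl_in_carrier)
    also have "\<dots> = ?cl (\<Sum>\<alpha>\<in>{\<alpha> \<in> arrows part. snd \<alpha> = i}. sc (eps_arrow part a \<alpha>) *
          (\<Sum>m<d (fst \<alpha>). symm (gen (\<alpha>, k, m)) (gen (opp \<alpha>, m, l))))"
      by (rule weyl.P_finsum) (auto simp: 2 tensors_closed)
    finally have 3: "(\<Oplus>\<^bsub>?P\<^esub>\<alpha>\<in>{\<alpha> \<in> arrows part. snd \<alpha> = i}. eps_arrow part a \<alpha> \<odot>\<^bsub>?P\<^esub>
        (\<Oplus>\<^bsub>?P\<^esub>m\<in>{..<d (fst \<alpha>)}.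
          ?cl (gen (\<alpha>, k, m)) \<otimes>\<^bsub>?P\<^esub> ?cl (gen (opp \<alpha>, m, l)) \<oplus>\<^bsub>?P\<^esub>
          ?cl (gen (opp \<alpha>, m, l)) \<otimes>\<^bsub>?P\<^esub> ?cl (gen (\<alpha>, k, m))))
      = ?cl (\<Sum>\<alpha>\<in>{\<alpha> \<in> arrows part. snd \<alpha> = i}. sc (eps_arrow part a \<alpha>) *
          (\<Sum>m<d (fst \<alpha>). symm (gen (\<alpha>, k, m)) (gen (opp \<alpha>, m, l))))" .
    have 4: "(\<Sum>\<alpha>\<in>{\<alpha> \<in> arrows part. snd \<alpha> = i}. sc (eps_arrow part a \<alpha>) *
          (\<Sum>m<d (fst \<alpha>). symm (gen (\<alpha>, k, m)) (gen (opp \<alpha>, m, l)))) \<in> tensors (bvars part d)"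
      by (intro tensors_sum tensors_mult single_in_tensors) (use s in auto)
    show ?thesis
      unfolding x(1) weyl_def Bhat_def comoment_gen_def prod.case 3 by (rule weyl.P_ops(3)[OF 4])
  qed
  note * = pres_hom_substitution[OF presentation_env presentation_weyl v
      comoment_gen_env_rels[OF assms] u]
  show "comoment part d a \<in> alg_hom (env d) (weyl part d a)"
    using *(1) by (simp add: comoment_def weyl_def env_def)
  show "comoment part d a (pres_class (hvars d) (env_rels d) p)
      = ?cl (subst (comoment_gen part d a) p)" if "p \<in> tensors (hvars d)" for p
    using *(2)[OF _ _ _ that] by (simp add: comoment_def weyl_def env_def)
qed

section \<open>Descent to the reductions\<close>

lemma comoment_filtered:
  fixes part :: "'i::finite \<Rightarrow> 'j"
  assumes "inj a" "x \<in> pres_le (hvars d) (env_rels d) k"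
  shows "comoment part d a x \<in> pres_le (bvars part d) (weyl_rels part d a) (2 * k)"
proof -
  obtain p where p: "p \<in> tensor_le (hvars d) k" "p \<in> tensors (hvars d)"
    "x = pres_class (hvars d) (env_rels d) p"
    using assms(2) by (rule env.filtE)
  have "subst (comoment_gen part d a) p \<in> tensor_le (bvars part d) (2 * k)"
    by (rule subst_tensor_le[OF comoment_gen_in_tensor_le p(1)])
  then show ?thesis
    unfolding p(3) comoment_eq(2)[OF assms(1) p(2)] by (rule weyl.filtI)
qed

lemma comoment_hbar_in_Ahat:
  fixes part :: "'i::finite \<Rightarrow> 'j"
  assumes "inj a" "f \<in> carrier (Uhat d)"
  shows "comoment_hbar part d a f \<in> carrier (Ahat part d a)"
  using rees_spread_in_carrier[OF presentation_env presentation_weyl _ comoment_filtered[OF assms(1)]]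
    assms(2)
  unfolding comoment_hbar_def Ahat_def Uhat_def weyl_def by simp

text \<open>The rescaling intertwines the comoment maps; on representatives both sides are the same
  substitution. Everything about descent follows from this identity.\<close>
lemma phi_comoment:
  fixes part :: "'i::finite \<Rightarrow> 'j"
  assumes "g \<in> SL2" "inj a" "x \<in> carrier (env d)"
  shows "phi part d g a (comoment part d (act a g) x) = comoment part d a x"
proof -
  obtain p where p: "p \<in> tensors (hvars d)" "x = pres_class (hvars d) (env_rels d) p"
    using assms(3) by (auto simp: env_def env.carrier_P)
  have q: "subst (comoment_gen part d (act a g)) p \<in> tensors (bvars part d)"
    by (rule subst_in_tensors[OF _ p(1)])
      (use comoment_gen_in_tensor_le tensor_le_subset in blast)
  show ?thesis
    unfolding p(2) comoment_eq(2)[OF act_inj[OF assms(1,2)] p(1)] phi_eq(2)[OF assms(1) q]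
      comoment_eq(2)[OF assms(2) p(1)]
    by (simp add: subst_subst rescale_comoment_gen[OF assms(1)])
qed

lemma Ahat_coeff: "x \<in> carrier (Ahat part d a) \<Longrightarrow> x k \<in> carrier (weyl part d a)"
  unfolding Ahat_def weyl_def by (rule weyl.filt_in_carrier[OF weyl.reesD(1)])

lemma Uhat_coeff: "x \<in> carrier (Uhat d) \<Longrightarrow> x k \<in> carrier (env d)"
  unfolding Uhat_def env_def by (rule env.filt_in_carrier[OF env.reesD(1)])

lemma phi_hbar_comoment_hbar:
  fixes part :: "'i::finite \<Rightarrow> 'j"
  assumes "g \<in> SL2" "inj a" "f \<in> carrier (Uhat d)"
  shows "phi_hbar part d g a (comoment_hbar part d (act a g) f) = comoment_hbar part d a f"
proof -
  have "phi part d g a \<zero>\<^bsub>weyl part d (act a g)\<^esub> = \<zero>\<^bsub>weyl part d a\<^esub>"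
  proof -
    interpret h: ring_hom_ring "weyl part d (act a g)" "weyl part d a" "phi part d g a"
      by (rule alg_hom_ring_hom_ring[OF _ _ phi_eq(1)[OF assms(1)]])
        (auto simp: weyl_def intro: weyl.P.ring_axioms)
    show ?thesis by simp
  qed
  then show ?thesis
    by (simp add: phi_hbar_def comoment_hbar_def phi_comoment[OF assms(1,2) Uhat_coeff[OF assms(3)]]
        fun_eq_iff)
qed

section \<open>Invariants\<close>

text \<open>The infinitesimal generators of the action, whose common commutant is the algebra of invariants.\<close>
definition moment_elements ::
    "('i \<Rightarrow> 'j) \<Rightarrow> ('i \<Rightarrow> nat) \<Rightarrow> ('j \<Rightarrow> cp1) \<Rightarrow> 'i bvar pres_elt set" where
  "moment_elements part d a =
     comoment part d a ` pres_class (hvars d) (env_rels d) ` lin_part (hvars d)"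

lemma lin_classes_in_env: "pres_class (hvars d) (env_rels d) ` lin_part (hvars d) \<subseteq> carrier (env d)"
  using lin_part_subset env.cl_in_carrier by (auto simp: env_def)

lemma moment_elements_subset:
  fixes part :: "'i::finite \<Rightarrow> 'j"
  assumes "inj a"
  shows "moment_elements part d a \<subseteq> carrier (weyl part d a)"
  unfolding moment_elements_def
  by (rule image_subsetI) (rule alg_homD(1)[OF comoment_eq(1)[OF assms] subsetD[OF lin_classes_in_env]])

lemma invariants_eq_commutant:
  fixes part :: "'i::finite \<Rightarrow> 'j"
  assumes "inj a"
  shows "invariants part d a
    = presentation.commutant (bvars part d) (weyl_rels part d a) (moment_elements part d a)"
proof -
  let ?L = "pres_class (hvars d) (env_rels d) ` lin_part (hvars d)"
  let ?W = "weyl part d a" and ?\<mu> = "comoment part d a"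
  have "?\<mu> \<Lambda> \<otimes>\<^bsub>?W\<^esub> x k \<ominus>\<^bsub>?W\<^esub> x k \<otimes>\<^bsub>?W\<^esub> ?\<mu> \<Lambda> = \<zero>\<^bsub>?W\<^esub> \<longleftrightarrow> ?\<mu> \<Lambda> \<otimes>\<^bsub>?W\<^esub> x k = x k \<otimes>\<^bsub>?W\<^esub> ?\<mu> \<Lambda>"
    if x: "x \<in> carrier (Ahat part d a)" and \<Lambda>: "\<Lambda> \<in> ?L" for x \<Lambda> k
  proof -
    have "?\<mu> \<Lambda> \<in> carrier ?W"
      using \<Lambda> lin_classes_in_env by (intro alg_homD(1)[OF comoment_eq(1)[OF assms]]) blast
    with Ahat_coeff[OF x, of k] show ?thesis
      unfolding weyl_def by (intro weyl.P.r_right_minus_eq weyl.P.m_closed)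
  qed
  then show ?thesis
    unfolding invariants_def weyl.commutant_def moment_elements_def ball_simps(9)
    by (intro Collect_cong conj_cong ball_cong refl) (simp_all add: Ahat_def weyl_def)
qed

lemma scaled_ring_Ahat: "scaled_ring (Ahat part d a)"
  unfolding Ahat_def by (rule weyl.rees.scaled_ring_axioms)

lemma scaled_ring_inv_alg:
  fixes part :: "'i::finite \<Rightarrow> 'j"
  assumes "inj a"
  shows "scaled_ring (inv_alg part d a)"
  using weyl.commutant_scaled_ring[OF moment_elements_subset[OF assms, unfolded weyl_def]]
  by (simp add: inv_alg_def Ahat_def invariants_eq_commutant[OF assms])

lemma invariants_subset: "invariants part d a \<subseteq> carrier (Ahat part d a)"
  by (auto simp: invariants_def)

section \<open>Ideals and reduced morphisms\<close>

lemma (in ring) ideal_Int_subring: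
  assumes "ring (R\<lparr>carrier := H\<rparr>)" "H \<subseteq> carrier R" "ideal J R"
  shows "ideal (J \<inter> H) (R\<lparr>carrier := H\<rparr>)"
proof -
  interpret J: ideal J R by fact
  interpret H: ring "R\<lparr>carrier := H\<rparr>" by fact
  have inv: "\<ominus>\<^bsub>R\<lparr>carrier := H\<rparr>\<^esub> x = \<ominus> x" if "x \<in> H" for x
  proof -
    have "\<ominus>\<^bsub>R\<lparr>carrier := H\<rparr>\<^esub> x \<in> carrier R" "\<ominus>\<^bsub>R\<lparr>carrier := H\<rparr>\<^esub> x \<oplus> x = \<zero>"
      using H.a_inv_closed[of x] H.l_neg[of x] that assms(2) by auto
    then show ?thesis
      using minus_equality[of "\<ominus>\<^bsub>R\<lparr>carrier := H\<rparr>\<^esub> x" x] that assms(2) by auto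
  qed
  show ?thesis
  proof (rule idealI)
    show "subgroup (J \<inter> H) (add_monoid (R\<lparr>carrier := H\<rparr>))"
    proof (rule H.add.subgroupI)
      have "\<zero> \<in> J \<inter> H"
        using H.zero_closed by simp
      then show "J \<inter> H \<noteq> {}" by blast
      show "\<ominus>\<^bsub>R\<lparr>carrier := H\<rparr>\<^esub> x \<in> J \<inter> H" if "x \<in> J \<inter> H" for x
        using that inv[of x] H.a_inv_closed[of x] J.a_inv_closed[of x] by auto
      show "x \<oplus>\<^bsub>R\<lparr>carrier := H\<rparr>\<^esub> y \<in> J \<inter> H" if "x \<in> J \<inter> H" "y \<in> J \<inter> H" for x y
        using that H.a_closed[of x y] J.a_closed[of x y] by auto
    qed auto
    show "x \<otimes>\<^bsub>R\<lparr>carrier := H\<rparr>\<^esub> y \<in> J \<inter> H" "y \<otimes>\<^bsub>R\<lparr>carrier := H\<rparr>\<^esub> x \<in> J \<inter> H"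
      if "y \<in> J \<inter> H" "x \<in> carrier (R\<lparr>carrier := H\<rparr>)" for x y
      using that H.m_closed[of x y] H.m_closed[of y x] J.I_l_closed[of y x] J.I_r_closed[of y x] assms(2)
      by auto
  qed (rule assms(1))
qed

abbreviation moment_ideal ::
    "('i \<Rightarrow> 'j) \<Rightarrow> ('i \<Rightarrow> nat) \<Rightarrow> (nat \<Rightarrow> 'i hvar pres_elt) set \<Rightarrow> ('j \<Rightarrow> cp1) \<Rightarrow>
     (nat \<Rightarrow> 'i bvar pres_elt) set" where
  "moment_ideal part d I a \<equiv> Idl\<^bsub>Ahat part d a\<^esub> (comoment_hbar part d a ` I)"

lemma ideal_moment_ideal:
  fixes part :: "'i::finite \<Rightarrow> 'j"
  assumes "inj a" "I \<subseteq> carrier (Uhat d)"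
  shows "ideal (moment_ideal part d I a) (Ahat part d a)"
proof -
  interpret A: scaled_ring "Ahat part d a" by (rule scaled_ring_Ahat)
  show ?thesis
    by (rule A.genideal_ideal) (use comoment_hbar_in_Ahat[OF assms(1)] assms(2) in auto)
qed

lemma ideal_red_ideal:
  fixes part :: "'i::finite \<Rightarrow> 'j"
  assumes "inj a" "I \<subseteq> carrier (Uhat d)"
  shows "ideal (red_ideal part d I a) (inv_alg part d a)"
proof -
  interpret A: scaled_ring "Ahat part d a" by (rule scaled_ring_Ahat)
  interpret B: scaled_ring "inv_alg part d a" by (rule scaled_ring_inv_alg[OF assms(1)])
  show ?thesis
    using A.ideal_Int_subring[OF B.ring_axioms[unfolded inv_alg_def] invariants_subset
        ideal_moment_ideal[OF assms]]
    by (simp add: red_ideal_def inv_alg_def)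
qed

text \<open>The preimage of the target ideal is an ideal, and it contains the generators of the source
  ideal because the rescaling intertwines the deformed comoment maps.\<close>
lemma phi_hbar_moment_ideal:
  fixes part :: "'i::finite \<Rightarrow> 'j"
  assumes "g \<in> SL2" "inj a" "I \<subseteq> carrier (Uhat d)"
  shows "phi_hbar part d g a ` moment_ideal part d I (act a g) \<subseteq> moment_ideal part d I a"
proof -
  interpret A: scaled_ring "Ahat part d a" by (rule scaled_ring_Ahat)
  interpret A': scaled_ring "Ahat part d (act a g)" by (rule scaled_ring_Ahat)
  interpret h: ring_hom_ring "Ahat part d (act a g)" "Ahat part d a" "phi_hbar part d g a"
    by (rule alg_hom_ring_hom_ring[OF A'.ring_axioms A.ring_axioms phi_hbar_alg_hom[OF assms(1)]])
  have sub: "comoment_hbar part d a ` I \<subseteq> moment_ideal part d I a"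
    by (rule A.genideal_self) (use comoment_hbar_in_Ahat[OF assms(2)] assms(3) in auto)
  have "moment_ideal part d I (act a g)
      \<subseteq> {x \<in> carrier (Ahat part d (act a g)). phi_hbar part d g a x \<in> moment_ideal part d I a}"
  proof (rule A'.genideal_minimal[OF h.ideal_vimage[OF ideal_moment_ideal[OF assms(2,3)]]])
    show "comoment_hbar part d (act a g) ` I
      \<subseteq> {x \<in> carrier (Ahat part d (act a g)). phi_hbar part d g a x \<in> moment_ideal part d I a}"
      using comoment_hbar_in_Ahat[OF act_inj[OF assms(1,2)]] sub assms(3)
        phi_hbar_comoment_hbar[OF assms(1,2)] by force
  qed
  then show ?thesis by auto
qed

lemma phi_hbar_invariants:
  fixes part :: "'i::finite \<Rightarrow> 'j"
  assumes "g \<in> SL2" "inj a" "x \<in> invariants part d (act a g)"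
  shows "phi_hbar part d g a x \<in> invariants part d a"
proof -
  have x: "x \<in> carrier (Ahat part d (act a g))"
    using assms(3) invariants_subset by auto
  note hD = alg_homD[OF phi_eq(1)[OF assms(1)]]
  have "comoment part d a \<Lambda> \<otimes>\<^bsub>weyl part d a\<^esub> phi part d g a (x k)
      = phi part d g a (x k) \<otimes>\<^bsub>weyl part d a\<^esub> comoment part d a \<Lambda>"
    if \<Lambda>: "\<Lambda> \<in> pres_class (hvars d) (env_rels d) ` lin_part (hvars d)" for \<Lambda> k
  proof -
    let ?m = "comoment part d (act a g) \<Lambda>"
    have m: "?m \<in> moment_elements part d (act a g)"
      using \<Lambda> by (auto simp: moment_elements_def)
    have c: "?m \<in> carrier (weyl part d (act a g))" "x k \<in> carrier (weyl part d (act a g))"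
      using m moment_elements_subset[OF act_inj[OF assms(1,2)]] Ahat_coeff[OF x] by blast+
    have "?m \<otimes>\<^bsub>weyl part d (act a g)\<^esub> x k = x k \<otimes>\<^bsub>weyl part d (act a g)\<^esub> ?m"
      using assms(3) m unfolding invariants_eq_commutant[OF act_inj[OF assms(1,2)]]
      by (simp add: weyl.commutant_def weyl_def)
    then have "phi part d g a ?m \<otimes>\<^bsub>weyl part d a\<^esub> phi part d g a (x k)
        = phi part d g a (x k) \<otimes>\<^bsub>weyl part d a\<^esub> phi part d g a ?m"
      using hD(2)[OF c] hD(2)[OF c(2,1)] by simp
    moreover have "phi part d g a ?m = comoment part d a \<Lambda>"
      using \<Lambda> lin_classes_in_env by (intro phi_comoment[OF assms(1,2)]) auto
    ultimately show ?thesis by simp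
  qed
  moreover have "phi_hbar part d g a x \<in> carrier (Ahat part d a)"
    by (rule alg_homD(1)[OF phi_hbar_alg_hom[OF assms(1)] x])
  ultimately show ?thesis
    unfolding invariants_eq_commutant[OF assms(2)] weyl.commutant_def
    by (auto simp: moment_elements_def Ahat_def weyl_def phi_hbar_def)
qed

lemma phi_hbar_inv_alg_hom:
  fixes part :: "'i::finite \<Rightarrow> 'j"
  assumes "g \<in> SL2" "inj a"
  shows "phi_hbar part d g a \<in> alg_hom (inv_alg part d (act a g)) (inv_alg part d a)"
  by (rule alg_homI)
    (simp_all add: inv_alg_def alg_homD[OF phi_hbar_alg_hom[OF assms(1)]]
      subsetD[OF invariants_subset] phi_hbar_invariants[OF assms])

text \<open>The deformed morphism preserves invariants and the ideals that are divided out, so it descends.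
  The projection is surjective, and functions on the reduction are taken to be undefined outside
  its carrier; this leaves one choice.\<close>
lemma reduced_morphism_unique:
  fixes part :: "'i::finite \<Rightarrow> 'j"
  assumes "g \<in> SL2" "inj a" "I \<subseteq> carrier (Uhat d)"
  shows "\<exists>!F. is_reduced_morphism part d I g a F"
proof -
  have "phi_hbar part d g a ` red_ideal part d I (act a g) \<subseteq> red_ideal part d I a"
    using phi_hbar_moment_ideal[OF assms] phi_hbar_invariants[OF assms(1,2)]
    by (auto simp: red_ideal_def)
  from induced_alg_hom_unique[OF scaled_ring_inv_alg[OF act_inj[OF assms(1,2)]]
      scaled_ring_inv_alg[OF assms(2)] ideal_red_ideal[OF act_inj[OF assms(1,2)] assms(3)]
      ideal_red_ideal[OF assms(2,3)] phi_hbar_inv_alg_hom[OF assms(1,2)] this]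
  show ?thesis
    by (simp add: is_reduced_morphism_def reduction_def red_proj_def inv_alg_def)
qed

lemma reduced_morphism:
  fixes part :: "'i::finite \<Rightarrow> 'j"
  assumes "g \<in> SL2" "inj a" "I \<subseteq> carrier (Uhat d)"
  shows "is_reduced_morphism part d I g a (reduced_morphism part d I g a)"
  unfolding reduced_morphism_def by (rule theI'[OF reduced_morphism_unique[OF assms]])

lemma phi_hbar_mult:
  fixes part :: "'i::finite \<Rightarrow> 'j"
  assumes "g \<in> SL2" "h \<in> SL2" "x \<in> carrier (Ahat part d (act (act a g) h))"
  shows "phi_hbar part d (g * h) a x = phi_hbar part d g a (phi_hbar part d h (act a g) x)"
proof -
  have "x k \<in> carrier (weyl part d (act a (g * h)))" for k
    unfolding act_mult[OF assms(1,2)] by (rule Ahat_coeff[OF assms(3)])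
  then show ?thesis
    by (simp add: phi_hbar_def phi_mult[OF assms(1,2)])
qed

lemma alg_hom_compose:
  assumes "scaled_ring A" "f \<in> alg_hom A B" "h \<in> alg_hom B C"
  shows "compose (carrier A) h f \<in> alg_hom A C"
proof -
  interpret A: scaled_ring A by fact
  show ?thesis
    by (rule alg_homI) (simp_all add: compose_def alg_homD[OF assms(2)] alg_homD[OF assms(3)] A.smult_closed)
qed

text \<open>The composite has the property that characterises the reduced morphism of the product, because
  the rescaling factors form a cocycle and the unreduced morphisms therefore compose.\<close>
lemma is_reduced_morphism_compose:
  fixes part :: "'i::finite \<Rightarrow> 'j"
  assumes "g \<in> SL2" "h \<in> SL2" "inj a" "I \<subseteq> carrier (Uhat d)"
    and F: "is_reduced_morphism part d I g a F" and G: "is_reduced_morphism part d I h (act a g) G"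
  shows "is_reduced_morphism part d I (g * h) a
    (compose (carrier (reduction part d I (act (act a g) h))) F G)"
proof -
  let ?b = "act (act a g) h"
  let ?R = "reduction part d I ?b"
  have inj: "inj (act a g)" "inj ?b"
    using assms(1-3) by (auto intro: act_inj)
  interpret B: scaled_ring "inv_alg part d ?b"
    by (rule scaled_ring_inv_alg[OF inj(2)])
  have "compose (carrier ?R) F G \<in> alg_hom ?R (reduction part d I a)"
  proof (rule alg_hom_compose)
    show "scaled_ring ?R"
      unfolding reduction_def by (rule B.alg_quot_scaled_ring[OF ideal_red_ideal[OF inj(2) assms(4)]])
    show "G \<in> alg_hom ?R (reduction part d I (act a g))"
      using G by (simp add: is_reduced_morphism_def)
    show "F \<in> alg_hom (reduction part d I (act a g)) (reduction part d I a)"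
      using F by (simp add: is_reduced_morphism_def)
  qed
  moreover have "compose (carrier ?R) F G (red_proj part d I ?b x)
      = red_proj part d I a (phi_hbar part d (g * h) a x)" if x: "x \<in> invariants part d ?b" for x
  proof -
    have "red_proj part d I ?b x \<in> carrier ?R"
      unfolding reduction_def B.alg_quot_carrier red_proj_def
      using x by (intro imageI) (simp add: inv_alg_def)
    then have "compose (carrier ?R) F G (red_proj part d I ?b x) = F (G (red_proj part d I ?b x))"
      by (simp add: compose_def)
    also have "G (red_proj part d I ?b x) = red_proj part d I (act a g) (phi_hbar part d h (act a g) x)"
      using G x by (simp add: is_reduced_morphism_def)
    also have "F \<dots> = red_proj part d I a (phi_hbar part d g a (phi_hbar part d h (act a g) x))"
      using F phi_hbar_invariants[OF assms(2) inj(1) x] by (simp add: is_reduced_morphism_def)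
    also have "phi_hbar part d g a (phi_hbar part d h (act a g) x) = phi_hbar part d (g * h) a x"
      using x invariants_subset by (intro phi_hbar_mult[OF assms(1,2), symmetric]) auto
    finally show ?thesis .
  qed
  ultimately show ?thesis
    by (simp add: is_reduced_morphism_def act_mult[OF assms(1,2)])
qed

theorem theorem7p16:
  fixes part :: "'i::finite \<Rightarrow> 'j::finite"
    and d :: "'i \<Rightarrow> nat"
    and a :: "'j \<Rightarrow> cp1"
    and g :: "complex mat"
    and Orb :: "('i \<Rightarrow> complex mat) set"
    and I :: "(nat \<Rightarrow> 'i hvar pres_elt) set"
  assumes "inj a"
    and "g \<in> SL2"
    and "\<exists>X\<in>lie_h d. Orb = adjoint_orbit d X"
    and "deforms d I Orb"
  shows "(\<exists>!F. is_reduced_morphism part d I g a F) \<and>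
    (\<forall>g'\<in>SL2.
       reduced_morphism part d I (g * g') a =
       compose (carrier (reduction part d I (act (act a g) g')))
         (reduced_morphism part d I g a)
         (reduced_morphism part d I g' (act a g)))"
proof -
  interpret I: ideal I "Uhat d"
    using assms(4) by (simp add: deforms_def)
  have I: "I \<subseteq> carrier (Uhat d)"
    by (rule I.a_subset)
  show ?thesis
  proof (intro conjI ballI)
    show "\<exists>!F. is_reduced_morphism part d I g a F"
      by (rule reduced_morphism_unique[OF assms(2,1) I])
    fix g' assume g': "g' \<in> SL2"
    show "reduced_morphism part d I (g * g') a =
       compose (carrier (reduction part d I (act (act a g) g')))
         (reduced_morphism part d I g a) (reduced_morphism part d I g' (act a g))"
      unfolding reduced_morphism_def[of part d I "g * g'"]
      by (intro the1_equality reduced_morphism_unique SL2_mult_closed is_reduced_morphism_compose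
          reduced_morphism act_inj assms(1,2) g' I)
  qed
qed

end
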